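(* Let $u_0$ be an axisymmetric, swirl-free, divergence-free initial velocity on $\mathbb{R}^3$ with scalar vorticity $\omega_0$, such that $u_0\in L^2(\mathbb{R}^3)$ and $\omega_0,\ \omega_0/r\in L^1(\mathbb{R}^3)\cap L^\infty(\mathbb{R}^3)$, and let $(u,\omega)$ be the corresponding global-in-time solution of the axisymmetric Euler equations without swirl. Assume in addition that $P_2(0)<\infty$. Then: (i) for each integer $k\ge 2$, if $P_k(0)<\infty$, there is a constant $C(k,\omega_0,u_0)$, depending only on $k$ and the initial data, such that $$P_k(t)\le C(k,\omega_0,u_0)\,(1+t)^{\frac43 k-\frac23}\quad\text{for all } t\ge 0;$$ (ii) there is a constant $C(\omega_0,u_0)$, depending only on the initial data, such that for all $t\ge 0$ $$\|u_r(\cdot,t)\|_{L^\infty(\mathbb{R}^3)}\le C(\omega_0,u_0)(1+t)^{1/3}\quad\text{and}\quad \|\omega(\cdot,t)\|_{L^\infty(\mathbb{R}^3)}\le C(\omega_0,u_0)(1+t)^{4/3}.$$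
   Context: Use cylindrical coordinates $(r,\theta,z)$ in $\mathbb{R}^3$ and the half plane $\Pi=\{(r,z): r\ge 0,\ z\in\mathbb{R}\}$. An axisymmetric velocity without swirl has the form $u=u_r(r,z,t)e_r+u_z(r,z,t)e_z$. Its scalar vorticity is $\omega=-\partial_z u_r+\partial_r u_z$ (this sign convention is used throughout; $\omega_0$ is the scalar vorticity of $u_0$). Functions of $(r,z)$ are identified with axisymmetric functions on $\mathbb{R}^3$. The axisymmetric Euler equations without swirl are $$(\partial_t+u_r\partial_r+u_z\partial_z)\frac{\omega}{r}=0,$$ where $u$ is recovered from $\omega$ by the axisymmetric Biot–Savart law $u_r=\frac1r\partial_z\psi$, $u_z=-\frac1r\partial_r\psi$, $$\psi(r,z,t)=\frac1{2\pi}\iint_\Pi\sqrt{r\bar r}\,F\Big(\frac{(r-\bar r)^2+(z-\bar z)^2}{r\bar r}\Big)\omega(\bar r,\bar z,t)\,d\bar r\,d\bar z,\qquad F(s)=\int_0^\pi\frac{\cos\theta}{(2(1-\cos\theta)+s)^{1/2}}\,d\theta .$$ For initial data with $u_0\in L^2(\mathbb{R}^3)$ and $\omega_0,\omega_0/r\in L^1\cap L^\infty(\mathbb{R}^3)$ a global-in-time solution is known to exist (Danchin); $\omega/r$ is transported along particle trajectories, so $\|\omega/r\|_{L^p(\mathbb{R}^3)}$ is conserved for $1\le p\le\infty$, and the kinetic energy $\frac12\int_{\mathbb{R}^3}|u|^2dx$ is conserved. For $k\in\mathbb{N}$, the $k$-th radial moment is $P_k(t)=\iint_\Pi r^k|\omega(r,z,t)|\,dr\,dz$.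 *)

theory Defs
  imports "HOL-Probability.Probability" "HOL-Probability.Essential_Supremum"
begin

text \<open>
  Points of the half plane are pairs \<open>(r, z)\<close> of type \<open>real \<times> real\<close>. A function \<open>f\<close> of
  \<open>(r, z)\<close> is identified with the axisymmetric function \<open>f \<circ> cyl\<close> on \<open>\<real>\<^sup>3\<close>, so all Lebesgue
  norms below are genuine norms on \<open>\<real>\<^sup>3\<close>. Representatives are always taken Borel measurable.
  Values on the axis \<open>r = 0\<close>, a null set, carry no information.
\<close>

definition half_plane :: "(real \<times> real) set" where
  "half_plane = {p. 0 \<le> fst p}"

definition open_half_plane :: "(real \<times> real) set" where
  "open_half_plane = {p. 0 < fst p}"

definition cyl :: "real^3 \<Rightarrow> real \<times> real" where
  "cyl x = (sqrt ((x $ 1)\<^sup>2 + (x $ 2)\<^sup>2), x $ 3)"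

definition e_r :: "real^3 \<Rightarrow> real^3" where
  "e_r x = (1 / fst (cyl x)) *\<^sub>R vector [x $ 1, x $ 2, 0]"

definition e_z :: "real^3" where
  "e_z = axis 3 1"

definition axisym_velocity ::
  "(real \<times> real \<Rightarrow> real) \<Rightarrow> (real \<times> real \<Rightarrow> real) \<Rightarrow> real^3 \<Rightarrow> real^3" where
  "axisym_velocity ur uz x = ur (cyl x) *\<^sub>R e_r x + uz (cyl x) *\<^sub>R e_z"

definition in_L1 :: "(real^3 \<Rightarrow> real) \<Rightarrow> bool" where
  "in_L1 f \<longleftrightarrow> integrable lborel f"

definition in_L2 :: "(real^3 \<Rightarrow> real^3) \<Rightarrow> bool" where
  "in_L2 v \<longleftrightarrow> v \<in> borel_measurable lborel \<and> integrable lborel (\<lambda>x. (norm (v x))\<^sup>2)"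

text \<open>The library's \<open>esssup\<close> is \<open>\<infinity>\<close> on non-measurable functions.\<close>

definition Linf_norm :: "(real^3 \<Rightarrow> real) \<Rightarrow> ereal" where
  "Linf_norm f = esssup lborel (\<lambda>x. ereal \<bar>f x\<bar>)"

definition in_Linf :: "(real^3 \<Rightarrow> real) \<Rightarrow> bool" where
  "in_Linf f \<longleftrightarrow> f \<in> borel_measurable lborel \<and> Linf_norm f < \<infinity>"

definition kinetic_energy :: "(real^3 \<Rightarrow> real^3) \<Rightarrow> ennreal" where
  "kinetic_energy v = (\<integral>\<^sup>+ x. ennreal ((norm (v x))\<^sup>2 / 2) \<partial>lborel)"

definition radial_moment :: "nat \<Rightarrow> (real \<times> real \<Rightarrow> real) \<Rightarrow> ennreal" where
  "radial_moment k w = (\<integral>\<^sup>+ p\<in>half_plane. ennreal (fst p ^ k * \<bar>w p\<bar>) \<partial>lborel)"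

text \<open>\<open>\<phi>\<close> is continuously differentiable with gradient \<open>g\<close> and compact support inside \<open>S\<close>.\<close>

definition test_function ::
  "'a::euclidean_space set \<Rightarrow> ('a \<Rightarrow> real) \<Rightarrow> ('a \<Rightarrow> 'a) \<Rightarrow> bool" where
  "test_function S \<phi> g \<longleftrightarrow>
     (\<forall>x. (\<phi> has_derivative (\<lambda>h. g x \<bullet> h)) (at x)) \<and> continuous_on UNIV g \<and>
     (\<exists>K. compact K \<and> K \<subseteq> S \<and> (\<forall>x. x \<notin> K \<longrightarrow> \<phi> x = 0))"

text \<open>
  The initial velocity is only square integrable, so its divergence and its scalar vorticity are
  taken in the sense of distributions.
\<close>

definition divergence_free :: "(real^3 \<Rightarrow> real^3) \<Rightarrow> bool" where
  "divergence_free v \<longleftrightarrow>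
     (\<forall>\<phi> g. test_function UNIV \<phi> g \<longrightarrow> (LINT x|lborel. v x \<bullet> g x) = 0)"

text \<open>\<open>\<omega> = - \<partial>\<^sub>z u\<^sub>r + \<partial>\<^sub>r u\<^sub>z\<close>, integrated by parts against \<open>\<phi>\<close>; here \<open>g = (\<partial>\<^sub>r \<phi>, \<partial>\<^sub>z \<phi>)\<close>.\<close>

definition scalar_vorticity ::
  "(real \<times> real \<Rightarrow> real) \<Rightarrow> (real \<times> real \<Rightarrow> real) \<Rightarrow> (real \<times> real \<Rightarrow> real) \<Rightarrow> bool" where
  "scalar_vorticity ur uz w \<longleftrightarrow>
     (\<forall>\<phi> g. test_function open_half_plane \<phi> g \<longrightarrow>
        (LINT p:open_half_plane|lborel. w p * \<phi> p) =
        (LINT p:open_half_plane|lborel. ur p * snd (g p) - uz p * fst (g p)))"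

definition rel_vorticity :: "(real \<times> real \<Rightarrow> real) \<Rightarrow> real \<times> real \<Rightarrow> real" where
  "rel_vorticity w p = w p / fst p"

definition initial_data ::
  "(real \<times> real \<Rightarrow> real) \<Rightarrow> (real \<times> real \<Rightarrow> real) \<Rightarrow> (real \<times> real \<Rightarrow> real) \<Rightarrow> bool" where
  "initial_data ur0 uz0 w0 \<longleftrightarrow>
     ur0 \<in> borel_measurable borel \<and> uz0 \<in> borel_measurable borel \<and> w0 \<in> borel_measurable borel \<and>
     in_L2 (axisym_velocity ur0 uz0) \<and>
     divergence_free (axisym_velocity ur0 uz0) \<and>
     scalar_vorticity ur0 uz0 w0 \<and>
     in_L1 (w0 \<circ> cyl) \<and> in_Linf (w0 \<circ> cyl) \<and>
     in_L1 (rel_vorticity w0 \<circ> cyl) \<and> in_Linf (rel_vorticity w0 \<circ> cyl)"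

definition BS_kernel :: "real \<Rightarrow> real" where
  "BS_kernel s = integral {0..pi} (\<lambda>\<theta>. cos \<theta> / sqrt (2 * (1 - cos \<theta>) + s))"

definition stream_function :: "(real \<times> real \<Rightarrow> real) \<Rightarrow> real \<times> real \<Rightarrow> real" where
  "stream_function w p = 1 / (2 * pi) *
     (LINT q:half_plane|lborel.
        sqrt (fst p * fst q) *
        BS_kernel (((fst p - fst q)\<^sup>2 + (snd p - snd q)\<^sup>2) / (fst p * fst q)) * w q)"

text \<open>\<open>u\<^sub>r = \<partial>\<^sub>z \<psi> / r\<close> and \<open>u\<^sub>z = - \<partial>\<^sub>r \<psi> / r\<close>, pointwise off the axis.\<close>

definition biot_savart ::
  "(real \<times> real \<Rightarrow> real) \<Rightarrow> (real \<times> real \<Rightarrow> real) \<Rightarrow> (real \<times> real \<Rightarrow> real) \<Rightarrow> bool" where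
  "biot_savart w ur uz \<longleftrightarrow>
     (\<forall>r>0. \<forall>z.
        ((\<lambda>z'. stream_function w (r, z')) has_real_derivative r * ur (r, z)) (at z) \<and>
        ((\<lambda>r'. stream_function w (r', z)) has_real_derivative - (r * uz (r, z))) (at r))"

text \<open>The volume of \<open>\<real>\<^sup>3\<close> in cylindrical coordinates, \<open>r dr dz\<close>, up to the factor \<open>2\<pi>\<close>.\<close>

definition cyl_measure :: "(real \<times> real) measure" where
  "cyl_measure = density (restrict_space lborel open_half_plane) (\<lambda>p. ennreal (fst p))"

text \<open>
  Distributional form of \<open>(\<partial>\<^sub>t + u\<^sub>r \<partial>\<^sub>r + u\<^sub>z \<partial>\<^sub>z) (\<omega>/r) = 0\<close>, \<open>\<omega>/r = \<omega>\<^sub>0/r\<close> at \<open>t = 0\<close>, with respect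
  to \<open>r dr dz dt\<close>; the transport term may be integrated by parts because
  \<open>\<partial>\<^sub>r (r u\<^sub>r) + \<partial>\<^sub>z (r u\<^sub>z) = 0\<close>. Here \<open>g = (\<partial>\<^sub>t \<phi>, \<partial>\<^sub>r \<phi>, \<partial>\<^sub>z \<phi>)\<close>, and \<open>\<phi>\<close> need not vanish at \<open>t = 0\<close>.
\<close>

definition weak_transport ::
  "(real \<times> real \<Rightarrow> real) \<Rightarrow>
   (real \<Rightarrow> real \<times> real \<Rightarrow> real) \<Rightarrow> (real \<Rightarrow> real \<times> real \<Rightarrow> real) \<Rightarrow>
   (real \<Rightarrow> real \<times> real \<Rightarrow> real) \<Rightarrow> bool" where
  "weak_transport w0 ur uz w \<longleftrightarrow>
     (\<forall>(\<phi> :: real \<times> real \<times> real \<Rightarrow> real) g. test_function (UNIV \<times> open_half_plane) \<phi> g \<longrightarrow>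
        (LINT t:{0..}|lborel. LINT p|cyl_measure.
           rel_vorticity (w t) p *
           (fst (g (t, p)) + ur t p * fst (snd (g (t, p))) + uz t p * snd (snd (g (t, p)))))
        + (LINT p|cyl_measure. rel_vorticity w0 p * \<phi> (0, p)) = 0)"

text \<open>
  Particle trajectories of the (incompressible) velocity: \<open>X t p\<close> is the position at time \<open>t\<close> of
  the particle that starts at \<open>p\<close>. As in the notion of a regular Lagrangian flow, the
  preservation of volume is part of the notion of flow.
\<close>

definition particle_flow ::
  "(real \<Rightarrow> real \<times> real \<Rightarrow> real) \<Rightarrow> (real \<Rightarrow> real \<times> real \<Rightarrow> real) \<Rightarrow>
   (real \<Rightarrow> real \<times> real \<Rightarrow> real \<times> real) \<Rightarrow> bool" where
  "particle_flow ur uz X \<longleftrightarrow>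
     (\<forall>p\<in>open_half_plane. X 0 p = p \<and>
        (\<forall>t\<ge>0. X t p \<in> open_half_plane \<and>
           ((\<lambda>s. X s p) has_vector_derivative (ur t (X t p), uz t (X t p))) (at t within {0..}))) \<and>
     (\<forall>t\<ge>0. X t \<in> cyl_measure \<rightarrow>\<^sub>M cyl_measure \<and>
        distr cyl_measure cyl_measure (X t) = cyl_measure)"

text \<open>
  Global-in-time solution of the axisymmetric Euler equations without swirl with initial datum
  \<open>(u\<^sub>0, \<omega>\<^sub>0)\<close>, in the class provided by the known (Danchin) well-posedness theory: \<open>\<omega>/r\<close> solves
  the transport equation, \<open>u\<close> is recovered from \<open>\<omega>\<close> by the Biot--Savart law, \<open>\<omega>/r\<close> is transported
  along particle trajectories, and the kinetic energy is conserved.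
\<close>

definition axisym_euler_solution ::
  "(real \<times> real \<Rightarrow> real) \<Rightarrow> (real \<times> real \<Rightarrow> real) \<Rightarrow> (real \<times> real \<Rightarrow> real) \<Rightarrow>
   (real \<Rightarrow> real \<times> real \<Rightarrow> real) \<Rightarrow> (real \<Rightarrow> real \<times> real \<Rightarrow> real) \<Rightarrow>
   (real \<Rightarrow> real \<times> real \<Rightarrow> real) \<Rightarrow> bool" where
  "axisym_euler_solution ur0 uz0 w0 ur uz w \<longleftrightarrow>
     (\<forall>t\<ge>0. ur t \<in> borel_measurable borel \<and> uz t \<in> borel_measurable borel \<and>
             w t \<in> borel_measurable borel) \<and>
     (AE x in lborel. axisym_velocity (ur 0) (uz 0) x = axisym_velocity ur0 uz0 x) \<and>
     (AE p in cyl_measure. w 0 p = w0 p) \<and>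
     weak_transport w0 ur uz w \<and>
     (\<forall>t\<ge>0. biot_savart (w t) (ur t) (uz t)) \<and>
     (\<exists>X. particle_flow ur uz X \<and>
        (\<forall>t\<ge>0. AE p in cyl_measure. rel_vorticity (w t) (X t p) = rel_vorticity w0 p)) \<and>
     (\<forall>t\<ge>0. kinetic_energy (axisym_velocity (ur t) (uz t)) =
             kinetic_energy (axisym_velocity ur0 uz0))"

end

theory Submission
  imports Defs
begin

text \<open>
  Let \<open>M\<close> bound \<open>\<bar>\<omega>\<^sub>0/r\<bar>\<close>. The energy bounds \<open>u\<^sub>r\<close> in \<open>L\<^sup>2\<close> at all times and the flow preserves
  volume, so the radial displacement of particles up to time \<open>t\<close> has \<open>L\<^sup>2\<close> norm \<open>O(t)\<close>. Hence
  \<open>P\<^sub>2(t) \<le> 2 P\<^sub>2(0) + 2 M O(t\<^sup>2)\<close>, without any a priori finiteness.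

  The oscillation of \<open>u\<^sub>r\<close> at scale \<open>R\<close> around radius \<open>r\<close> is estimated from the Biot--Savart law: after
  integration over the angle, the difference of the kernels is at most a multiple of
  \<open>R / (\<rho> (\<rho> + R))\<close> with \<open>\<rho>\<close> the distance in the half plane. Its integral against \<open>\<bar>\<omega>\<bar>\<close> is controlled
  by \<open>\<bar>\<omega>\<bar> \<le> M r\<close> where the kernel is large and by \<open>P\<^sub>2\<close> where it is small; optimally this gives
  \<open>M\<^bsup>3/4\<^esup> P\<^sub>2\<^bsup>1/4\<^esup> L\<^bsup>1/4\<^esup>\<close> with \<open>L = (r + R) R\<^sup>2\<close>. The average of \<open>u\<^sub>r\<close> over a box of size \<open>R\<close> is at
  most \<open>(E/L)\<^bsup>1/2\<^esup>\<close>. With \<open>L = (1 + t)\<^bsup>-2/3\<^esup>\<close> both are \<open>O((1 + t)\<^bsup>1/3\<^esup>)\<close>, uniformly in \<open>r\<close>.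

  Particles therefore move radially by at most \<open>O((1 + t)\<^bsup>4/3\<^esup>)\<close>, and the bounds on \<open>\<omega>\<close> and on \<open>P\<^sub>k\<close>
  follow since \<open>\<omega>/r\<close> is transported.
\<close>

section \<open>Cylindrical coordinates\<close>

text \<open>The Biot-Savart law gives \<open>ur\<close> only as a vertical derivative of the stream
  function. Velocities at two points are therefore compared through difference quotients: a vertical
  step \<open>h\<close> and a displacement of the base point produce a mixed second difference of
  the potential, bounded by |h| times an integrable kernel, and \<open>h\<close> tends to 0 only at
  the end. The singular integral is never differentiated. All powers of time come from one balance.
  The oscillation is at most a multiple of \<nu>^(-1/3) L^(1/3) + \<nu> P2 for every \<nu> > 0. With
  P2 of order t^2 the best \<nu> gives t^(1/2) L^(1/4), which meets the energy term L^(-1/2) at L =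
  t^(-2/3), where \<nu> = t^(-5/3). The moment exponent is 2 + 4/3 (k - 2): two powers of the radius
  are left to P2, and only the remaining k - 2 are paid for with the displacement t^(4/3).\<close>

lemma borel_measurable_vec3:
  "(\<lambda>y. vector [fst (fst y), snd (fst y), snd y] :: real^3) \<in> borel_measurable borel"
proof -
  have eq: "(\<lambda>y. vector [fst (fst y), snd (fst y), snd y] :: real^3) =
     (\<lambda>x. \<chi> i. if i = 1 then fst (fst x) else if i = 2 then snd (fst x) else snd x)"
    by (simp add: fun_eq_iff vec_eq_iff forall_3)
  have c: "continuous_on UNIV (\<lambda>x::(real\<times>real)\<times>real. if i = 1 then fst (fst x) else if i = 2 then snd (fst x) else snd x)"
    for i :: 3
    by (cases "i = 1"; cases "i = 2") (simp_all add: continuous_on_fst continuous_on_snd)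
  show ?thesis
    unfolding eq by (rule borel_measurable_continuous_onI, rule continuous_on_vec_lambda, rule c)
qed

lemma emeasure_lborel_Times:
  assumes "A \<in> sets borel" "B \<in> sets borel"
  shows "emeasure (lborel :: ('a::euclidean_space \<times> 'b::euclidean_space) measure) (A \<times> B) =
    emeasure lborel A * emeasure lborel B"
  using assms by (subst lborel_prod[symmetric]) (simp add: lborel.emeasure_pair_measure_Times)

text \<open>Boxes determine Lebesgue measure, so the two measures are compared there. The nesting of
  the pairs singles out the horizontal plane, in which polar coordinates are introduced
  next.\<close>

lemma lborel_vec3:
  "(lborel :: (real^3) measure) = distr lborel borel (\<lambda>y. vector [fst (fst y), snd (fst y), snd y])"
proof (rule lborel_eqI)
  show "sets (distr lborel borel (\<lambda>y. vector [fst (fst y), snd (fst y), snd y] :: real^3)) = sets borel" by simp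
  note meas = borel_measurable_vec3
  fix l u :: "real^3"
  assume le: "\<And>b. b \<in> Basis \<Longrightarrow> l \<bullet> b \<le> u \<bullet> b"
  have le': "l $ i \<le> u $ i" for i
    using le[of "axis i 1"] by (simp add: inner_axis axis_in_Basis_iff)
  have "(\<lambda>y. vector [fst (fst y), snd (fst y), snd y] :: real^3) -` box l u = ({l$1<..<u$1} \<times> {l$2<..<u$2}) \<times> {l$3<..<u$3}"
    by (auto simp: mem_box_cart forall_3)
  hence "emeasure (distr lborel borel (\<lambda>y. vector [fst (fst y), snd (fst y), snd y] :: real^3)) (box l u)
    = emeasure lborel (({l$1<..<u$1} \<times> {l$2<..<u$2}) \<times> {l$3<..<u$3})"
    using meas by (simp add: emeasure_distr)
  also have "\<dots> = ennreal ((u$1-l$1)*(u$2-l$2)*(u$3-l$3))"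
  proof -
    have "emeasure lborel (({l$1<..<u$1} \<times> {l$2<..<u$2}) \<times> {l$3<..<u$3})
        = ennreal (u$1 - l$1) * ennreal (u$2 - l$2) * ennreal (u$3 - l$3)"
      using le'
      by (simp only: emeasure_lborel_Times[OF borel_open borel_open] open_Times open_greaterThanLessThan emeasure_lborel_Ioo)
    thus ?thesis using le'[of 1] le'[of 2] le'[of 3] by (simp only: ennreal_mult'' ennreal_mult' diff_ge_0_iff_ge)
  qed
  also have "\<dots> = ennreal (\<Prod>b\<in>Basis. (u - l) \<bullet> b)"
  proof -
    have B: "(Basis :: (real^3) set) = {axis 1 1, axis 2 1, axis 3 1}"
      using exhaust_3 by (auto simp: Basis_vec_def) metis
    show ?thesis
      by (rule arg_cong[where f=ennreal], unfold B) (simp add: inner_axis axis_eq_axis)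
  qed
  finally show "emeasure (distr lborel borel (\<lambda>y. vector [fst (fst y), snd (fst y), snd y] :: real^3)) (box l u) = ennreal (\<Prod>b\<in>Basis. (u - l) \<bullet> b)"
    .
qed

text \<open>Polar coordinates for radial integrands: the image of planar Lebesgue measure under
  \<open>norm\<close> and the density 2 pi r agree on every \<open>{..a}\<close>, where both give
  the area of a disc, and these half lines generate the Borel sets.\<close>

lemma nn_integral_norm_plane:
  fixes g :: "real \<Rightarrow> ennreal"
  assumes [measurable]: "g \<in> borel_measurable borel"
  shows "(\<integral>\<^sup>+ y. g (norm (y :: real \<times> real)) \<partial>lborel) = (\<integral>\<^sup>+ r. ennreal (2 * pi * r) * indicator {0<..} r * g r \<partial>lborel)"
proof -
  let ?N = "density lborel (\<lambda>r. ennreal (2 * pi * r) * indicator {0<..} r)"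
  have em1: "emeasure (distr lborel borel (norm :: real \<times> real \<Rightarrow> real)) {..a} = ennreal (if a < 0 then 0 else pi * a\<^sup>2)" for a
  proof -
    have "(norm :: real \<times> real \<Rightarrow> real) -` {..a} = cball 0 a" by auto
    thus ?thesis by (auto simp: emeasure_distr emeasure_cball unit_ball_vol_2 power2_eq_square)
  qed
  have em2: "emeasure ?N {..a} = ennreal (if a < 0 then 0 else pi * a\<^sup>2)" for a
  proof (cases "a < 0")
    case True
    have "emeasure ?N {..a} = (\<integral>\<^sup>+ r. ennreal (2 * pi * r) * indicator {0<..} r * indicator {..a} r \<partial>lborel)"
      by (subst emeasure_density) auto
    also have "\<dots> = (\<integral>\<^sup>+ r. 0 \<partial>(lborel :: real measure))"
      by (intro nn_integral_cong) (use True in \<open>auto simp: indicator_def\<close>)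
    finally have "emeasure ?N {..a} = (\<integral>\<^sup>+ r. 0 \<partial>(lborel :: real measure))" .
    then show ?thesis using True by simp
  next
    case False
    have "emeasure ?N {..a} = (\<integral>\<^sup>+ r. ennreal (2 * pi * r) * indicator {0..a} r \<partial>lborel)" 
      using False by (subst emeasure_density) (auto intro!: nn_integral_cong simp: indicator_def)
    also have "\<dots> = ennreal (pi * a\<^sup>2 - pi * 0\<^sup>2)"
      using False by (intro nn_integral_FTC_Icc) (auto intro!: derivative_eq_intros)
    finally show ?thesis using False by simp
  qed
  have "distr lborel borel (norm :: real \<times> real \<Rightarrow> real) = ?N"
  proof (rule measure_eqI_generator_eq[where E="range atMost" and \<Omega>=UNIV and A="\<lambda>i. {..real i}"])
    show "Int_stable (range (atMost :: real \<Rightarrow> _))" by (auto simp: Int_stable_def)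
    show "sets (distr lborel borel (norm :: real \<times> real \<Rightarrow> real)) = sigma_sets UNIV (range atMost)"
      by (simp add: borel_eq_atMost)
    show "sets ?N = sigma_sets UNIV (range atMost)"
      by (simp) (simp add: borel_eq_atMost)
    show "(\<Union>i. {..real i}) = UNIV" using real_arch_simple by auto
    fix i show "emeasure (distr lborel borel (norm :: real \<times> real \<Rightarrow> real)) {..real i} \<noteq> \<infinity>" by (simp add: em1)
  qed (auto simp: em1 em2)
  hence "(\<integral>\<^sup>+ r. g r \<partial>distr lborel borel (norm :: real \<times> real \<Rightarrow> real)) = (\<integral>\<^sup>+ r. g r \<partial>?N)" by simp
  thus ?thesis by (simp add: nn_integral_distr nn_integral_density)
qed

lemma borel_measurable_fst_pair [measurable]: "fst \<in> borel_measurable (borel :: (real \<times> real) measure)"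
  and borel_measurable_snd_pair [measurable]: "snd \<in> borel_measurable (borel :: (real \<times> real) measure)"
  by (auto intro!: borel_measurable_continuous_onI continuous_intros)

lemma open_half_plane_borel [measurable]: "open_half_plane \<in> sets borel"
  unfolding open_half_plane_def by (intro borel_open open_Collect_less continuous_intros)

lemma half_plane_borel [measurable]: "half_plane \<in> sets borel"
  unfolding half_plane_def by (intro borel_closed closed_Collect_le continuous_intros)

lemma space_cyl_measure [simp]: "space cyl_measure = open_half_plane"
  by (simp add: cyl_measure_def space_restrict_space)

lemma measurable_cyl_measureI:
  "f \<in> borel_measurable borel \<Longrightarrow> f \<in> borel_measurable cyl_measure"
  unfolding cyl_measure_def by (simp add: measurable_restrict_space1)

lemma nn_integral_cyl_measure:
  fixes f :: "real \<times> real \<Rightarrow> ennreal"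
  assumes [measurable]: "f \<in> borel_measurable borel"
  shows "(\<integral>\<^sup>+ p. f p \<partial>cyl_measure) = (\<integral>\<^sup>+ p. ennreal (fst p) * f p * indicator open_half_plane p \<partial>lborel)"
  unfolding cyl_measure_def
  by (subst nn_integral_density)
     (auto simp: nn_integral_restrict_space mult_ac intro!: measurable_restrict_space1 measurable_compose[OF _ measurable_ennreal] borel_measurable_continuous_onI continuous_intros)

lemma cyl_borel [measurable]: "cyl \<in> borel_measurable borel"
  unfolding cyl_def by (intro borel_measurable_continuous_onI continuous_intros)

text \<open>At each height the horizontal plane is integrated in polar coordinates. Every norm on
  \<real>^3 in the theorem reaches the half plane through this identity.\<close>

lemma nn_integral_cyl:
  fixes f :: "real \<times> real \<Rightarrow> ennreal"
  assumes [measurable]: "f \<in> borel_measurable borel"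
  shows "(\<integral>\<^sup>+ x. f (cyl x) \<partial>lborel) = ennreal (2 * pi) * (\<integral>\<^sup>+ p. f p \<partial>cyl_measure)"
proof -
  have [measurable]: "f \<in> borel_measurable (lborel \<Otimes>\<^sub>M lborel)"
    by (simp add: lborel_prod)
  note borel_measurable_vec3 [measurable]
  have norm_plane: "norm y = sqrt ((fst y)\<^sup>2 + (snd y)\<^sup>2)" for y :: "real \<times> real"
    by (cases y) (simp add: norm_Pair)
  have "(\<integral>\<^sup>+ x. f (cyl x) \<partial>lborel) = (\<integral>\<^sup>+ y. f (cyl (vector [fst (fst y), snd (fst y), snd y])) \<partial>lborel)"
    by (subst lborel_vec3, subst nn_integral_distr) auto
  also have "\<dots> = (\<integral>\<^sup>+ y. f (norm (fst y :: real \<times> real), snd y) \<partial>(lborel \<Otimes>\<^sub>M lborel))"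
    unfolding lborel_prod by (simp add: cyl_def norm_plane)
  also have "\<dots> = (\<integral>\<^sup>+ c. \<integral>\<^sup>+ y. f (norm (y :: real \<times> real), c) \<partial>lborel \<partial>lborel)"
    by (subst lborel_pair.nn_integral_snd[symmetric]) simp_all
  also have "\<dots> = (\<integral>\<^sup>+ c. \<integral>\<^sup>+ r. ennreal (2 * pi * r) * indicator {0<..} r * f (r, c) \<partial>lborel \<partial>lborel)"
    by (intro nn_integral_cong nn_integral_norm_plane) simp
  also have "\<dots> = (\<integral>\<^sup>+ p. ennreal (2 * pi * fst p) * indicator {0<..} (fst p) * f p \<partial>(lborel \<Otimes>\<^sub>M lborel))"
    by (subst lborel_pair.nn_integral_snd[symmetric]) simp_all
  also have "\<dots> = (\<integral>\<^sup>+ p. ennreal (2 * pi) * (ennreal (fst p) * f p * indicator open_half_plane p) \<partial>lborel)"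
    unfolding lborel_prod
    by (intro nn_integral_cong) (auto simp: open_half_plane_def indicator_def ennreal_mult mult_ac)
  finally show ?thesis by (simp add: nn_integral_cmult nn_integral_cyl_measure)
qed

lemma AE_cyl_measure_iff:
  assumes [measurable]: "Measurable.pred borel Q"
  shows "(AE p in cyl_measure. Q p) \<longleftrightarrow> (AE p in lborel. p \<in> open_half_plane \<longrightarrow> Q p)"
  unfolding cyl_measure_def
  by (subst AE_density)
     (auto simp: AE_restrict_space_iff open_half_plane_def intro!: measurable_restrict_space1)

text \<open>Both sides say that the indicator of the exceptional set has integral 0, so
  \<open>nn_integral_cyl\<close> carries null sets across.\<close>

lemma AE_cyl_iff:
  assumes [measurable]: "Measurable.pred borel Q"
  shows "(AE x in lborel. Q (cyl x)) \<longleftrightarrow> (AE p in cyl_measure. Q p)"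
proof -
  have [measurable]: "Measurable.pred cyl_measure Q"
    unfolding cyl_measure_def by (simp add: measurable_restrict_space1)
  have "(AE x in lborel. Q (cyl x)) \<longleftrightarrow> (\<integral>\<^sup>+ x. indicator {p. \<not> Q p} (cyl x) \<partial>lborel) = 0"
    by (subst nn_integral_0_iff_AE) (auto simp: indicator_def)
  also have "\<dots> \<longleftrightarrow> (\<integral>\<^sup>+ p. indicator {p. \<not> Q p} p \<partial>cyl_measure) = 0"
    by (subst nn_integral_cyl) auto
  also have "\<dots> \<longleftrightarrow> (AE p in cyl_measure. Q p)"
    by (subst nn_integral_0_iff_AE) (auto simp: indicator_def)
  finally show ?thesis .
qed

lemma AE_lborel_off_axis: "AE p in (lborel :: (real \<times> real) measure). fst p \<noteq> 0"
proof (rule AE_I)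
  show "{p \<in> space lborel. \<not> fst p \<noteq> 0} \<subseteq> {0} \<times> (UNIV :: real set)" by auto
  show "emeasure lborel ({0} \<times> (UNIV :: real set)) = 0"
    by (subst emeasure_lborel_Times) auto
  show "{0} \<times> (UNIV :: real set) \<in> sets (lborel :: (real \<times> real) measure)"
    by (simp add: borel_Times)
qed

lemma rel_vorticity_borel [measurable]:
  "w \<in> borel_measurable borel \<Longrightarrow> rel_vorticity w \<in> borel_measurable borel"
  unfolding rel_vorticity_def[abs_def] by (intro borel_measurable_divide borel_measurable_fst_pair)

text \<open>This form can be transported: the flow preserves \<open>cyl_measure\<close>, and
  \<open>rel_vorticity\<close> is constant along it.\<close>

lemma radial_moment_cyl_measure:
  assumes [measurable]: "w \<in> borel_measurable borel"
  shows "radial_moment k w = (\<integral>\<^sup>+ p. ennreal (fst p ^ k * \<bar>rel_vorticity w p\<bar>) \<partial>cyl_measure)"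
proof -
  have "radial_moment k w = (\<integral>\<^sup>+ p. ennreal (fst p) * ennreal (fst p ^ k * \<bar>rel_vorticity w p\<bar>)
      * indicator open_half_plane p \<partial>lborel)"
    unfolding radial_moment_def
  proof (intro nn_integral_cong_AE, use AE_lborel_off_axis in eventually_elim)
    fix p :: "real \<times> real" assume "fst p \<noteq> 0"
    thus "ennreal (fst p ^ k * \<bar>w p\<bar>) * indicator half_plane p =
      ennreal (fst p) * ennreal (fst p ^ k * \<bar>rel_vorticity w p\<bar>) * indicator open_half_plane p"
      by (auto simp: indicator_def half_plane_def open_half_plane_def rel_vorticity_def ennreal_mult[symmetric])
  qed
  thus ?thesis by (simp add: nn_integral_cyl_measure)
qed

lemma Linf_norm_cyl_le:
  assumes [measurable]: "f \<in> borel_measurable borel" and "AE p in cyl_measure. \<bar>f p\<bar> \<le> c"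
  shows "Linf_norm (f \<circ> cyl) \<le> ereal c"
  unfolding Linf_norm_def
proof (rule esssup_I)
  show "(\<lambda>x. ereal \<bar>(f \<circ> cyl) x\<bar>) \<in> borel_measurable lborel" by (simp add: comp_def)
  have "AE x in lborel. \<bar>f (cyl x)\<bar> \<le> c"
    using assms by (subst AE_cyl_iff) auto
  thus "AE x in lborel. ereal \<bar>(f \<circ> cyl) x\<bar> \<le> ereal c" by simp
qed

lemma in_Linf_cylD:
  assumes [measurable]: "f \<in> borel_measurable borel" and "in_Linf (f \<circ> cyl)"
  shows "\<exists>c\<ge>0. AE p in cyl_measure. \<bar>f p\<bar> \<le> c"
proof -
  define s where "s = Linf_norm (f \<circ> cyl)"
  have fin: "s < \<infinity>" using assms by (simp add: in_Linf_def s_def)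
  define c where "c = max 0 (real_of_ereal s)"
  have "AE x in lborel. ereal \<bar>(f \<circ> cyl) x\<bar> \<le> s"
    unfolding s_def Linf_norm_def by (rule esssup_AE)
  hence "AE x in lborel. \<bar>f (cyl x)\<bar> \<le> c"
  proof eventually_elim
    fix x assume "ereal \<bar>(f \<circ> cyl) x\<bar> \<le> s"
    thus "\<bar>f (cyl x)\<bar> \<le> c" using fin by (cases s) (auto simp: c_def)
  qed
  hence "AE p in cyl_measure. \<bar>f p\<bar> \<le> c" by (subst (asm) AE_cyl_iff) auto
  thus ?thesis by (intro exI[of _ c]) (simp add: c_def)
qed

lemma norm_axisym_velocity:
  assumes "0 < fst (cyl x)"
  shows "(norm (axisym_velocity ur uz x))\<^sup>2 = (ur (cyl x))\<^sup>2 + (uz (cyl x))\<^sup>2"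
proof -
  define r where "r = fst (cyl x)"
  have r: "r > 0" and r2: "r\<^sup>2 = (x$1)\<^sup>2 + (x$2)\<^sup>2" using assms by (auto simp: r_def cyl_def)
  define v where "v = axisym_velocity ur uz x"
  have c: "v $ 1 = ur (cyl x) * (x$1 / r)" "v $ 2 = ur (cyl x) * (x$2 / r)" "v $ 3 = uz (cyl x)"
    by (simp_all add: v_def axisym_velocity_def e_r_def e_z_def r_def axis_def)
  have "(norm v)\<^sup>2 = (v $ 1)\<^sup>2 + (v $ 2)\<^sup>2 + (v $ 3)\<^sup>2"
    by (simp add: norm_vec_def L2_set_def sum_3 add_nonneg_nonneg)
  also have "\<dots> = (ur (cyl x))\<^sup>2 * (((x$1)\<^sup>2 + (x$2)\<^sup>2) / r\<^sup>2) + (uz (cyl x))\<^sup>2"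
    unfolding c by (simp add: power_mult_distrib power_divide add_divide_distrib distrib_left)
  also have "((x$1)\<^sup>2 + (x$2)\<^sup>2) / r\<^sup>2 = 1" using r by (simp add: r2[symmetric])
  finally show ?thesis by (simp add: v_def)
qed

text \<open>The angle contributes 2 pi and the energy density 1/2, so the energy is at least pi
  times the left side; the factor pi \<ge> 1 is then dropped.\<close>

lemma radial_energy_le:
  assumes [measurable]: "ur \<in> borel_measurable borel"
  shows "(\<integral>\<^sup>+ p. ennreal ((ur p)\<^sup>2) \<partial>cyl_measure) \<le> kinetic_energy (axisym_velocity ur uz)"
proof -
  let ?I = "\<integral>\<^sup>+ p. ennreal ((ur p)\<^sup>2) \<partial>cyl_measure"
  have "?I \<le> ennreal pi * ?I"
    using mult_right_mono[of 1 "ennreal pi" ?I] pi_ge_two by (simp add: ennreal_leI)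
  also have "\<dots> = (\<integral>\<^sup>+ p. ennreal pi * ennreal ((ur p)\<^sup>2) \<partial>cyl_measure)"
    by (subst nn_integral_cmult) (auto intro!: measurable_cyl_measureI)
  \<comment> \<open>The indicator is 1 on the whole space of \<open>cyl_measure\<close>. It is
    inserted because \<open>norm_axisym_velocity\<close> holds only off the axis.\<close>
  also have "\<dots> = (\<integral>\<^sup>+ p. ennreal (2 * pi) * (ennreal ((ur p)\<^sup>2 / 2) * indicator open_half_plane p) \<partial>cyl_measure)"
    by (intro nn_integral_cong) (simp add: ennreal_mult'[symmetric])
  also have "\<dots> = ennreal (2 * pi) * (\<integral>\<^sup>+ p. ennreal ((ur p)\<^sup>2 / 2) * indicator open_half_plane p \<partial>cyl_measure)"
    by (subst nn_integral_cmult) (auto intro!: measurable_cyl_measureI)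
  also have "\<dots> = (\<integral>\<^sup>+ x. ennreal ((ur (cyl x))\<^sup>2 / 2) * indicator open_half_plane (cyl x) \<partial>lborel)"
    by (subst nn_integral_cyl) auto
  also have "\<dots> \<le> kinetic_energy (axisym_velocity ur uz)"
    unfolding kinetic_energy_def
    by (intro nn_integral_mono) (auto simp: indicator_def open_half_plane_def norm_axisym_velocity intro!: ennreal_leI)
  finally show ?thesis .
qed

lemma kinetic_energy_finite: "in_L2 v \<Longrightarrow> kinetic_energy v < \<infinity>"
proof -
  assume "in_L2 v"
  hence "integrable lborel (\<lambda>x. (norm (v x))\<^sup>2 / 2)" by (simp add: in_L2_def)
  thus ?thesis unfolding kinetic_energy_def
    by (subst nn_integral_eq_integral) auto
qed

text \<open>The factor r of the volume element cancels the denominator of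
  \<open>rel_vorticity\<close>.\<close>

lemma in_L1_radial_moment:
  assumes [measurable]: "w \<in> borel_measurable borel" and "in_L1 (rel_vorticity w \<circ> cyl)"
  shows "radial_moment 0 w < \<infinity>"
proof -
  have "(\<integral>\<^sup>+ x. ennreal \<bar>rel_vorticity w (cyl x)\<bar> \<partial>lborel) < \<infinity>"
    using assms(2) by (simp add: in_L1_def integrable_iff_bounded)
  hence "ennreal (2 * pi) * radial_moment 0 w < \<infinity>"
    by (subst (asm) nn_integral_cyl[of "\<lambda>p. ennreal \<bar>rel_vorticity w p\<bar>"]) (auto simp: radial_moment_cyl_measure)
  thus ?thesis by (auto simp: ennreal_mult_less_top top_unique)
qed

section \<open>Second differences of the Newtonian potential\<close>

text \<open>Comparable to 1/d^2, the gradient of 1/d, for d < R, and to R/d^3, the second derivative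
  times a displacement R, for d > R.\<close>

definition diff_kernel :: "real \<Rightarrow> real \<Rightarrow> real" where
  "diff_kernel R d = R / (d\<^sup>2 * (d + R))"

text \<open>Writing 1/b - 1/a = - (b^2 - a^2) / (a b (a + b)) makes the numerators quadratic
  polynomials, whose difference is exactly 2 (x - x') \<bullet> h. Both smallnesses, |h| and R, are
  thus gained by algebra instead of two derivatives.\<close>

lemma inverse_norm_second_difference_far:
  fixes x x' h :: "'a::real_inner"
  assumes R: "R > 0" and xx: "norm (x - x') \<le> 3 * R" and h: "norm h \<le> R" and far: "8 * R < norm x"
  shows "\<bar>(1 / norm (x + h) - 1 / norm x) - (1 / norm (x' + h) - 1 / norm x')\<bar>
    \<le> 200 * norm h * diff_kernel R (norm x)"
proof -
  define a b a' b' n where "a = norm x" "b = norm (x + h)" "a' = norm x'" "b' = norm (x' + h)" "n = norm h"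
  note defs = this
  have ba: "\<bar>b - a\<bar> \<le> n" using norm_triangle_ineq3[of "x + h" x] by (simp add: defs)
  have ba': "\<bar>b' - a'\<bar> \<le> n" using norm_triangle_ineq3[of "x' + h" x'] by (simp add: defs)
  have aa': "\<bar>a' - a\<bar> \<le> 3 * R" using norm_triangle_ineq3[of x x'] xx by (simp add: defs abs_minus_commute)
  have bb': "\<bar>b' - b\<bar> \<le> 3 * R" using norm_triangle_ineq3[of "x + h" "x' + h"] xx by (simp add: defs abs_minus_commute)
  have n0: "0 \<le> n" "n \<le> R" and a8: "8 * R < a" using h far by (auto simp: defs)
  \<comment> \<open>All four points lie within 4 R < a/2 of \<open>x\<close>, so the four norms are
    comparable.\<close>
  have bd: "a/2 \<le> b" "a/2 \<le> a'" "a/2 \<le> b'" "b \<le> 3*a/2" "a' \<le> 3*a/2" "b' \<le> 3*a/2"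
    using ba ba' aa' bb' n0 a8 R by linarith+
  have pos: "a > 0" "b > 0" "a' > 0" "b' > 0" using bd a8 R by linarith+
  define N N' S S' where "N = b\<^sup>2 - a\<^sup>2" "N' = b'\<^sup>2 - a'\<^sup>2" "S = a * b * (a + b)" "S' = a' * b' * (a' + b')"
  note defs2 = this
  have S0: "S > 0" "S' > 0" using pos by (auto simp: defs2)
  have inv: "1 / v - 1 / u = - (v\<^sup>2 - u\<^sup>2) / (u * v * (u + v))" if "u > 0" "v > 0" for u v :: real
  proof -
    have "- (v\<^sup>2 - u\<^sup>2) / (u * v * (u + v)) = ((u - v) * (u + v)) / ((u * v) * (u + v))"
      by (simp add: power2_eq_square algebra_simps)
    also have "\<dots> = (u - v) / (u * v)" using that by (intro nonzero_mult_divide_mult_cancel_right) auto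
    also have "\<dots> = 1 / v - 1 / u" using that by (simp add: diff_divide_distrib)
    finally show ?thesis by simp
  qed
  have e1: "1 / b - 1 / a = - N / S" unfolding defs2 by (rule inv) (use pos in auto)
  have e2: "1 / b' - 1 / a' = - N' / S'" unfolding defs2 by (rule inv) (use pos in auto)
  have NN: "\<bar>N - N'\<bar> \<le> 6 * R * n"
  proof -
    have q: "(norm (y + h))\<^sup>2 - (norm y)\<^sup>2 = 2 * (y \<bullet> h) + h \<bullet> h" for y
      by (simp only: power2_norm_eq_inner inner_add_left inner_add_right inner_commute[of h y])
    have "N - N' = 2 * ((x - x') \<bullet> h)"
      unfolding defs2 defs q inner_diff_left by simp
    moreover have "\<bar>(x - x') \<bullet> h\<bar> \<le> norm (x - x') * norm h" by (rule Cauchy_Schwarz_ineq2)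
    moreover have "norm (x - x') * norm h \<le> 3 * R * n" unfolding defs using xx by (intro mult_right_mono) auto
    ultimately show ?thesis by simp
  qed
  have N': "\<bar>N'\<bar> \<le> n * (a' + b')"
  proof -
    have "N' = (b' - a') * (a' + b')" by (simp add: defs2 power2_eq_square algebra_simps)
    thus ?thesis using ba' pos by (auto simp: abs_mult intro!: mult_mono)
  qed
  have SS: "\<bar>S' - S\<bar> \<le> 30 * R * a\<^sup>2"
  proof -
    \<comment> \<open>Expand S = a^2 b + a b^2 and change one factor at a time. The four terms
      contribute 3 (15/4 + 1 + 9/4 + 3) = 30.\<close>
    have "S' - S = (a' - a) * ((a' + a) * b') + (b' - b) * (a * a) + (a' - a) * (b' * b') + (b' - b) * (a * (b' + b))"
      by (simp add: defs2 algebra_simps)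
    hence "\<bar>S' - S\<bar> \<le> \<bar>(a' - a) * ((a' + a) * b')\<bar> + \<bar>(b' - b) * (a * a)\<bar> + \<bar>(a' - a) * (b' * b')\<bar> + \<bar>(b' - b) * (a * (b' + b))\<bar>"
      by linarith
    also have "\<dots> \<le> 3*R * ((5*a/2) * (3*a/2)) + 3*R * (a * a) + 3*R * ((3*a/2) * (3*a/2)) + 3*R * (a * (5*a/2 + a/2))"
    proof (intro add_mono)
      have m: "\<bar>u * v\<bar> \<le> 3 * R * V" if "\<bar>u\<bar> \<le> 3 * R" "0 \<le> v" "v \<le> V" for u v V
        using that R by (simp only: abs_mult) (intro mult_mono; simp)
      show "\<bar>(a' - a) * ((a' + a) * b')\<bar> \<le> 3*R * ((5*a/2) * (3*a/2))"
        by (rule m[OF aa']; (rule mult_nonneg_nonneg | rule mult_mono); use pos bd in linarith)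
      show "\<bar>(b' - b) * (a * a)\<bar> \<le> 3*R * (a * a)"
        by (rule m[OF bb' _ order_refl]) (use pos in simp)
      show "\<bar>(a' - a) * (b' * b')\<bar> \<le> 3*R * ((3*a/2) * (3*a/2))"
        by (rule m[OF aa']; (rule mult_nonneg_nonneg | rule mult_mono); use pos bd in linarith)
      show "\<bar>(b' - b) * (a * (b' + b))\<bar> \<le> 3*R * (a * (5*a/2 + a/2))"
        by (rule m[OF bb']; (rule mult_nonneg_nonneg | rule mult_mono); use pos bd in linarith)
    qed
    also have "\<dots> = 30 * R * a\<^sup>2" by (simp add: power2_eq_square)
    finally show ?thesis .
  qed
  have Sl: "3/4 * a^3 \<le> S"
  proof -
    have "a * (a/2) * (a + a/2) \<le> S" unfolding defs2 using pos bd by (intro mult_mono) auto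
    thus ?thesis by (simp add: power3_eq_cube)
  qed
  \<comment> \<open>The first term carries the cancellation in the numerators, the second the change
    of the denominators; \<open>N'\<close> still supplies a factor |h| there.\<close>
  have T: "(- N / S) - (- N' / S') = - ((N - N') / S) - N' * (S' - S) / (S * S')"
    using S0 by (simp add: field_simps)
  have t1: "\<bar>(N - N') / S\<bar> \<le> 8 * R * n / a^3"
  proof -
    have "\<bar>(N - N') / S\<bar> = \<bar>N - N'\<bar> / S" using S0 by simp
    also have "\<dots> \<le> (6 * R * n) / (3/4 * a^3)" using NN Sl pos R n0 by (intro frac_le) auto
    finally show ?thesis by simp
  qed
  have t2: "\<bar>N' * (S' - S) / (S * S')\<bar> \<le> 160 * R * n / a^3"
  proof -
    have "\<bar>N' * (S' - S) / (S * S')\<bar> = \<bar>N'\<bar> * \<bar>S' - S\<bar> / (S * S')" using S0 by (simp add: abs_mult)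
    also have "\<dots> \<le> (n * (a' + b')) * (30 * R * a\<^sup>2) / (S * S')"
      using N' SS S0 n0 pos R by (intro divide_right_mono mult_mono) auto
    also have "\<dots> = n * (30 * R * a\<^sup>2) / (S * (a' * b'))"
    proof -
      have "(n * (a' + b')) * (30 * R * a\<^sup>2) / (S * S') = (n * (30 * R * a\<^sup>2)) * (a' + b') / ((S * (a' * b')) * (a' + b'))"
        unfolding defs2(4) by (simp only: mult_ac)
      also have "\<dots> = n * (30 * R * a\<^sup>2) / (S * (a' * b'))"
        using pos by (intro nonzero_mult_divide_mult_cancel_right) auto
      finally show ?thesis .
    qed
    also have "\<dots> \<le> n * (30 * R * a\<^sup>2) / (3/4 * a^3 * (a/2 * (a/2)))"
      using pos bd Sl n0 R S0 by (intro divide_left_mono mult_mono mult_nonneg_nonneg mult_pos_pos) auto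
    also have "\<dots> = 160 * R * n / a^3"
      using pos by (simp add: field_simps power2_eq_square power3_eq_cube)
    finally show ?thesis .
  qed
  have "\<bar>(1 / b - 1 / a) - (1 / b' - 1 / a')\<bar> \<le> \<bar>- ((N - N') / S)\<bar> + \<bar>N' * (S' - S) / (S * S')\<bar>"
    unfolding e1 e2 T by (rule abs_triangle_ineq4)
  also have "\<dots> \<le> 8 * R * n / a^3 + 160 * R * n / a^3"
    unfolding abs_minus_cancel using t1 t2 by (rule add_mono)
  also have "\<dots> = 168 * R * n / a^3"
    by (simp add: add_divide_distrib[symmetric])
  also have "\<dots> \<le> 200 * n * diff_kernel R a"
  proof -
    \<comment> \<open>From 8 R < a one has a + R \<le> 9/8 a, and 168 * 9/8 = 189.\<close>
    have "168 * (a + R) \<le> 200 * a" using a8 R unfolding distrib_left by linarith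
    hence "R * n * a\<^sup>2 * (168 * (a + R)) \<le> R * n * a\<^sup>2 * (200 * a)" using R n0 by (intro mult_left_mono) auto
    thus ?thesis using pos R by (simp add: diff_kernel_def divide_simps) (simp add: algebra_simps power2_eq_square power3_eq_cube)
  qed
  finally show ?thesis by (simp add: defs)
qed

text \<open>If |x| \<le> 8 R, no cancellation between the two differences is used. All four points
  have norm at most 12 R, where 1/d^2 \<le> 13 K(d) for K = \<open>diff_kernel R\<close>, and each
  first difference is at most |h| p q \<le> |h| (p^2 + q^2) with p, q the inverse norms. Any of the
  four points may be close to the singularity, hence the sum of four kernels.\<close>

lemma inverse_norm_second_difference:
  fixes x x' h :: "'a::real_inner"
  assumes R: "R > 0" and xx: "norm (x - x') \<le> 3 * R" and h: "norm h \<le> R"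
    and nz: "x \<noteq> 0" "x + h \<noteq> 0" "x' \<noteq> 0" "x' + h \<noteq> 0"
  shows "\<bar>(1 / norm (x + h) - 1 / norm x) - (1 / norm (x' + h) - 1 / norm x')\<bar>
    \<le> 200 * norm h * (diff_kernel R (norm x) + diff_kernel R (norm (x + h)) +
        diff_kernel R (norm x') + diff_kernel R (norm (x' + h)))"
proof -
  have K0: "0 \<le> diff_kernel R (norm y)" for y :: 'a using R by (simp add: diff_kernel_def)
  show ?thesis
  proof (cases "8 * R < norm x")
    case True
    have "200 * norm h * diff_kernel R (norm x) \<le> 200 * norm h * (diff_kernel R (norm x) + diff_kernel R (norm (x + h)) +
        diff_kernel R (norm x') + diff_kernel R (norm (x' + h)))"
      using K0 by (intro mult_left_mono) (auto simp: add_nonneg_nonneg)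
    thus ?thesis using inverse_norm_second_difference_far[OF R xx h True] by linarith
  next
    case False
    have inv: "1 / (norm y)\<^sup>2 \<le> 13 * diff_kernel R (norm y)" if "norm y \<le> 12 * R" "y \<noteq> 0" for y :: 'a
    proof -
      have "1 / (norm y)\<^sup>2 = ((norm y + R) / R) * diff_kernel R (norm y)"
        using that R by (simp add: diff_kernel_def add_nonneg_eq_0_iff)
      also have "\<dots> \<le> 13 * diff_kernel R (norm y)"
        using that R K0 by (intro mult_right_mono) (auto simp: field_simps)
      finally show ?thesis .
    qed
    have dq: "\<bar>1 / norm (y + h) - 1 / norm y\<bar> \<le> norm h * (13 * diff_kernel R (norm y) + 13 * diff_kernel R (norm (y + h)))"
      if "norm y \<le> 11 * R" "y \<noteq> 0" "y + h \<noteq> 0" for y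
    proof -
      define p q where "p = 1 / norm (y + h)" "q = 1 / norm y"
      have "\<bar>p - q\<bar> = \<bar>norm y - norm (y + h)\<bar> * (p * q)"
        using that by (simp add: p_q_def divide_simps abs_mult)
      also have "\<dots> \<le> norm h * (p * q)"
        using norm_triangle_ineq3[of y "y + h"] by (intro mult_right_mono) (auto simp: p_q_def)
      also have "\<dots> \<le> norm h * (q\<^sup>2 + p\<^sup>2)"
      proof (intro mult_left_mono)
        have "0 \<le> p * q" by (simp add: p_q_def)
        thus "p * q \<le> q\<^sup>2 + p\<^sup>2" using sum_squares_bound[of p q] by linarith
      qed auto
      also have "\<dots> \<le> norm h * (13 * diff_kernel R (norm y) + 13 * diff_kernel R (norm (y + h)))"
        using inv[of y] inv[of "y + h"] that h norm_triangle_ineq[of y h] R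
        by (intro mult_left_mono add_mono) (auto simp: p_q_def power_divide)
      finally show ?thesis by (simp add: p_q_def)
    qed
    have n: "norm x \<le> 11 * R" using False R by linarith
    have n': "norm x' \<le> 11 * R" using False xx norm_triangle_ineq3[of x x'] by linarith
    have "\<bar>(1 / norm (x + h) - 1 / norm x) - (1 / norm (x' + h) - 1 / norm x')\<bar> \<le>
      13 * norm h * (diff_kernel R (norm x) + diff_kernel R (norm (x + h)) +
        diff_kernel R (norm x') + diff_kernel R (norm (x' + h)))"
      using dq[OF n nz(1,2)] dq[OF n' nz(3,4)] by (simp add: algebra_simps abs_le_iff)
    also have "\<dots> \<le> 200 * norm h * (diff_kernel R (norm x) + diff_kernel R (norm (x + h)) +
        diff_kernel R (norm x') + diff_kernel R (norm (x' + h)))"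
      by (intro mult_right_mono add_nonneg_nonneg K0) auto
    finally show ?thesis .
  qed
qed

section \<open>Integrating out the angle\<close>

text \<open>Jordan's inequality, from concavity of the sine on the quarter period.\<close>

lemma sin_ge_chord:
  assumes "0 \<le> x" "x \<le> pi / 2"
  shows "2 * x / pi \<le> sin x"
proof -
  have "concave_on {0..pi/2} (sin :: real \<Rightarrow> real)"
    by (rule f''_le0_imp_concave[where f'=cos and f''="\<lambda>x. - sin x"])
       (auto intro!: derivative_eq_intros sin_ge_zero)
  from concave_onD[OF this, of "2 * x / pi" 0 "pi / 2"] show ?thesis
    using assms by (simp add: field_simps)
qed

lemma one_minus_cos_ge:
  assumes "0 \<le> \<theta>" "\<theta> \<le> pi"
  shows "2 * \<theta>\<^sup>2 / pi\<^sup>2 \<le> 1 - cos \<theta>"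
proof -
  have "(\<theta> / pi)\<^sup>2 \<le> (sin (\<theta> / 2))\<^sup>2"
    using sin_ge_chord[of "\<theta> / 2"] assms by (intro power_mono) auto
  thus ?thesis using cos_double_sin[of "\<theta> / 2"] by (simp add: power_divide)
qed

text \<open>Integration over the ring weakens the singularity by one order. If \<rho> > r, then s
  \<le> 2 \<rho> and the trivial bound on the integrand suffices. Otherwise 1 - cos \<theta> is
  replaced by its quadratic lower bound, which leaves an arctangent; there s \<le> r + \<rho> \<le>
  2 r makes s / sqrt (r s) bounded by 2, and pi \<le> 4 gives the constant 8.\<close>

lemma angular_integral_le:
  assumes r: "r > 0" and s: "s > 0" and \<rho>: "\<rho> > 0" and rs: "\<bar>r - s\<bar> \<le> \<rho>"
  shows "(\<integral>\<^sup>+\<theta>\<in>{0..pi}. ennreal (s / (\<rho>\<^sup>2 + 2 * r * s * (1 - cos \<theta>))) \<partial>lborel) \<le> ennreal (8 / \<rho>)"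
proof (cases "\<rho> \<le> r")
  case False
  have "(\<integral>\<^sup>+\<theta>\<in>{0..pi}. ennreal (s / (\<rho>\<^sup>2 + 2 * r * s * (1 - cos \<theta>))) \<partial>lborel) \<le> (\<integral>\<^sup>+\<theta>\<in>{0..pi}. ennreal (2 / \<rho>) \<partial>lborel)"
  proof (intro nn_integral_mono mult_right_mono ennreal_leI)
    fix \<theta> :: real
    have "s / (\<rho>\<^sup>2 + 2 * r * s * (1 - cos \<theta>)) \<le> (2 * \<rho>) / \<rho>\<^sup>2"
      using False rs r s \<rho> by (intro frac_le) auto
    also have "\<dots> = 2 / \<rho>" by (simp add: power2_eq_square)
    finally show "s / (\<rho>\<^sup>2 + 2 * r * s * (1 - cos \<theta>)) \<le> 2 / \<rho>" .
  qed auto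
  also have "\<dots> = ennreal (2 / \<rho> * pi)" using \<rho>
    by (simp add: nn_integral_cmult ennreal_mult[symmetric])
  also have "\<dots> \<le> ennreal (8 / \<rho>)" using pi_less_4 \<rho> by (intro ennreal_leI) (simp add: field_simps)
  finally show ?thesis .
next
  case True
  \<comment> \<open>Chosen so that c^2 \<theta>^2 is what \<open>one_minus_cos_ge\<close> yields
    below 2 r s (1 - cos \<theta>).\<close>
  define c where "c = 2 * sqrt (r * s) / pi"
  have c: "c > 0" using r s by (simp add: c_def)
  have c2: "c\<^sup>2 = 4 * r * s / pi\<^sup>2" using r s by (simp add: c_def power_divide power_mult_distrib)
  have "(\<integral>\<^sup>+\<theta>\<in>{0..pi}. ennreal (s / (\<rho>\<^sup>2 + 2 * r * s * (1 - cos \<theta>))) \<partial>lborel)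
     \<le> (\<integral>\<^sup>+\<theta>\<in>{0..pi}. ennreal (s / (\<rho>\<^sup>2 + c\<^sup>2 * \<theta>\<^sup>2)) \<partial>lborel)"
  proof (intro nn_integral_mono)
    fix \<theta> :: real
    show "ennreal (s / (\<rho>\<^sup>2 + 2 * r * s * (1 - cos \<theta>))) * indicator {0..pi} \<theta>
      \<le> ennreal (s / (\<rho>\<^sup>2 + c\<^sup>2 * \<theta>\<^sup>2)) * indicator {0..pi} \<theta>"
    proof (cases "\<theta> \<in> {0..pi}")
      case th: True
      have "2 * r * s * (2 * \<theta>\<^sup>2 / pi\<^sup>2) \<le> 2 * r * s * (1 - cos \<theta>)"
        using one_minus_cos_ge[of \<theta>] th r s by (intro mult_left_mono) auto
      hence "c\<^sup>2 * \<theta>\<^sup>2 \<le> 2 * r * s * (1 - cos \<theta>)" by (simp add: c2)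
      moreover have "0 \<le> 2 * r * s * (1 - cos \<theta>)" using r s by (intro mult_nonneg_nonneg) auto
      ultimately show ?thesis using \<rho> s th by (intro mult_right_mono ennreal_leI divide_left_mono) (auto intro!: add_pos_nonneg mult_pos_pos)
    qed simp
  qed
  also have "\<dots> = ennreal (s / (\<rho> * c) * arctan (c * pi / \<rho>) - s / (\<rho> * c) * arctan (c * 0 / \<rho>))"
  proof (rule nn_integral_FTC_Icc)
    fix \<theta> :: real
    have p: "\<rho>\<^sup>2 + c\<^sup>2 * \<theta>\<^sup>2 > 0" using \<rho> by (auto intro!: add_pos_nonneg)
    have "((\<lambda>\<theta>. s / (\<rho> * c) * arctan (c * \<theta> / \<rho>)) has_real_derivative
        s / (\<rho> * c) * (inverse (1 + (c * \<theta> / \<rho>)\<^sup>2) * (c / \<rho>))) (at \<theta>)"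
      using \<rho> c by (auto intro!: derivative_eq_intros)
    also have "s / (\<rho> * c) * (inverse (1 + (c * \<theta> / \<rho>)\<^sup>2) * (c / \<rho>)) = s / (\<rho>\<^sup>2 + c\<^sup>2 * \<theta>\<^sup>2)"
    proof -
      have "1 + (c * \<theta> / \<rho>)\<^sup>2 = (\<rho>\<^sup>2 + c\<^sup>2 * \<theta>\<^sup>2) / \<rho>\<^sup>2"
        using \<rho> by (simp add: field_simps power2_eq_square)
      thus ?thesis using \<rho> c p by (simp add: power2_eq_square)
    qed
    finally show "((\<lambda>\<theta>. s / (\<rho> * c) * arctan (c * \<theta> / \<rho>)) has_real_derivative s / (\<rho>\<^sup>2 + c\<^sup>2 * \<theta>\<^sup>2)) (at \<theta>)" .
    show "0 \<le> s / (\<rho>\<^sup>2 + c\<^sup>2 * \<theta>\<^sup>2)" using p s by auto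
  qed auto
  also have "\<dots> \<le> ennreal (8 / \<rho>)"
  proof (rule ennreal_leI)
    have "s / (\<rho> * c) * arctan (c * pi / \<rho>) \<le> s / (\<rho> * c) * (pi / 2)"
      using arctan_ubound[of "c * pi / \<rho>"] s \<rho> c by (intro mult_left_mono) auto
    also have "\<dots> = (pi\<^sup>2 / 4) * (s / sqrt (r * s)) / \<rho>"
      using \<rho> r s by (simp add: c_def power2_eq_square field_simps)
    also have "\<dots> \<le> (4\<^sup>2 / 4) * 2 / \<rho>"
    proof (intro divide_right_mono mult_mono power_mono)
      have "s * s \<le> (4 * r) * s" using True rs s by (intro mult_right_mono) auto
      also have "\<dots> = (2 * sqrt (r * s))\<^sup>2" using r s by (simp add: power_mult_distrib)
      finally have "s\<^sup>2 \<le> (2 * sqrt (r * s))\<^sup>2" by (simp only: power2_eq_square)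
      hence "s \<le> 2 * sqrt (r * s)" by (rule power2_le_imp_le) (use r s in simp)
      thus "s / sqrt (r * s) \<le> 2" using r s by (simp add: pos_divide_le_eq)
    qed (use pi_less_4 r s \<rho> in auto)
    finally show "s / (\<rho> * c) * arctan (c * pi / \<rho>) - s / (\<rho> * c) * arctan (c * 0 / \<rho>) \<le> 8 / \<rho>" by simp
  qed
  finally show ?thesis .
qed

section \<open>An integral bound in the half plane\<close>

text \<open>The integrand to be dominated is \<rho>^(-4/3) (\<rho> + R)^(-1). Since \<rho> is at
  least each coordinate difference, half of each exponent is given to each coordinate, and the plane
  integral becomes a product of line integrals. The exponent -2/3 is integrable at 0, the total -7/6
  at infinity.\<close>

definition sing_weight :: "real \<Rightarrow> real \<Rightarrow> real" where
  "sing_weight R a = \<bar>a\<bar> powr (-2/3) * (\<bar>a\<bar> + R) powr (-1/2)"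

lemma sing_weight_borel [measurable]: "sing_weight R \<in> borel_measurable borel"
  unfolding sing_weight_def[abs_def] by measurable

text \<open>Cutting at |a| = R, the half line contributes 3 from the inner and 6 from the outer
  part; evenness doubles this.\<close>

lemma nn_integral_sing_weight:
  assumes R: "R > 0"
  shows "(\<integral>\<^sup>+ a. ennreal (sing_weight R a) \<partial>lborel) \<le> ennreal (18 * R powr (-1/6))"
proof -
  let ?f = "sing_weight R"
  have near: "(\<integral>\<^sup>+ a. ennreal (R powr (-1/2) * a powr (-2/3)) * indicator {0..R} a \<partial>lborel) = ennreal (3 * R powr (-1/6))"
  proof -
    have "((\<lambda>x. R powr (-1/2) * x powr (-2/3)) has_integral R powr (-1/2) * (R powr (-2/3 + 1) / (-2/3 + 1))) {0..R}"
      using R by (intro has_integral_mult_right has_integral_powr_from_0) auto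
    hence "(\<integral>\<^sup>+ a. ennreal (R powr (-1/2) * a powr (-2/3)) * indicator {0..R} a \<partial>lborel)
       = ennreal (R powr (-1/2) * (R powr (-2/3 + 1) / (-2/3 + 1)))"
      by (intro nn_integral_has_integral_lebesgue') auto
    also have "R powr (-1/2) * (R powr (-2/3 + 1) / (-2/3 + 1)) = 3 * (R powr (-1/2) * R powr (1/3))" by simp
    also have "R powr (-1/2) * R powr (1/3) = R powr (-1/6)" by (simp add: powr_add[symmetric])
    finally show ?thesis .
  qed
  have far: "(\<integral>\<^sup>+ a. ennreal (a powr (-7/6)) * indicator {R..} a \<partial>lborel) = ennreal (6 * R powr (-1/6))"
  proof -
    have "((\<lambda>x. x powr (-7/6)) has_integral - (R powr (-7/6 + 1)) / (-7/6 + 1)) {R..}"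
      using R by (intro has_integral_powr_to_inf) auto
    hence "(\<integral>\<^sup>+ a. ennreal (a powr (-7/6)) * indicator {R..} a \<partial>lborel) = ennreal (- (R powr (-7/6 + 1)) / (-7/6 + 1))"
      by (intro nn_integral_has_integral_lebesgue') auto
    thus ?thesis by simp
  qed
  have half: "(\<integral>\<^sup>+ a. ennreal (?f a) * indicator {0..} a \<partial>lborel) \<le> ennreal (9 * R powr (-1/6))"
  proof -
    have "(\<integral>\<^sup>+ a. ennreal (?f a) * indicator {0..} a \<partial>lborel) \<le>
       (\<integral>\<^sup>+ a. ennreal (R powr (-1/2) * a powr (-2/3)) * indicator {0..R} a + ennreal (a powr (-7/6)) * indicator {R..} a \<partial>lborel)"
    proof (rule nn_integral_mono)
      fix a :: real
      consider "a < 0" | "0 \<le> a" "a \<le> R" | "R < a" by linarith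
      thus "ennreal (?f a) * indicator {0..} a \<le> ennreal (R powr (-1/2) * a powr (-2/3)) * indicator {0..R} a + ennreal (a powr (-7/6)) * indicator {R..} a"
      proof cases
        case 2
        have "(a + R) powr (-1/2) \<le> R powr (-1/2)" using 2 R by (intro powr_mono2') auto
        hence "a powr (-2/3) * (a + R) powr (-1/2) \<le> a powr (-2/3) * R powr (-1/2)" by (rule mult_left_mono) simp
        hence "?f a \<le> R powr (-1/2) * a powr (-2/3)" using 2 by (simp add: sing_weight_def mult.commute)
        hence "ennreal (?f a) \<le> ennreal (R powr (-1/2) * a powr (-2/3))" by (rule ennreal_leI)
        thus ?thesis using 2 by (simp add: add_increasing2)
      next
        case 3
        have "?f a \<le> a powr (-2/3) * a powr (-1/2)"
          unfolding sing_weight_def using 3 R by (intro mult_mono powr_mono2') auto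
        also have "\<dots> = a powr (-7/6)" by (simp add: powr_add[symmetric])
        finally have "ennreal (?f a) \<le> ennreal (a powr (-7/6))" by (rule ennreal_leI)
        thus ?thesis using 3 R by (auto simp: indicator_def)
      qed auto
    qed
    also have "\<dots> = ennreal (3 * R powr (-1/6)) + ennreal (6 * R powr (-1/6))"
      unfolding near[symmetric] far[symmetric] by (intro nn_integral_add) auto
    finally show ?thesis by (simp add: ennreal_plus[symmetric] del: ennreal_plus)
  qed
  have even: "?f (- a) = ?f a" for a by (simp add: sing_weight_def)
  have "(\<integral>\<^sup>+ a. ennreal (?f a) \<partial>lborel) \<le>
      (\<integral>\<^sup>+ a. ennreal (?f a) * indicator {0..} a + ennreal (?f a) * indicator {..0} a \<partial>lborel)"
    by (intro nn_integral_mono) (auto simp: indicator_def)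
  also have "\<dots> = (\<integral>\<^sup>+ a. ennreal (?f a) * indicator {0..} a \<partial>lborel) + (\<integral>\<^sup>+ a. ennreal (?f a) * indicator {..0} a \<partial>lborel)"
    by (intro nn_integral_add) auto
  also have "(\<integral>\<^sup>+ a. ennreal (?f a) * indicator {..0} a \<partial>lborel) = (\<integral>\<^sup>+ a. ennreal (?f a) * indicator {0..} a \<partial>lborel)"
    by (subst nn_integral_real_affine[where c="-1" and t=0])
       (auto simp: even indicator_def intro!: nn_integral_cong)
  also have "(\<integral>\<^sup>+ a. ennreal (?f a) * indicator {0..} a \<partial>lborel) + (\<integral>\<^sup>+ a. ennreal (?f a) * indicator {0..} a \<partial>lborel)
      \<le> ennreal (9 * R powr (-1/6)) + ennreal (9 * R powr (-1/6))"
    by (intro add_mono half)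
  finally show ?thesis by (simp add: ennreal_plus[symmetric] del: ennreal_plus)
qed

lemma nn_integral_sing_weight_product:
  assumes R: "R > 0"
  shows "(\<integral>\<^sup>+ q. ennreal (sing_weight R (fst p - fst q) * sing_weight R (snd p - snd q)) \<partial>lborel)
    \<le> ennreal (324 * R powr (-1/3))"
proof -
  have shift: "(\<integral>\<^sup>+ a. ennreal (sing_weight R (c - a)) \<partial>lborel) \<le> ennreal (18 * R powr (-1/6))" for c
    using nn_integral_sing_weight[OF R]
    by (subst (asm) nn_integral_real_affine[where c="-1" and t=c]) (auto simp: minus_diff_commute)
  have "(\<integral>\<^sup>+ q. ennreal (sing_weight R (fst p - fst q) * sing_weight R (snd p - snd q)) \<partial>lborel)
     = (\<integral>\<^sup>+ a. \<integral>\<^sup>+ b. ennreal (sing_weight R (fst p - a)) * ennreal (sing_weight R (snd p - b)) \<partial>lborel \<partial>lborel)"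
    unfolding lborel_prod[symmetric, where 'a=real and 'b=real]
    by (subst lborel.nn_integral_fst[symmetric]) (auto simp: ennreal_mult sing_weight_def)
  also have "\<dots> = (\<integral>\<^sup>+ a. ennreal (sing_weight R (fst p - a)) \<partial>lborel) * (\<integral>\<^sup>+ b. ennreal (sing_weight R (snd p - b)) \<partial>lborel)"
    by (simp add: nn_integral_cmult nn_integral_multc)
  also have "\<dots> \<le> ennreal (18 * R powr (-1/6)) * ennreal (18 * R powr (-1/6))"
    by (intro mult_mono shift) auto
  also have "\<dots> = ennreal (324 * (R powr (-1/6) * R powr (-1/6)))" by (simp add: ennreal_mult[symmetric])
  also have "R powr (-1/6) * R powr (-1/6) = R powr (-1/3)" by (simp add: powr_add[symmetric])
  finally show ?thesis .
qed

text \<open>The task is to remove the source radius \<open>s\<close>. One factor R is spent on s R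
  \<le> (r + R) (\<rho> + R), which trades \<open>s\<close> for the observer's radius at the cost of
  one of the four powers of \<rho> + R. A cube root then leaves the product weight.\<close>

lemma weighted_kernel_le:
  assumes R: "R > 0" and r: "r > 0" and s: "0 \<le> s" "\<bar>r - s\<bar> = a" and a: "a > 0" and b: "b > 0"
    and \<rho>: "a \<le> \<rho>" "b \<le> \<rho>"
  shows "((R / (\<rho> * (\<rho> + R)))^4 * s) powr (1/3) \<le> R * (r + R) powr (1/3) * (sing_weight R a * sing_weight R b)"
proof -
  have \<rho>0: "\<rho> > 0" using a \<rho> by simp
  let ?A = "a powr 2 * (a + R) powr (3/2)" and ?B = "b powr 2 * (b + R) powr (3/2)"
  have ab: "?A * ?B \<le> \<rho>^4 * (\<rho> + R)^3"
  proof -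
    have "?A * ?B \<le> (\<rho> powr 2 * (\<rho> + R) powr (3/2)) * (\<rho> powr 2 * (\<rho> + R) powr (3/2))"
      using a b \<rho> R by (intro mult_mono powr_mono2) auto
    also have "\<dots> = (\<rho> powr 2 * \<rho> powr 2) * ((\<rho> + R) powr (3/2) * (\<rho> + R) powr (3/2))" by (simp only: mult_ac)
    also have "\<dots> = \<rho> powr (of_nat 4) * (\<rho> + R) powr (of_nat 3)" by (simp add: powr_add[symmetric])
    also have "\<dots> = \<rho>^4 * (\<rho> + R)^3" using \<rho>0 R by (simp only: powr_realpow add_pos_pos)
    finally show ?thesis .
  qed
  have sR: "s * R \<le> (r + R) * (\<rho> + R)"
  proof -
    have "s \<le> r + \<rho>" using s \<rho> by linarith
    hence "s * R \<le> (r + \<rho>) * R" using R by (intro mult_right_mono) auto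
    also have "\<dots> \<le> (r + R) * (\<rho> + R)" using r R \<rho>0 by (simp add: algebra_simps)
    finally show ?thesis .
  qed
  have "(R / (\<rho> * (\<rho> + R)))^4 * s = R^3 * (s * R) / (\<rho>^4 * (\<rho> + R)^4)"
    by (simp add: power_divide power_mult_distrib) (simp add: power4_eq_xxxx power3_eq_cube)
  also have "\<dots> \<le> R^3 * ((r + R) * (\<rho> + R)) / (\<rho>^4 * (\<rho> + R)^4)"
    using sR R \<rho>0 by (intro divide_right_mono mult_left_mono) auto
  also have "\<dots> = R^3 * (r + R) * (\<rho> + R) / (\<rho>^4 * (\<rho> + R)^3 * (\<rho> + R))"
    by (simp add: power4_eq_xxxx power3_eq_cube mult_ac)
  also have "\<dots> = R^3 * (r + R) / (\<rho>^4 * (\<rho> + R)^3)"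
    using \<rho>0 R by (intro nonzero_mult_divide_mult_cancel_right) auto
  also have "\<dots> \<le> R^3 * (r + R) / (?A * ?B)"
    using ab a b R r \<rho>0 by (intro divide_left_mono) auto
  finally have le: "(R / (\<rho> * (\<rho> + R)))^4 * s \<le> R^3 * (r + R) / (?A * ?B)" .
  have cube: "(R^3) powr (1/3) = R" using R by (simp add: powr_powr flip: powr_numeral)
  have square: "(x\<^sup>2) powr (1/3) = x powr (2/3)" if "x > 0" for x :: real
    using that by (simp add: powr_powr flip: powr_numeral)
  have "((R / (\<rho> * (\<rho> + R)))^4 * s) powr (1/3) \<le> (R^3 * (r + R) / (?A * ?B)) powr (1/3)"
    using le s R \<rho>0 by (intro powr_mono2) auto
  also have "\<dots> = R * (r + R) powr (1/3) * (sing_weight R a * sing_weight R b)"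
    using R r a b cube square[of a] square[of b] by (simp add: powr_mult powr_divide powr_powr sing_weight_def powr_minus_divide)
  finally show ?thesis .
qed

text \<open>The threshold k = \<nu> s^2 decides which information on the vorticity is used. Below it
  the second moment absorbs the whole product. Above it y \<le> M s, and s^2 < k/\<nu> turns (k s)^3
  = k^3 s s^2 into at most k^4 s / \<nu>, which explains the power 1/3.\<close>

lemma level_split:
  fixes k s y M \<nu> :: real
  assumes "0 \<le> y" "y \<le> M * s" "0 \<le> k" "0 \<le> s" "\<nu> > 0" "M \<ge> 0"
  shows "k * y \<le> M * \<nu> powr (-1/3) * (k^4 * s) powr (1/3) + \<nu> * (s\<^sup>2 * y)"
proof (cases "k \<le> \<nu> * s\<^sup>2")
  case True
  hence "k * y \<le> \<nu> * s\<^sup>2 * y" using assms by (intro mult_right_mono) auto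
  thus ?thesis using assms by (simp add: mult_ac add_increasing)
next
  case False
  have "(k * s)^3 = k^3 * s * s\<^sup>2" by (simp add: power_mult_distrib power3_eq_cube power2_eq_square)
  also have "\<dots> \<le> k^3 * s * (k / \<nu>)"
    using False assms by (intro mult_left_mono) (auto simp: field_simps)
  also have "\<dots> = k^4 * s / \<nu>" by (simp add: power4_eq_xxxx power3_eq_cube)
  finally have c: "(k * s)^3 \<le> k^4 * s / \<nu>" .
  have "k * s = ((k * s)^3) powr (1/3)"
    using assms by (cases "k * s = 0") (auto simp: powr_powr simp flip: powr_numeral)
  also have "\<dots> \<le> (k^4 * s / \<nu>) powr (1/3)" using c assms by (intro powr_mono2) auto
  also have "\<dots> = \<nu> powr (-1/3) * (k^4 * s) powr (1/3)"
    using assms by (simp add: powr_divide powr_minus_divide)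
  finally have "M * (k * s) \<le> M * (\<nu> powr (-1/3) * (k^4 * s) powr (1/3))" using assms by (intro mult_left_mono) auto
  moreover have "k * y \<le> k * (M * s)" using assms by (intro mult_left_mono) auto
  moreover have "0 \<le> \<nu> * (s\<^sup>2 * y)" using assms by auto
  ultimately show ?thesis by (simp add: mult_ac)
qed

text \<open>What \<open>diff_kernel\<close> becomes, up to a constant, after weighting by the source
  radius and integrating over the angle.\<close>

definition plane_kernel :: "real \<Rightarrow> real \<Rightarrow> real" where
  "plane_kernel R \<rho> = R / (\<rho> * (\<rho> + R))"

lemma abs_fst_diff_le_dist: "\<bar>fst p - fst q\<bar> \<le> dist p q" for p q :: "real \<times> real"
  using dist_fst_le[of p q] by (simp add: dist_real_def)

lemma abs_snd_diff_le_dist: "\<bar>snd p - snd q\<bar> \<le> dist p q" for p q :: "real \<times> real"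
  using dist_snd_le[of p q] by (simp add: dist_real_def)

lemma AE_lborel_pair_neq:
  fixes p :: "real \<times> real"
  shows "AE q in lborel. fst p \<noteq> fst q \<and> snd p \<noteq> snd q"
proof (rule AE_I)
  show "{q \<in> space lborel. \<not> (fst p \<noteq> fst q \<and> snd p \<noteq> snd q)} \<subseteq> ({fst p} \<times> UNIV) \<union> (UNIV \<times> {snd p})" by auto
  have "emeasure lborel (({fst p} \<times> UNIV) \<union> (UNIV \<times> {snd p})) \<le>
     emeasure lborel ({fst p} \<times> (UNIV :: real set)) + emeasure lborel ((UNIV :: real set) \<times> {snd p})"
    by (intro emeasure_subadditive) (auto simp: borel_Times)
  also have "\<dots> = 0" by (simp add: emeasure_lborel_Times)
  finally show "emeasure lborel (({fst p} \<times> UNIV) \<union> (UNIV \<times> {snd p})) = 0" by simp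
  show "({fst p} \<times> UNIV) \<union> (UNIV \<times> {snd p}) \<in> sets lborel" by (auto simp: borel_Times)
qed

text \<open>The parameter \<nu> stays free, so that the time-dependent optimum can be inserted
  later. The scale (r + R) R^2 is the one that also measures the volume of a box of size R for the
  energy.\<close>

lemma plane_kernel_integral_le:
  assumes [measurable]: "w \<in> borel_measurable borel"
    and w: "AE q in lborel. q \<in> half_plane \<longrightarrow> \<bar>w q\<bar> \<le> M * fst q"
    and M: "M \<ge> 0" and r: "fst p > 0" and R: "R > 0" and \<nu>: "\<nu> > 0"
  shows "(\<integral>\<^sup>+ q\<in>half_plane. ennreal (plane_kernel R (dist p q) * \<bar>w q\<bar>) \<partial>lborel) \<le>
    ennreal (324 * M * \<nu> powr (-1/3) * ((fst p + R) * R\<^sup>2) powr (1/3)) + ennreal \<nu> * radial_moment 2 w"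
proof -
  let ?c = "M * \<nu> powr (-1/3) * (R * (fst p + R) powr (1/3))"
  let ?W = "\<lambda>q. sing_weight R (fst p - fst q) * sing_weight R (snd p - snd q)"
  have W0: "0 \<le> ?W q" for q by (simp add: sing_weight_def)
  have c0: "0 \<le> ?c" using M R by simp
  have "(\<integral>\<^sup>+ q\<in>half_plane. ennreal (plane_kernel R (dist p q) * \<bar>w q\<bar>) \<partial>lborel) \<le>
     (\<integral>\<^sup>+ q. ennreal ?c * ennreal (?W q) + ennreal \<nu> * (ennreal (fst q ^ 2 * \<bar>w q\<bar>) * indicator half_plane q) \<partial>lborel)"
  proof (intro nn_integral_mono_AE, use w AE_lborel_pair_neq[of p] in eventually_elim)
    fix q assume wq: "q \<in> half_plane \<longrightarrow> \<bar>w q\<bar> \<le> M * fst q" and ne: "fst p \<noteq> fst q \<and> snd p \<noteq> snd q"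
    show "ennreal (plane_kernel R (dist p q) * \<bar>w q\<bar>) * indicator half_plane q \<le>
      ennreal ?c * ennreal (?W q) + ennreal \<nu> * (ennreal (fst q ^ 2 * \<bar>w q\<bar>) * indicator half_plane q)"
    proof (cases "q \<in> half_plane")
      case True
      hence s: "0 \<le> fst q" by (simp add: half_plane_def)
      have "plane_kernel R (dist p q) * \<bar>w q\<bar> \<le> M * \<nu> powr (-1/3) * ((plane_kernel R (dist p q))^4 * fst q) powr (1/3) + \<nu> * ((fst q)\<^sup>2 * \<bar>w q\<bar>)"
        using wq True s \<nu> M R by (intro level_split) (auto simp: plane_kernel_def)
      also have "((plane_kernel R (dist p q))^4 * fst q) powr (1/3) \<le> R * (fst p + R) powr (1/3) * (sing_weight R \<bar>fst p - fst q\<bar> * sing_weight R \<bar>snd p - snd q\<bar>)"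
        unfolding plane_kernel_def
        by (intro weighted_kernel_le R r s refl abs_fst_diff_le_dist abs_snd_diff_le_dist) (use ne in auto)
      also have "R * (fst p + R) powr (1/3) * (sing_weight R \<bar>fst p - fst q\<bar> * sing_weight R \<bar>snd p - snd q\<bar>) = R * (fst p + R) powr (1/3) * ?W q"
        by (simp add: sing_weight_def)
      finally have "plane_kernel R (dist p q) * \<bar>w q\<bar> \<le> ?c * ?W q + \<nu> * ((fst q)\<^sup>2 * \<bar>w q\<bar>)"
        using M by (simp add: mult_left_mono mult.assoc)
      hence "ennreal (plane_kernel R (dist p q) * \<bar>w q\<bar>) \<le> ennreal (?c * ?W q + \<nu> * ((fst q)\<^sup>2 * \<bar>w q\<bar>))"
        by (rule ennreal_leI)
      also have "\<dots> = ennreal (?c * ?W q) + ennreal (\<nu> * ((fst q)\<^sup>2 * \<bar>w q\<bar>))"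
        using mult_nonneg_nonneg[OF c0 W0[of q]] \<nu> by (intro ennreal_plus) auto
      also have "\<dots> = ennreal ?c * ennreal (?W q) + ennreal \<nu> * ennreal ((fst q)\<^sup>2 * \<bar>w q\<bar>)"
        using c0 W0 \<nu> by (simp only: ennreal_mult' less_imp_le)
      finally show ?thesis using True by simp
    qed simp
  qed
  also have "\<dots> = ennreal ?c * (\<integral>\<^sup>+ q. ennreal (?W q) \<partial>lborel) + ennreal \<nu> * radial_moment 2 w"
    unfolding radial_moment_def by (subst nn_integral_add) (auto simp: nn_integral_cmult)
  also have "ennreal ?c * (\<integral>\<^sup>+ q. ennreal (?W q) \<partial>lborel) \<le> ennreal ?c * ennreal (324 * R powr (-1/3))"
    by (intro mult_left_mono nn_integral_sing_weight_product R) auto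
  also have "\<dots> = ennreal (?c * (324 * R powr (-1/3)))" using c0 by (simp only: ennreal_mult')
  \<comment> \<open>One power of R from the kernel and R^(-1/3) from the weights combine to
    (R^2)^(1/3).\<close>
  also have "?c * (324 * R powr (-1/3)) = 324 * M * \<nu> powr (-1/3) * ((fst p + R) powr (1/3) * (R powr 1 * R powr (-1/3)))"
    using R by simp
  also have "R powr 1 * R powr (-1/3) = (R powr 2) powr (1/3)" unfolding powr_add[symmetric] powr_powr by simp
  also have "(fst p + R) powr (1/3) * (R powr 2) powr (1/3) = ((fst p + R) * R\<^sup>2) powr (1/3)"
    using R r by (simp add: powr_mult)
  finally show ?thesis by (simp add: add_mono)
qed

section \<open>The stream function\<close>

text \<open>The distance in \<real>^3 from \<open>p\<close>, placed at angle 0, to the point of the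
  ring through \<open>q\<close> at angle \<theta>, split into the planar distance and the part due
  to the angle; see \<open>chord_eq_norm\<close>.\<close>

definition chord :: "real \<times> real \<Rightarrow> real \<times> real \<Rightarrow> real \<Rightarrow> real" where
  "chord p q \<theta> = sqrt ((fst p - fst q)\<^sup>2 + (snd p - snd q)\<^sup>2 + 2 * fst p * fst q * (1 - cos \<theta>))"

text \<open>Up to normalisation, the azimuthal vector potential at \<open>p\<close> of a circular
  vortex ring through \<open>q\<close>. The cosine projects the turning vortex direction on the
  azimuthal direction at \<open>p\<close>; by symmetry half the circle is enough.\<close>

definition ring_potential :: "real \<times> real \<Rightarrow> real \<times> real \<Rightarrow> real" where
  "ring_potential p q = (LINT \<theta>:{0..pi}|lborel. cos \<theta> / chord p q \<theta>)"

lemma dist_plane: "dist p q = sqrt ((fst p - fst q)\<^sup>2 + (snd p - snd q)\<^sup>2)" for p q :: "real \<times> real"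
  by (cases p, cases q) (simp add: dist_Pair_Pair dist_real_def)

lemma chord_ge_dist:
  assumes "0 \<le> fst p" "0 \<le> fst q"
  shows "dist p q \<le> chord p q \<theta>"
  unfolding dist_plane chord_def using assms by (intro real_sqrt_le_mono) simp

lemma chord_square:
  assumes "0 \<le> fst p" "0 \<le> fst q"
  shows "(chord p q \<theta>)\<^sup>2 = (dist p q)\<^sup>2 + 2 * fst p * fst q * (1 - cos \<theta>)"
  unfolding dist_plane chord_def using assms by simp

lemma chord_eq_norm:
  "chord p q \<theta> = norm ((fst p, 0, snd p) - (fst q * cos \<theta>, fst q * sin \<theta>, snd q) :: real \<times> real \<times> real)"
proof -
  have "(fst p - fst q)\<^sup>2 + (snd p - snd q)\<^sup>2 + 2 * fst p * fst q * (1 - cos \<theta>)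
     = (fst p - fst q * cos \<theta>)\<^sup>2 + ((fst q)\<^sup>2 * (sin \<theta>)\<^sup>2 + (snd p - snd q)\<^sup>2)"
    unfolding sin_squared_eq by (simp add: power2_eq_square algebra_simps)
  thus ?thesis by (simp add: chord_def norm_Pair power_mult_distrib)
qed

lemma chord_pos:
  assumes "0 \<le> fst p" "0 \<le> fst q" "p \<noteq> q"
  shows "0 < chord p q \<theta>"
  using chord_ge_dist[OF assms(1,2), of \<theta>] assms(3) by (simp add: less_le_trans[OF zero_less_dist_iff[THEN iffD2]])

lemma ring_potential_integrable:
  assumes "0 \<le> fst p" "0 \<le> fst q" "p \<noteq> q"
  shows "set_integrable lborel {0..pi} (\<lambda>\<theta>. cos \<theta> / chord p q \<theta>)"
proof (rule borel_integrable_atLeastAtMost')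
  show "continuous_on {0..pi} (\<lambda>\<theta>. cos \<theta> / chord p q \<theta>)"
    using chord_pos[OF assms] unfolding chord_def by (intro continuous_intros) (auto simp: less_le)
qed

lemma ring_potential_borel [measurable]: "ring_potential p \<in> borel_measurable borel"
  unfolding ring_potential_def[abs_def] set_lebesgue_integral_def chord_def
  by (intro lborel.borel_measurable_lebesgue_integral) measurable

lemma abs_ring_potential_le:
  assumes "0 \<le> fst p" "0 \<le> fst q" "p \<noteq> q"
  shows "\<bar>ring_potential p q\<bar> \<le> pi / dist p q"
proof -
  have d: "dist p q > 0" using assms by simp
  have "ennreal (norm (ring_potential p q)) \<le> (\<integral>\<^sup>+ \<theta>. ennreal (norm (indicator {0..pi} \<theta> *\<^sub>R (cos \<theta> / chord p q \<theta>))) \<partial>lborel)"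
    unfolding ring_potential_def set_lebesgue_integral_def
    using ring_potential_integrable[OF assms] by (intro integral_norm_bound_ennreal) (simp add: set_integrable_def)
  also have "\<dots> \<le> (\<integral>\<^sup>+ \<theta>\<in>{0..pi}. ennreal (1 / dist p q) \<partial>lborel)"
  proof (intro nn_integral_mono)
    fix \<theta> :: real
    have "\<bar>cos \<theta> / chord p q \<theta>\<bar> \<le> 1 / dist p q"
      unfolding abs_divide using chord_ge_dist[OF assms(1,2), of \<theta>] d by (intro frac_le) auto
    thus "ennreal (norm (indicator {0..pi} \<theta> *\<^sub>R (cos \<theta> / chord p q \<theta>))) \<le> ennreal (1 / dist p q) * indicator {0..pi} \<theta>"
      by (auto simp: indicator_def intro!: ennreal_leI)
  qed
  also have "\<dots> = ennreal (pi / dist p q)"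
    using d by (simp add: nn_integral_cmult ennreal_mult[symmetric])
  finally show ?thesis using d by (simp add: ennreal_le_iff)
qed

text \<open>Multiplying the radicand of \<open>BS_kernel\<close> by the product of the two radii
  turns it into the squared chord. One square root of the product arises there, the other is the
  prefactor.\<close>

lemma BS_kernel_eq_ring_potential:
  assumes "0 < fst p" "0 < fst q" "p \<noteq> q"
  shows "sqrt (fst p * fst q) * BS_kernel (((fst p - fst q)\<^sup>2 + (snd p - snd q)\<^sup>2) / (fst p * fst q))
    = fst p * fst q * ring_potential p q"
proof -
  let ?m = "fst p * fst q" and ?s = "((fst p - fst q)\<^sup>2 + (snd p - snd q)\<^sup>2) / (fst p * fst q)"
  have m: "?m > 0" using assms by simp
  have eq: "cos \<theta> / sqrt (2 * (1 - cos \<theta>) + ?s) = sqrt ?m * (cos \<theta> / chord p q \<theta>)" for \<theta>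
  proof -
    have ms: "?m * ?s = (fst p - fst q)\<^sup>2 + (snd p - snd q)\<^sup>2" using m by (subst times_divide_eq_right, subst nonzero_mult_div_cancel_left) auto
    have "chord p q \<theta> = sqrt (?m * (2 * (1 - cos \<theta>) + ?s))"
      unfolding chord_def distrib_left[of ?m] ms by (simp add: algebra_simps)
    hence "chord p q \<theta> = sqrt ?m * sqrt (2 * (1 - cos \<theta>) + ?s)" by (simp add: real_sqrt_mult)
    thus ?thesis using m assms(1,2) by simp
  qed
  have "BS_kernel ?s = integral {0..pi} (\<lambda>\<theta>. sqrt ?m * (cos \<theta> / chord p q \<theta>))"
    unfolding BS_kernel_def eq ..
  also have "\<dots> = sqrt ?m * integral {0..pi} (\<lambda>\<theta>. cos \<theta> / chord p q \<theta>)" by (rule integral_mult_right)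
  also have "integral {0..pi} (\<lambda>\<theta>. cos \<theta> / chord p q \<theta>) = ring_potential p q"
    unfolding ring_potential_def
    using ring_potential_integrable[of p q] assms by (intro set_borel_integral_eq_integral(2)[symmetric]) auto
  finally show ?thesis using m by (simp add: mult.assoc[symmetric])
qed

lemma stream_function_eq:
  assumes [measurable]: "w \<in> borel_measurable borel" and p: "0 < fst p"
  shows "stream_function w p = fst p / (2 * pi) * (LINT q:half_plane|lborel. fst q * w q * ring_potential p q)"
proof -
  let ?s = "\<lambda>q. ((fst p - fst q)\<^sup>2 + (snd p - snd q)\<^sup>2) / (fst p * fst q)"
  let ?f = "\<lambda>q. sqrt (fst p * fst q) * BS_kernel (?s q) * w q"
  let ?g = "\<lambda>q. fst p * (fst q * w q * ring_potential p q)"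
  \<comment> \<open>On the axis both sides vanish. The diagonal, where
    \<open>BS_kernel_eq_ring_potential\<close> is silent, is kept as a separate value and discarded
    as a null set.\<close>
  have eq: "?f q = (if q = p then ?f p else ?g q)" if "q \<in> half_plane" for q
  proof (cases "fst q = 0")
    case True then show ?thesis using p by auto
  next
    case False
    hence "0 < fst q" using that by (simp add: half_plane_def)
    then show ?thesis using BS_kernel_eq_ring_potential[of p q] p by (simp add: mult_ac)
  qed
  have "(LINT q:half_plane|lborel. ?f q) = (LINT q:half_plane|lborel. if q = p then ?f p else ?g q)"
    by (intro set_lebesgue_integral_cong) (use eq in auto)
  also have "\<dots> = (LINT q:half_plane|lborel. ?g q)"
    unfolding set_lebesgue_integral_def
  proof (rule integral_cong_AE)
    show "AE q in lborel. indicator half_plane q *\<^sub>R (if q = p then ?f p else ?g q) = indicator half_plane q *\<^sub>R ?g q"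
      using AE_lborel_singleton[of p] by eventually_elim simp
  qed measurable
  finally show ?thesis unfolding stream_function_def by simp
qed

lemma AE_half_plane_off:
  "AE q in lborel. q \<in> half_plane \<longrightarrow> 0 < fst q \<and> p \<noteq> q"
  using AE_lborel_off_axis AE_lborel_singleton[of p]
  by eventually_elim (auto simp: half_plane_def)

text \<open>Integrals of differences can be split only after this. At distance \<rho> \<ge> 1,
  s/\<rho> \<le> 1 + s^2 leads to the moments 0 and 2. At distance \<rho> < 1, s \<le> r + 1 and
  1/\<rho> \<le> 2 \<open>plane_kernel 1 \<rho>\<close> lead to the planar kernel bound with R =
  1.\<close>

lemma stream_integrand_integrable:
  assumes [measurable]: "w \<in> borel_measurable borel"
    and w: "AE q in lborel. q \<in> half_plane \<longrightarrow> \<bar>w q\<bar> \<le> M * fst q" and M: "M \<ge> 0"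
    and p: "0 < fst p" and P0: "radial_moment 0 w < \<infinity>" and P2: "radial_moment 2 w < \<infinity>"
  shows "set_integrable lborel half_plane (\<lambda>q. fst q * w q * ring_potential p q)"
  unfolding set_integrable_def
proof (rule integrableI_bounded)
  let ?k = "plane_kernel 1"
  have "(\<integral>\<^sup>+ q\<in>half_plane. ennreal (plane_kernel 1 (dist p q) * \<bar>w q\<bar>) \<partial>lborel) \<le>
    ennreal (324 * M * 1 powr (-1/3) * ((fst p + 1) * 1\<^sup>2) powr (1/3)) + ennreal 1 * radial_moment 2 w"
    by (intro plane_kernel_integral_le w M p) auto
  also have "\<dots> < \<infinity>" using P2 by simp
  finally have fin: "(\<integral>\<^sup>+ q\<in>half_plane. ennreal (plane_kernel 1 (dist p q) * \<bar>w q\<bar>) \<partial>lborel) < \<infinity>" .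
  have [measurable]: "(\<lambda>q. plane_kernel 1 (dist p q)) \<in> borel_measurable borel"
    unfolding plane_kernel_def dist_plane by measurable
  have "(\<integral>\<^sup>+ q. ennreal (norm (indicator half_plane q *\<^sub>R (fst q * w q * ring_potential p q))) \<partial>lborel)
     \<le> (\<integral>\<^sup>+ q. ennreal pi * (ennreal (fst q ^ 0 * \<bar>w q\<bar>) * indicator half_plane q + ennreal (fst q ^ 2 * \<bar>w q\<bar>) * indicator half_plane q
         + ennreal (2 * (fst p + 1)) * (ennreal (plane_kernel 1 (dist p q) * \<bar>w q\<bar>) * indicator half_plane q)) \<partial>lborel)"
  proof (intro nn_integral_mono_AE, use AE_half_plane_off[of p] in eventually_elim)
    fix q assume q: "q \<in> half_plane \<longrightarrow> 0 < fst q \<and> p \<noteq> q"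
    show "ennreal (norm (indicator half_plane q *\<^sub>R (fst q * w q * ring_potential p q))) \<le>
      ennreal pi * (ennreal (fst q ^ 0 * \<bar>w q\<bar>) * indicator half_plane q + ennreal (fst q ^ 2 * \<bar>w q\<bar>) * indicator half_plane q
         + ennreal (2 * (fst p + 1)) * (ennreal (plane_kernel 1 (dist p q) * \<bar>w q\<bar>) * indicator half_plane q))"
    proof (cases "q \<in> half_plane")
      case True
      define \<rho> where "\<rho> = dist p q"
      have s: "fst q > 0" and \<rho>: "\<rho> > 0" using True q by (auto simp: \<rho>_def)
      have "fst q / \<rho> \<le> 1 + (fst q)\<^sup>2 + 2 * (fst p + 1) * ?k \<rho>"
      proof (cases "\<rho> \<ge> 1")
        case ge: True
        have "fst q / \<rho> \<le> fst q / 1" using ge s by (intro divide_left_mono) auto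
        also have "\<dots> \<le> 1 + (fst q)\<^sup>2" using sum_squares_bound[of 1 "fst q"] s by simp
        finally show ?thesis using p \<rho> by (simp add: plane_kernel_def add_increasing2)
      next
        case False
        have "fst q \<le> fst p + 1" using abs_fst_diff_le_dist[of p q] False by (simp add: \<rho>_def)
        hence "fst q / \<rho> \<le> (fst p + 1) / \<rho>" using \<rho> by (simp add: divide_right_mono)
        also have "\<dots> = (fst p + 1) * ((\<rho> + 1) / (\<rho> * (\<rho> + 1)))" using \<rho> by simp
        also have "\<dots> \<le> (fst p + 1) * (2 / (\<rho> * (\<rho> + 1)))"
          using False \<rho> p by (intro mult_left_mono divide_right_mono) auto
        also have "\<dots> = 2 * (fst p + 1) * ?k \<rho>" by (simp add: plane_kernel_def)
        finally show ?thesis using zero_le_power2[of "fst q"] by linarith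
      qed
      hence "pi * \<bar>w q\<bar> * (fst q / \<rho>) \<le> pi * \<bar>w q\<bar> * (1 + (fst q)\<^sup>2 + 2 * (fst p + 1) * ?k \<rho>)"
        by (intro mult_left_mono) auto
      moreover have "\<bar>fst q * w q * ring_potential p q\<bar> \<le> fst q * \<bar>w q\<bar> * (pi / \<rho>)"
      proof -
        have "\<bar>ring_potential p q\<bar> \<le> pi / \<rho>"
          using abs_ring_potential_le[of p q] s p q True by (auto simp: \<rho>_def)
        hence "fst q * \<bar>w q\<bar> * \<bar>ring_potential p q\<bar> \<le> fst q * \<bar>w q\<bar> * (pi / \<rho>)"
          using s by (intro mult_left_mono) auto
        thus ?thesis using s by (simp only: abs_mult abs_of_pos)
      qed
      ultimately have "\<bar>fst q * w q * ring_potential p q\<bar> \<le>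
         pi * (fst q ^ 0 * \<bar>w q\<bar> + fst q ^ 2 * \<bar>w q\<bar> + 2 * (fst p + 1) * (?k \<rho> * \<bar>w q\<bar>))"
        by (simp add: algebra_simps)
      hence "ennreal \<bar>fst q * w q * ring_potential p q\<bar> \<le>
         ennreal (pi * (fst q ^ 0 * \<bar>w q\<bar> + fst q ^ 2 * \<bar>w q\<bar> + 2 * (fst p + 1) * (?k \<rho> * \<bar>w q\<bar>)))"
        by (rule ennreal_leI)
      also have "\<dots> = ennreal pi * (ennreal (fst q ^ 0 * \<bar>w q\<bar>) + ennreal (fst q ^ 2 * \<bar>w q\<bar>) + ennreal (2 * (fst p + 1)) * ennreal (?k \<rho> * \<bar>w q\<bar>))"
      proof -
        have n: "0 \<le> fst q ^ 0 * \<bar>w q\<bar>" "0 \<le> fst q ^ 2 * \<bar>w q\<bar>" "0 \<le> 2 * (fst p + 1)" "0 \<le> ?k \<rho> * \<bar>w q\<bar>"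
          using \<rho> p by (auto simp: plane_kernel_def)
        show ?thesis
          unfolding ennreal_mult'[OF pi_ge_zero] ennreal_plus[OF add_nonneg_nonneg[OF n(1,2)] mult_nonneg_nonneg[OF n(3,4)]]
            ennreal_plus[OF n(1,2)] ennreal_mult'[OF n(3)] ..
      qed
      finally show ?thesis using True by (simp add: \<rho>_def)
    qed simp
  qed
  also have "\<dots> = ennreal pi * (radial_moment 0 w + radial_moment 2 w
      + ennreal (2 * (fst p + 1)) * (\<integral>\<^sup>+ q\<in>half_plane. ennreal (plane_kernel 1 (dist p q) * \<bar>w q\<bar>) \<partial>lborel))"
    unfolding radial_moment_def by (simp add: nn_integral_cmult nn_integral_add)
  also have "\<dots> < \<infinity>" using P0 P2 fin by (simp add: ennreal_mult_less_top)
  finally show "(\<integral>\<^sup>+ q. ennreal (norm (indicator half_plane q *\<^sub>R (fst q * w q * ring_potential p q))) \<partial>lborel) < \<infinity>" .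
qed measurable

section \<open>Second differences of the ring potential\<close>

text \<open>Since the chord is at least \<rho>, the decay factor R / (chord + R) can be frozen at
  \<rho>; the inverse squared chord is left to \<open>angular_integral_le\<close>.\<close>

lemma angular_diff_kernel_le:
  assumes p: "0 < fst p" and q: "0 < fst q" and pq: "p \<noteq> q" and R: "R > 0"
  shows "(\<integral>\<^sup>+\<theta>\<in>{0..pi}. ennreal (fst q * diff_kernel R (chord p q \<theta>)) \<partial>lborel) \<le> ennreal (8 * plane_kernel R (dist p q))"
proof -
  define \<rho> where "\<rho> = dist p q"
  have \<rho>: "\<rho> > 0" using pq by (simp add: \<rho>_def)
  have "(\<integral>\<^sup>+\<theta>\<in>{0..pi}. ennreal (fst q * diff_kernel R (chord p q \<theta>)) \<partial>lborel)
    \<le> (\<integral>\<^sup>+\<theta>. ennreal (R / (\<rho> + R)) * (ennreal (fst q / (\<rho>\<^sup>2 + 2 * fst p * fst q * (1 - cos \<theta>))) * indicator {0..pi} \<theta>) \<partial>lborel)"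
  proof (intro nn_integral_mono)
    fix \<theta> :: real
    let ?D = "\<rho>\<^sup>2 + 2 * fst p * fst q * (1 - cos \<theta>)"
    have c: "(chord p q \<theta>)\<^sup>2 = ?D" "\<rho> \<le> chord p q \<theta>"
      using chord_square[of p q \<theta>] chord_ge_dist[of p q \<theta>] p q by (auto simp: \<rho>_def)
    have D: "?D > 0" using c(1) chord_pos[of p q \<theta>] p q pq by (metis less_imp_le zero_less_power)
    have "fst q * diff_kernel R (chord p q \<theta>) = fst q * R / (?D * (chord p q \<theta> + R))"
      unfolding diff_kernel_def c by simp
    also have "\<dots> \<le> fst q * R / (?D * (\<rho> + R))"
      using c D \<rho> R q by (intro divide_left_mono mult_left_mono mult_pos_pos) auto
    also have "\<dots> = R / (\<rho> + R) * (fst q / ?D)" by (simp add: mult_ac)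
    finally have "ennreal (fst q * diff_kernel R (chord p q \<theta>)) \<le> ennreal (R / (\<rho> + R) * (fst q / ?D))"
      by (rule ennreal_leI)
    also have "\<dots> = ennreal (R / (\<rho> + R)) * ennreal (fst q / ?D)" using R \<rho> by (intro ennreal_mult') auto
    finally show "ennreal (fst q * diff_kernel R (chord p q \<theta>)) * indicator {0..pi} \<theta> \<le>
      ennreal (R / (\<rho> + R)) * (ennreal (fst q / ?D) * indicator {0..pi} \<theta>)"
      by (simp add: mult.assoc[symmetric] mult_right_mono)
  qed
  also have "\<dots> = ennreal (R / (\<rho> + R)) * (\<integral>\<^sup>+\<theta>\<in>{0..pi}. ennreal (fst q / (\<rho>\<^sup>2 + 2 * fst p * fst q * (1 - cos \<theta>))) \<partial>lborel)"
    by (intro nn_integral_cmult) measurable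
  also have "\<dots> \<le> ennreal (R / (\<rho> + R)) * ennreal (8 / \<rho>)"
    by (intro mult_left_mono angular_integral_le p q \<rho>) (auto simp: \<rho>_def abs_fst_diff_le_dist)
  also have "\<dots> = ennreal (8 * plane_kernel R \<rho>)"
    using R \<rho> by (simp add: ennreal_mult'[symmetric] plane_kernel_def mult_ac)
  finally show ?thesis by (simp add: \<rho>_def)
qed

text \<open>A vertical step is the same vector of \<real>^3 for every point of the ring, and
  \<open>p\<close>, \<open>p'\<close> both sit at angle 0, so the estimate for the Newtonian
  potential applies for each fixed angle. The constant is 200 * 8.\<close>

lemma ring_potential_second_difference:
  fixes p p' q :: "real \<times> real" and h R :: real
  defines "e \<equiv> (0, h)"
  assumes p: "0 < fst p" "0 < fst p'" and q: "0 < fst q" and ne: "p \<noteq> q" "p + e \<noteq> q" "p' \<noteq> q" "p' + e \<noteq> q"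
    and R: "R > 0" and pp: "dist p p' \<le> 3 * R" and h: "\<bar>h\<bar> \<le> R"
  shows "fst q * \<bar>(ring_potential (p + e) q - ring_potential p q) - (ring_potential (p' + e) q - ring_potential p' q)\<bar>
    \<le> 1600 * \<bar>h\<bar> * (plane_kernel R (dist p q) + plane_kernel R (dist (p + e) q) +
         plane_kernel R (dist p' q) + plane_kernel R (dist (p' + e) q))"
proof -
  have pe: "0 < fst (p + e)" "0 < fst (p' + e)" using p by (auto simp: e_def)
  let ?c = "\<lambda>p \<theta>. chord p q \<theta>"
  let ?D = "\<lambda>\<theta>. (1 / ?c (p + e) \<theta> - 1 / ?c p \<theta>) - (1 / ?c (p' + e) \<theta> - 1 / ?c p' \<theta>)"
  let ?K = "\<lambda>\<theta>. diff_kernel R (?c p \<theta>) + diff_kernel R (?c (p + e) \<theta>) + diff_kernel R (?c p' \<theta>) + diff_kernel R (?c (p' + e) \<theta>)"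
  have D: "\<bar>?D \<theta>\<bar> \<le> 200 * \<bar>h\<bar> * ?K \<theta>" for \<theta>
  proof -
    let ?x = "(fst p, 0, snd p) - (fst q * cos \<theta>, fst q * sin \<theta>, snd q) :: real \<times> real \<times> real"
    let ?x' = "(fst p', 0, snd p') - (fst q * cos \<theta>, fst q * sin \<theta>, snd q) :: real \<times> real \<times> real"
    let ?h = "(0, 0, h) :: real \<times> real \<times> real"
    have c: "?c p \<theta> = norm ?x" "?c (p + e) \<theta> = norm (?x + ?h)" "?c p' \<theta> = norm ?x'" "?c (p' + e) \<theta> = norm (?x' + ?h)"
      unfolding chord_eq_norm by (simp_all add: e_def algebra_simps)
    have nh: "norm ?h = \<bar>h\<bar>" by (simp add: norm_Pair)
    have pos: "?c p \<theta> > 0" "?c (p + e) \<theta> > 0" "?c p' \<theta> > 0" "?c (p' + e) \<theta> > 0"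
      by (intro chord_pos less_imp_le p pe q ne)+
    have nz: "?x \<noteq> 0" "?x + ?h \<noteq> 0" "?x' \<noteq> 0" "?x' + ?h \<noteq> 0"
      using pos unfolding c by auto
    have "?x - ?x' = (fst p - fst p', 0, snd p - snd p')" by simp
    hence "norm (?x - ?x') = dist p p'" by (simp add: norm_Pair dist_plane)
    hence "norm (?x - ?x') \<le> 3 * R" using pp by simp
    from inverse_norm_second_difference[OF R this _ nz] show ?thesis
      using h unfolding c nh by simp
  qed
  have int: "set_integrable lborel {0..pi} (\<lambda>\<theta>. cos \<theta> / ?c p \<theta>)" "set_integrable lborel {0..pi} (\<lambda>\<theta>. cos \<theta> / ?c (p + e) \<theta>)"
    "set_integrable lborel {0..pi} (\<lambda>\<theta>. cos \<theta> / ?c p' \<theta>)" "set_integrable lborel {0..pi} (\<lambda>\<theta>. cos \<theta> / ?c (p' + e) \<theta>)"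
    by (intro ring_potential_integrable less_imp_le p pe q ne)+
  let ?S = "(ring_potential (p + e) q - ring_potential p q) - (ring_potential (p' + e) q - ring_potential p' q)"
  let ?F = "\<lambda>\<theta>. (cos \<theta> / ?c (p + e) \<theta> - cos \<theta> / ?c p \<theta>) - (cos \<theta> / ?c (p' + e) \<theta> - cos \<theta> / ?c p' \<theta>)"
  have S: "?S = (LINT \<theta>:{0..pi}|lborel. ?F \<theta>)"
    unfolding ring_potential_def using int by (simp add: set_integral_diff)
  have intF: "set_integrable lborel {0..pi} ?F" by (intro set_integral_diff int)
  have [measurable]: "(\<lambda>\<theta>. diff_kernel R (?c p \<theta>)) \<in> borel_measurable borel" for p
    unfolding diff_kernel_def chord_def by measurable
  have K0: "0 \<le> diff_kernel R (?c p \<theta>)" if "0 < fst p" "p \<noteq> q" for p \<theta>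
    using chord_pos[of p q \<theta>] that q R by (simp add: diff_kernel_def)
  have "ennreal (fst q * \<bar>?S\<bar>) = ennreal (fst q) * ennreal (norm ?S)" using q by (simp add: ennreal_mult')
  also have "\<dots> \<le> ennreal (fst q) * (\<integral>\<^sup>+ \<theta>. ennreal (norm (indicator {0..pi} \<theta> *\<^sub>R ?F \<theta>)) \<partial>lborel)"
    unfolding S set_lebesgue_integral_def using intF
    by (intro mult_left_mono integral_norm_bound_ennreal) (auto simp: set_integrable_def)
  also have "\<dots> \<le> ennreal (fst q) * (\<integral>\<^sup>+ \<theta>\<in>{0..pi}. ennreal (200 * \<bar>h\<bar> * ?K \<theta>) \<partial>lborel)"
  proof (intro mult_left_mono nn_integral_mono)
    fix \<theta> :: real
    have "?F \<theta> = cos \<theta> * ?D \<theta>" by (simp add: algebra_simps)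
    hence "\<bar>?F \<theta>\<bar> = \<bar>cos \<theta>\<bar> * \<bar>?D \<theta>\<bar>" by (simp add: abs_mult)
    also have "\<dots> \<le> 1 * \<bar>?D \<theta>\<bar>" by (intro mult_right_mono) auto
    also have "\<dots> \<le> 200 * \<bar>h\<bar> * ?K \<theta>" using D[of \<theta>] by simp
    finally show "ennreal (norm (indicator {0..pi} \<theta> *\<^sub>R ?F \<theta>)) \<le> ennreal (200 * \<bar>h\<bar> * ?K \<theta>) * indicator {0..pi} \<theta>"
      by (auto simp: indicator_def intro!: ennreal_leI)
  qed auto
  also have "\<dots> = (\<integral>\<^sup>+ \<theta>. ennreal (fst q) * (ennreal (200 * \<bar>h\<bar> * ?K \<theta>) * indicator {0..pi} \<theta>) \<partial>lborel)"
    by (intro nn_integral_cmult[symmetric]) measurable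
  also have "\<dots> = (\<integral>\<^sup>+ \<theta>. ennreal (200 * \<bar>h\<bar>) * (ennreal (fst q * diff_kernel R (?c p \<theta>)) * indicator {0..pi} \<theta>
       + ennreal (fst q * diff_kernel R (?c (p + e) \<theta>)) * indicator {0..pi} \<theta>
       + ennreal (fst q * diff_kernel R (?c p' \<theta>)) * indicator {0..pi} \<theta>
       + ennreal (fst q * diff_kernel R (?c (p' + e) \<theta>)) * indicator {0..pi} \<theta>) \<partial>lborel)"
  proof (intro nn_integral_cong)
    fix \<theta> :: real
    have k: "0 \<le> fst q * diff_kernel R (?c p \<theta>)" "0 \<le> fst q * diff_kernel R (?c (p + e) \<theta>)"
      "0 \<le> fst q * diff_kernel R (?c p' \<theta>)" "0 \<le> fst q * diff_kernel R (?c (p' + e) \<theta>)"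
      using q by (intro mult_nonneg_nonneg K0 p pe ne; simp)+
    have "ennreal (fst q) * ennreal (200 * \<bar>h\<bar> * ?K \<theta>) = ennreal (fst q * (200 * \<bar>h\<bar> * ?K \<theta>))"
      using q by (simp add: ennreal_mult')
    also have "fst q * (200 * \<bar>h\<bar> * ?K \<theta>) = 200 * \<bar>h\<bar> * (fst q * diff_kernel R (?c p \<theta>) + fst q * diff_kernel R (?c (p + e) \<theta>)
        + fst q * diff_kernel R (?c p' \<theta>) + fst q * diff_kernel R (?c (p' + e) \<theta>))"
      by (simp add: algebra_simps)
    also have "ennreal \<dots> = ennreal (200 * \<bar>h\<bar>) * (ennreal (fst q * diff_kernel R (?c p \<theta>)) + ennreal (fst q * diff_kernel R (?c (p + e) \<theta>))
        + ennreal (fst q * diff_kernel R (?c p' \<theta>)) + ennreal (fst q * diff_kernel R (?c (p' + e) \<theta>)))"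
      using k by (simp only: ennreal_mult' ennreal_plus add_nonneg_nonneg abs_ge_zero mult_nonneg_nonneg zero_le_numeral)
    finally show "ennreal (fst q) * (ennreal (200 * \<bar>h\<bar> * ?K \<theta>) * indicator {0..pi} \<theta>) = ennreal (200 * \<bar>h\<bar>) * (ennreal (fst q * diff_kernel R (?c p \<theta>)) * indicator {0..pi} \<theta>
       + ennreal (fst q * diff_kernel R (?c (p + e) \<theta>)) * indicator {0..pi} \<theta>
       + ennreal (fst q * diff_kernel R (?c p' \<theta>)) * indicator {0..pi} \<theta>
       + ennreal (fst q * diff_kernel R (?c (p' + e) \<theta>)) * indicator {0..pi} \<theta>)"
      by (simp add: indicator_def)
  qed
  also have "\<dots> = ennreal (200 * \<bar>h\<bar>) * ((\<integral>\<^sup>+ \<theta>\<in>{0..pi}. ennreal (fst q * diff_kernel R (?c p \<theta>)) \<partial>lborel)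
      + (\<integral>\<^sup>+ \<theta>\<in>{0..pi}. ennreal (fst q * diff_kernel R (?c (p + e) \<theta>)) \<partial>lborel)
      + (\<integral>\<^sup>+ \<theta>\<in>{0..pi}. ennreal (fst q * diff_kernel R (?c p' \<theta>)) \<partial>lborel)
      + (\<integral>\<^sup>+ \<theta>\<in>{0..pi}. ennreal (fst q * diff_kernel R (?c (p' + e) \<theta>)) \<partial>lborel))"
    by (simp add: nn_integral_cmult nn_integral_add)
  also have "\<dots> \<le> ennreal (200 * \<bar>h\<bar>) * (ennreal (8 * plane_kernel R (dist p q)) + ennreal (8 * plane_kernel R (dist (p + e) q))
      + ennreal (8 * plane_kernel R (dist p' q)) + ennreal (8 * plane_kernel R (dist (p' + e) q)))"
    by (intro mult_left_mono add_mono angular_diff_kernel_le p pe q ne R) auto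
  also have "\<dots> = ennreal (200 * \<bar>h\<bar> * (8 * plane_kernel R (dist p q) + 8 * plane_kernel R (dist (p + e) q)
      + 8 * plane_kernel R (dist p' q) + 8 * plane_kernel R (dist (p' + e) q)))"
  proof -
    have "0 \<le> 8 * plane_kernel R (dist u v)" for u v :: "real \<times> real" using R by (simp add: plane_kernel_def)
    thus ?thesis by (simp only: ennreal_mult' ennreal_plus add_nonneg_nonneg abs_ge_zero mult_nonneg_nonneg zero_le_numeral)
  qed
  finally have "fst q * \<bar>?S\<bar> \<le> 200 * \<bar>h\<bar> * (8 * plane_kernel R (dist p q) + 8 * plane_kernel R (dist (p + e) q)
      + 8 * plane_kernel R (dist p' q) + 8 * plane_kernel R (dist (p' + e) q))"
    using R by (subst (asm) ennreal_le_iff) (auto simp: plane_kernel_def)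
  thus ?thesis by (simp add: algebra_simps)
qed

section \<open>The radial velocity\<close>

lemma set_nn_integral_bound:
  fixes f :: "real \<times> real \<Rightarrow> real"
  assumes "set_integrable lborel A f"
    and "(\<integral>\<^sup>+q\<in>A. ennreal \<bar>f q\<bar> \<partial>lborel) \<le> ennreal c" "0 \<le> c"
  shows "\<bar>LINT q:A|lborel. f q\<bar> \<le> c"
proof -
  have "ennreal (norm (LINT q:A|lborel. f q)) \<le> (\<integral>\<^sup>+ q. ennreal (norm (indicator A q *\<^sub>R f q)) \<partial>lborel)"
    unfolding set_lebesgue_integral_def using assms(1)
    by (intro integral_norm_bound_ennreal) (simp add: set_integrable_def)
  also have "\<dots> = (\<integral>\<^sup>+q\<in>A. ennreal \<bar>f q\<bar> \<partial>lborel)"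
    by (intro nn_integral_cong) (simp add: indicator_def)
  finally have "ennreal (norm (LINT q:A|lborel. f q)) \<le> ennreal c" using assms(2) by simp
  thus ?thesis using assms(3) by (simp add: ennreal_le_iff)
qed

lemma plane_kernel_dist_borel [measurable]:
  "(\<lambda>q. plane_kernel R (dist p q)) \<in> borel_measurable (borel :: (real \<times> real) measure)"
  unfolding plane_kernel_def dist_plane by measurable

text \<open>The constant is 4 * 1600, one share for each of the four base points, all controlled by
  the same \<open>b\<close>.\<close>

lemma potential_second_difference:
  fixes w :: "real \<times> real \<Rightarrow> real" and p p' :: "real \<times> real" and h R :: real
  defines "e \<equiv> (0, h)" and "I \<equiv> \<lambda>x. LINT q:half_plane|lborel. fst q * w q * ring_potential x q"
  assumes [measurable]: "w \<in> borel_measurable borel"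
    and w: "AE q in lborel. q \<in> half_plane \<longrightarrow> \<bar>w q\<bar> \<le> M * fst q" and M: "M \<ge> 0"
    and P: "radial_moment 0 w < \<infinity>" "radial_moment 2 w < \<infinity>"
    and p: "0 < fst p" "0 < fst p'" and R: "R > 0" and pp: "dist p p' \<le> 3 * R" and h: "\<bar>h\<bar> \<le> R"
    and b: "0 \<le> b" "\<And>x. x \<in> {p, p + e, p', p' + e} \<Longrightarrow>
      (\<integral>\<^sup>+ q\<in>half_plane. ennreal (plane_kernel R (dist x q) * \<bar>w q\<bar>) \<partial>lborel) \<le> ennreal b"
  shows "\<bar>(I (p + e) - I p) - (I (p' + e) - I p')\<bar> \<le> 6400 * \<bar>h\<bar> * b"
proof -
  have pe: "0 < fst (p + e)" "0 < fst (p' + e)" using p by (auto simp: e_def)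
  have int: "set_integrable lborel half_plane (\<lambda>q. fst q * w q * ring_potential x q)" if "0 < fst x" for x
    by (rule stream_integrand_integrable[OF _ w M that P]) simp
  note i = int[OF p(1)] int[OF p(2)] int[OF pe(1)] int[OF pe(2)]
  let ?f = "\<lambda>q. (fst q * w q * ring_potential (p + e) q - fst q * w q * ring_potential p q)
      - (fst q * w q * ring_potential (p' + e) q - fst q * w q * ring_potential p' q)"
  let ?k = "\<lambda>x q. ennreal (plane_kernel R (dist x q) * \<bar>w q\<bar>) * indicator half_plane q"
  have eq: "(I (p + e) - I p) - (I (p' + e) - I p') = (LINT q:half_plane|lborel. ?f q)"
    unfolding I_def using i by (simp add: set_integral_diff)
  have "(\<integral>\<^sup>+q\<in>half_plane. ennreal \<bar>?f q\<bar> \<partial>lborel) \<le>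
    (\<integral>\<^sup>+q. ennreal (1600 * \<bar>h\<bar>) * (?k p q + ?k (p + e) q + ?k p' q + ?k (p' + e) q) \<partial>lborel)"
  proof (intro nn_integral_mono_AE, use AE_half_plane_off[of p] AE_half_plane_off[of "p + e"]
      AE_half_plane_off[of p'] AE_half_plane_off[of "p' + e"] in eventually_elim)
    fix q assume ne: "q \<in> half_plane \<longrightarrow> 0 < fst q \<and> p \<noteq> q" "q \<in> half_plane \<longrightarrow> 0 < fst q \<and> p + e \<noteq> q"
      "q \<in> half_plane \<longrightarrow> 0 < fst q \<and> p' \<noteq> q" "q \<in> half_plane \<longrightarrow> 0 < fst q \<and> p' + e \<noteq> q"
    show "ennreal \<bar>?f q\<bar> * indicator half_plane q \<le> ennreal (1600 * \<bar>h\<bar>) * (?k p q + ?k (p + e) q + ?k p' q + ?k (p' + e) q)"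
    proof (cases "q \<in> half_plane")
      case True
      hence q: "0 < fst q" using ne by simp
      let ?S = "(ring_potential (p + e) q - ring_potential p q) - (ring_potential (p' + e) q - ring_potential p' q)"
      have f: "\<bar>?f q\<bar> = \<bar>w q\<bar> * (fst q * \<bar>?S\<bar>)"
      proof -
        have "?f q = w q * (fst q * ?S)" by (simp add: algebra_simps)
        thus ?thesis using q by (simp add: abs_mult)
      qed
      let ?K = "plane_kernel R (dist p q) + plane_kernel R (dist (p + e) q) + plane_kernel R (dist p' q) + plane_kernel R (dist (p' + e) q)"
      have "fst q * \<bar>?S\<bar> \<le> 1600 * \<bar>h\<bar> * ?K"
        unfolding e_def by (intro ring_potential_second_difference p q R pp h) (use ne True in \<open>auto simp: e_def\<close>)
      hence "\<bar>w q\<bar> * (fst q * \<bar>?S\<bar>) \<le> \<bar>w q\<bar> * (1600 * \<bar>h\<bar> * ?K)" by (intro mult_left_mono) auto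
      also have "\<dots> = 1600 * \<bar>h\<bar> * (plane_kernel R (dist p q) * \<bar>w q\<bar> + plane_kernel R (dist (p + e) q) * \<bar>w q\<bar>
          + plane_kernel R (dist p' q) * \<bar>w q\<bar> + plane_kernel R (dist (p' + e) q) * \<bar>w q\<bar>)"
        by (simp add: algebra_simps)
      finally have "ennreal \<bar>?f q\<bar> \<le> ennreal (1600 * \<bar>h\<bar> * (plane_kernel R (dist p q) * \<bar>w q\<bar> + plane_kernel R (dist (p + e) q) * \<bar>w q\<bar>
          + plane_kernel R (dist p' q) * \<bar>w q\<bar> + plane_kernel R (dist (p' + e) q) * \<bar>w q\<bar>))"
        unfolding f by (rule ennreal_leI)
      also have "\<dots> = ennreal (1600 * \<bar>h\<bar>) * (?k p q + ?k (p + e) q + ?k p' q + ?k (p' + e) q)"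
      proof -
        have "0 \<le> plane_kernel R (dist x q) * \<bar>w q\<bar>" for x using R by (simp add: plane_kernel_def)
        moreover have "0 \<le> 1600 * \<bar>h\<bar>" by simp
        ultimately show ?thesis using True
          by (simp only: ennreal_mult'[of "1600 * \<bar>h\<bar>"] ennreal_plus add_nonneg_nonneg indicator_simps mult_1_right)
      qed
      finally show ?thesis using True by simp
    qed simp
  qed
  also have "\<dots> = ennreal (1600 * \<bar>h\<bar>) * ((\<integral>\<^sup>+q. ?k p q \<partial>lborel) + (\<integral>\<^sup>+q. ?k (p + e) q \<partial>lborel)
      + (\<integral>\<^sup>+q. ?k p' q \<partial>lborel) + (\<integral>\<^sup>+q. ?k (p' + e) q \<partial>lborel))"
    by (simp add: nn_integral_cmult nn_integral_add)
  also have "\<dots> \<le> ennreal (1600 * \<bar>h\<bar>) * (ennreal b + ennreal b + ennreal b + ennreal b)"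
    by (intro mult_left_mono add_mono b(2)) auto
  also have "\<dots> = ennreal (1600 * \<bar>h\<bar> * (b + b + b + b))"
    using b(1) by (simp only: ennreal_mult'[of "1600 * \<bar>h\<bar>"] ennreal_plus add_nonneg_nonneg abs_ge_zero mult_nonneg_nonneg zero_le_numeral)
  also have "1600 * \<bar>h\<bar> * (b + b + b + b) = 6400 * \<bar>h\<bar> * b" by simp
  finally have "(\<integral>\<^sup>+q\<in>half_plane. ennreal \<bar>?f q\<bar> \<partial>lborel) \<le> ennreal (6400 * \<bar>h\<bar> * b)" .
  thus ?thesis unfolding eq using b(1) i
    by (intro set_nn_integral_bound set_integral_diff) auto
qed

text \<open>The factor r in \<open>biot_savart\<close> cancels the one in front of the stream
  function, so velocities at different radii compare through the same reduced integral. The second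
  difference is linear in \<open>h\<close>, hence the bound survives division by \<open>h\<close>
  and the limit. As the vertical steps keep the radius, the kernel bound is assumed for all points
  at the two radii.\<close>

lemma velocity_difference_le:
  fixes p p' :: "real \<times> real" and R :: real
  assumes [measurable]: "w \<in> borel_measurable borel"
    and w: "AE q in lborel. q \<in> half_plane \<longrightarrow> \<bar>w q\<bar> \<le> M * fst q" and M: "M \<ge> 0"
    and P: "radial_moment 0 w < \<infinity>" "radial_moment 2 w < \<infinity>"
    and bs: "biot_savart w ur uz"
    and p: "0 < fst p" "0 < fst p'" and R: "R > 0" and pp: "dist p p' \<le> 3 * R"
    and b: "0 \<le> b" "\<And>x. fst x \<in> {fst p, fst p'} \<Longrightarrow>
      (\<integral>\<^sup>+ q\<in>half_plane. ennreal (plane_kernel R (dist x q) * \<bar>w q\<bar>) \<partial>lborel) \<le> ennreal b"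
  shows "\<bar>ur p - ur p'\<bar> \<le> 6400 * b"
proof -
  let ?Q = "\<lambda>x h. (stream_function w (fst x, snd x + h) - stream_function w (fst x, snd x)) / h"
  let ?I = "\<lambda>x. LINT q:half_plane|lborel. fst q * w q * ring_potential x q"
  have lim: "((\<lambda>h. ?Q x h / fst x) \<longlongrightarrow> ur x) (at 0)" if "0 < fst x" for x
  proof -
    have "((\<lambda>z'. stream_function w (fst x, z')) has_real_derivative fst x * ur (fst x, snd x)) (at (snd x))"
      using bs that unfolding biot_savart_def by blast
    hence "((\<lambda>h. ?Q x h) \<longlongrightarrow> fst x * ur x) (at 0)" by (simp add: DERIV_def)
    hence "((\<lambda>h. ?Q x h / fst x) \<longlongrightarrow> fst x * ur x / fst x) (at 0)" using that by (intro tendsto_divide tendsto_const) auto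
    thus ?thesis using that by simp
  qed
  have "((\<lambda>h. \<bar>?Q p h / fst p - ?Q p' h / fst p'\<bar>) \<longlongrightarrow> \<bar>ur p - ur p'\<bar>) (at 0)"
    by (intro tendsto_rabs tendsto_diff lim p)
  moreover have "\<forall>\<^sub>F h in at 0. \<bar>?Q p h / fst p - ?Q p' h / fst p'\<bar> \<le> 6400 * b"
    unfolding eventually_at
  proof (intro exI[of _ R] conjI R ballI impI)
    fix h :: real assume "h \<noteq> 0 \<and> dist h 0 < R"
    hence h0: "h \<noteq> 0" and h: "\<bar>h\<bar> \<le> R" by auto
    have Q: "?Q x h / fst x = (?I (x + (0, h)) - ?I x) / (2 * pi * h)" if "0 < fst x" for x
    proof -
      have "stream_function w (fst x, snd x + h) = fst x / (2 * pi) * ?I (x + (0, h))"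
        using stream_function_eq[of w "x + (0, h)"] that by (simp add: plus_prod_def)
      moreover have "stream_function w (fst x, snd x) = fst x / (2 * pi) * ?I x"
        using stream_function_eq[of w x] that by simp
      moreover have "(fst x / (2 * pi) * A - fst x / (2 * pi) * B) / h / fst x = (A - B) / (2 * pi * h)" for A B
        using that unfolding right_diff_distrib[symmetric] by simp
      ultimately show ?thesis by simp
    qed
    have "\<bar>(?I (p + (0, h)) - ?I p) - (?I (p' + (0, h)) - ?I p')\<bar> \<le> 6400 * \<bar>h\<bar> * b"
      by (intro potential_second_difference[OF _ w M P p R pp h b(1)] b(2)) auto
    hence "\<bar>(?I (p + (0, h)) - ?I p) - (?I (p' + (0, h)) - ?I p')\<bar> / \<bar>2 * pi * h\<bar> \<le> 6400 * \<bar>h\<bar> * b / \<bar>2 * pi * h\<bar>"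
      by (intro divide_right_mono) auto
    also have "6400 * \<bar>h\<bar> * b / \<bar>2 * pi * h\<bar> = 6400 * b / (2 * pi)" using h0 by (simp add: abs_mult)
    \<comment> \<open>The factor 1 / (2 pi) of the Biot-Savart law is simply estimated by 1.\<close>
    also have "\<dots> \<le> 6400 * b / 1" using b(1) pi_ge_two by (intro divide_left_mono) auto
    finally show "\<bar>?Q p h / fst p - ?Q p' h / fst p'\<bar> \<le> 6400 * b"
      unfolding Q[OF p(1)] Q[OF p(2)] by (simp only: abs_divide[symmetric] diff_divide_distrib div_by_1)
  qed
  ultimately show ?thesis by (rule tendsto_upperbound) simp
qed

lemma cubic_radius_exists:
  fixes r L :: real
  assumes r: "r > 0" and L: "L > 0"
  shows "\<exists>R>0. (r + R) * R\<^sup>2 = L"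
proof -
  let ?f = "\<lambda>R. (r + R) * R\<^sup>2" and ?B = "max 1 L"
  have "L \<le> ?B" by simp
  also have "?B \<le> ?f ?B"
  proof -
    have "?B * 1 \<le> (r + ?B) * ?B\<^sup>2"
      using r by (intro mult_mono) auto
    thus ?thesis by simp
  qed
  finally have "\<exists>R\<ge>0. R \<le> ?B \<and> ?f R = L"
    using L by (intro IVT' continuous_intros) auto
  then obtain R where R: "R \<ge> 0" "?f R = L" by auto
  have "R \<noteq> 0" using R(2) L by auto
  thus ?thesis using R by (intro exI[of _ R]) auto
qed

text \<open>
  The scale \<open>R\<close> with \<open>(r + R) R\<^sup>2 = L\<close> balances the energy in a box of size \<open>R\<close> just outside
  radius \<open>r\<close> against the oscillation of the radial velocity over that box.
\<close>

lemma radial_velocity_le: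
  fixes ur uz w :: "real \<times> real \<Rightarrow> real"
  assumes [measurable]: "w \<in> borel_measurable borel" "ur \<in> borel_measurable borel"
    and w: "AE q in lborel. q \<in> half_plane \<longrightarrow> \<bar>w q\<bar> \<le> M * fst q" and M: "M \<ge> 0"
    and P0: "radial_moment 0 w < \<infinity>" and P2: "radial_moment 2 w \<le> ennreal P" "P \<ge> 0"
    and bs: "biot_savart w ur uz"
    and E: "(\<integral>\<^sup>+ p. ennreal ((ur p)\<^sup>2) \<partial>cyl_measure) \<le> ennreal E" "E \<ge> 0"
    and L: "L > 0" and \<nu>: "\<nu> > 0" and p: "0 < fst p"
  shows "\<bar>ur p\<bar> \<le> 6400 * (324 * M * \<nu> powr (-1/3) * (3 * L) powr (1/3) + \<nu> * P) + sqrt (E / L)"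
proof (rule ccontr)
  define b where "b = 324 * M * \<nu> powr (-1/3) * (3 * L) powr (1/3) + \<nu> * P"
  \<comment> \<open>By the oscillation bound, what is left of the speed throughout the box.\<close>
  define U where "U = \<bar>ur p\<bar> - 6400 * b"
  assume "\<not> ?thesis"
  hence U: "U > sqrt (E / L)" by (simp add: U_def b_def)
  have U0: "U > 0" using U E L by (intro le_less_trans[OF _ U]) auto
  have b0: "0 \<le> b" using M \<nu> P2 by (simp add: b_def)
  obtain R where R: "R > 0" and RL: "(fst p + R) * R\<^sup>2 = L" using cubic_radius_exists[OF p L] by blast
  define r z where "r = fst p" "z = snd p"
  note rz = this
  \<comment> \<open>The box is shifted outwards so that the volume density is at least r + R on it.
    Its volume, up to 2 pi, is then at least (r + R) R^2 = L, even when \<open>p\<close> is close to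
    the axis.\<close>
  let ?B = "{r + R..r + 2 * R} \<times> {z..z + R}"
  have [measurable]: "?B \<in> sets borel" by (intro borel_closed closed_Times) auto
  have near: "U\<^sup>2 \<le> (ur p')\<^sup>2" if p': "p' \<in> ?B" for p'
  proof -
    have p'0: "0 < fst p'" using p' p R by (auto simp: rz)
    have "dist p p' \<le> \<bar>fst p - fst p'\<bar> + \<bar>snd p - snd p'\<bar>"
      unfolding dist_plane by (rule sqrt_sum_squares_le_sum_abs)
    also have "\<dots> \<le> 3 * R" using p' R by (auto simp: rz)
    finally have d: "dist p p' \<le> 3 * R" .
    have "\<bar>ur p - ur p'\<bar> \<le> 6400 * b"
    proof (rule velocity_difference_le[OF _ w M P0 _ bs p p'0 R d b0])
      show "radial_moment 2 w < \<infinity>" using P2 by (auto intro: le_less_trans)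
      fix x :: "real \<times> real" assume x: "fst x \<in> {fst p, fst p'}"
      have x0: "fst x > 0" using x p p'0 by auto
      \<comment> \<open>Radii in the box reach r + 2 R, so the cubic scale at \<open>x\<close>
        exceeds L by at most a factor 3.\<close>
      have "fst x + R \<le> 3 * (fst p + R)" using x p' p R by (auto simp: rz)
      hence "(fst x + R) * R\<^sup>2 \<le> 3 * (fst p + R) * R\<^sup>2" by (intro mult_right_mono) auto
      also have "\<dots> = 3 * L" by (simp only: mult.assoc RL)
      finally have le: "(fst x + R) * R\<^sup>2 \<le> 3 * L" .
      have "(\<integral>\<^sup>+ q\<in>half_plane. ennreal (plane_kernel R (dist x q) * \<bar>w q\<bar>) \<partial>lborel) \<le>
          ennreal (324 * M * \<nu> powr (-1/3) * ((fst x + R) * R\<^sup>2) powr (1/3)) + ennreal \<nu> * radial_moment 2 w"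
        by (intro plane_kernel_integral_le w M x0 R \<nu>) auto
      also have "\<dots> \<le> ennreal (324 * M * \<nu> powr (-1/3) * (3 * L) powr (1/3)) + ennreal \<nu> * ennreal P"
        using le x0 R M P2 by (intro add_mono mult_left_mono ennreal_leI powr_mono2) auto
      also have "\<dots> = ennreal b"
        using M \<nu> P2 by (simp add: b_def ennreal_mult')
      finally show "(\<integral>\<^sup>+ q\<in>half_plane. ennreal (plane_kernel R (dist x q) * \<bar>w q\<bar>) \<partial>lborel) \<le> ennreal b" .
    qed simp
    hence "U \<le> \<bar>ur p'\<bar>" unfolding U_def by linarith
    thus ?thesis using U0 by (metis less_imp_le power2_abs power_mono)
  qed
  have "ennreal (U\<^sup>2 * L) = ennreal (U\<^sup>2 * (r + R)) * emeasure lborel ?B"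
    using R U0 p RL by (simp add: emeasure_lborel_Times ennreal_mult'[symmetric] rz power2_eq_square mult_ac)
  also have "\<dots> = (\<integral>\<^sup>+ q. ennreal (U\<^sup>2 * (r + R)) * indicator ?B q \<partial>lborel)"
    by (simp add: nn_integral_cmult_indicator)
  also have "\<dots> \<le> (\<integral>\<^sup>+ q. ennreal (fst q) * ennreal ((ur q)\<^sup>2) * indicator open_half_plane q \<partial>lborel)"
  proof (intro nn_integral_mono)
    fix q :: "real \<times> real"
    show "ennreal (U\<^sup>2 * (r + R)) * indicator ?B q \<le> ennreal (fst q) * ennreal ((ur q)\<^sup>2) * indicator open_half_plane q"
    proof (cases "q \<in> ?B")
      case True
      hence q: "r + R \<le> fst q" "0 < fst q" using p R by (auto simp: rz)
      have "U\<^sup>2 * (r + R) \<le> (ur q)\<^sup>2 * fst q"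
        using near[OF True] q p R by (intro mult_mono) (auto simp: rz)
      hence "ennreal (U\<^sup>2 * (r + R)) \<le> ennreal (fst q * (ur q)\<^sup>2)" by (intro ennreal_leI) (simp add: mult.commute)
      thus ?thesis using True q by (simp add: open_half_plane_def ennreal_mult')
    qed simp
  qed
  also have "\<dots> = (\<integral>\<^sup>+ p. ennreal ((ur p)\<^sup>2) \<partial>cyl_measure)" by (subst nn_integral_cyl_measure) auto
  also have "\<dots> \<le> ennreal E" by (rule E(1))
  finally have "U\<^sup>2 * L \<le> E" using E(2) by (simp add: ennreal_le_iff)
  hence "U\<^sup>2 \<le> E / L" using L by (simp add: pos_le_divide_eq)
  hence "U \<le> sqrt (E / L)" using U0 by (simp add: real_le_rsqrt)
  thus False using U by simp
qed

section \<open>Displacement of particles\<close>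

text \<open>Rounding \<open>s\<close> down to multiples of 1/(n + 1) leaves countably many
  measurable sections; continuity in \<open>s\<close> gives the pointwise limit.\<close>

lemma caratheodory_measurable:
  fixes f :: "real \<Rightarrow> 'a \<Rightarrow> real"
  assumes [measurable]: "\<And>s. f s \<in> borel_measurable M"
    and cont: "\<And>p. p \<in> space M \<Longrightarrow> continuous_on UNIV (\<lambda>s. f s p)"
  shows "(\<lambda>x. f (fst x) (snd x)) \<in> borel_measurable (borel \<Otimes>\<^sub>M M)"
proof (rule borel_measurable_LIMSEQ_real)
  let ?g = "\<lambda>n s. real_of_int \<lfloor>s * real (Suc n)\<rfloor> / real (Suc n)"
  show "(\<lambda>x. f (?g n (fst x)) (snd x)) \<in> borel_measurable (borel \<Otimes>\<^sub>M M)" for n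
  proof (rule measurable_compose_countable[where f="\<lambda>i x. f (real_of_int i / real (Suc n)) (snd x)" and g="\<lambda>x. \<lfloor>fst x * real (Suc n)\<rfloor>"])
    show "(\<lambda>x. f (real_of_int i / real (Suc n)) (snd x)) \<in> borel_measurable (borel \<Otimes>\<^sub>M M)" for i by measurable
    show "(\<lambda>x. \<lfloor>fst x * real (Suc n)\<rfloor>) \<in> borel \<Otimes>\<^sub>M M \<rightarrow>\<^sub>M count_space UNIV" by measurable
  qed
  fix x :: "real \<times> 'a" assume "x \<in> space (borel \<Otimes>\<^sub>M M)"
  hence x: "snd x \<in> space M" by (auto simp: space_pair_measure)
  have quot: "\<bar>y - a * m\<bar> / m = \<bar>y / m - a\<bar>" if "m > 0" for y a m :: real
  proof -
    have "y / m - a = (y - a * m) / m" using that by (simp add: diff_divide_distrib)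
    thus ?thesis using that by simp
  qed
  have "(\<lambda>n. ?g n (fst x)) \<longlonglongrightarrow> fst x"
  proof (rule LIMSEQ_I)
    fix e :: real assume "e > 0"
    then obtain N where N: "inverse (real (Suc N)) < e" using reals_Archimedean by blast
    have "norm (?g n (fst x) - fst x) < e" if "n \<ge> N" for n
    proof -
      have "\<bar>real_of_int \<lfloor>fst x * real (Suc n)\<rfloor> - fst x * real (Suc n)\<bar> \<le> 1" by linarith
      hence "\<bar>real_of_int \<lfloor>fst x * real (Suc n)\<rfloor> - fst x * real (Suc n)\<bar> / real (Suc n) \<le> 1 / real (Suc n)"
        by (intro divide_right_mono) auto
      also have "1 / real (Suc n) \<le> 1 / real (Suc N)" using that by (intro divide_left_mono) auto
      also have "\<dots> < e" using N by (simp add: inverse_eq_divide)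
      also have "\<bar>real_of_int \<lfloor>fst x * real (Suc n)\<rfloor> - fst x * real (Suc n)\<bar> / real (Suc n) = \<bar>?g n (fst x) - fst x\<bar>"
        by (rule quot) simp
      finally show ?thesis by simp
    qed
    thus "\<exists>no. \<forall>n\<ge>no. norm (?g n (fst x) - fst x) < e" by blast
  qed
  moreover have "isCont (\<lambda>s. f s (snd x)) (fst x)"
    using cont[OF x] by (simp add: continuous_on_eq_continuous_at)
  ultimately show "(\<lambda>n. f (?g n (fst x)) (snd x)) \<longlonglongrightarrow> f (fst x) (snd x)"
    by (rule isCont_tendsto_compose[rotated])
qed

text \<open>No integrability of the derivative is needed: if its square is not integrable the bound is void.\<close>

lemma increment_square_le:
  fixes f f' :: "real \<Rightarrow> real"
  assumes T: "T > 0" and [measurable]: "f' \<in> borel_measurable borel"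
    and der: "\<And>s. s \<in> {0..T} \<Longrightarrow> (f has_real_derivative f' s) (at s within {0..T})"
  shows "ennreal ((f T - f 0)\<^sup>2) \<le> ennreal T * (\<integral>\<^sup>+ s\<in>{0..T}. ennreal ((f' s)\<^sup>2) \<partial>lborel)"
proof (cases "(\<integral>\<^sup>+ s\<in>{0..T}. ennreal ((f' s)\<^sup>2) \<partial>lborel) = \<infinity>")
  case True
  then show ?thesis using T by (simp add: ennreal_mult_top)
next
  case False
  define I where "I = integral {0..T} (\<lambda>s. (f' s)\<^sup>2)"
  have eq: "(\<integral>\<^sup>+ s\<in>{0..T}. ennreal ((f' s)\<^sup>2) \<partial>lborel) = (\<integral>\<^sup>+ s. ennreal (norm (indicator {0..T} s *\<^sub>R (f' s)\<^sup>2)) \<partial>lborel)"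
    by (intro nn_integral_cong) (simp add: indicator_def)
  have sint: "set_integrable lborel {0..T} (\<lambda>s. (f' s)\<^sup>2)"
    unfolding set_integrable_def using False unfolding eq by (intro integrableI_bounded) (auto simp: top.not_eq_extremum)
  have sq: "((\<lambda>s. (f' s)\<^sup>2) has_integral I) {0..T}"
    unfolding I_def using set_borel_integral_eq_integral(1)[OF sint] by (rule integrable_integral)
  have "(f' has_integral (f T - f 0)) {0..T}"
    using T der by (intro fundamental_theorem_of_calculus) (auto simp: has_real_derivative_iff_has_vector_derivative)
  \<comment> \<open>The mean slope. Integrating (f' - c)^2 \<ge> 0 is the Cauchy-Schwarz inequality,
    with the integral of f' known from the fundamental theorem.\<close>
  define c where "c = (f T - f 0) / T"
  have "((\<lambda>s. c\<^sup>2 + (f' s)\<^sup>2 - 2 * c * f' s) has_integral (T * c\<^sup>2 + I - 2 * c * (f T - f 0))) {0..T}"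
    using has_integral_const_real[of "c\<^sup>2" 0 T] T
    by (intro has_integral_diff has_integral_add has_integral_mult_right sq) (auto simp: \<open>(f' has_integral _) _\<close>)
  moreover have "0 \<le> c\<^sup>2 + (f' s)\<^sup>2 - 2 * c * f' s" for s
    using sum_squares_bound[of c "f' s"] by simp
  ultimately have "0 \<le> T * c\<^sup>2 + I - 2 * c * (f T - f 0)" by (rule has_integral_nonneg)
  moreover have "T * (T * c\<^sup>2 + I - 2 * c * (f T - f 0)) = T * I - (f T - f 0)\<^sup>2"
    using T by (simp add: c_def field_simps power2_eq_square)
  ultimately have "(f T - f 0)\<^sup>2 \<le> T * I" using T by (metis diff_ge_0_iff_ge mult_nonneg_nonneg less_imp_le)
  hence "ennreal ((f T - f 0)\<^sup>2) \<le> ennreal T * ennreal I" using T by (simp add: ennreal_mult'[symmetric] ennreal_leI)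
  also have "ennreal I = (\<integral>\<^sup>+ s\<in>{0..T}. ennreal ((f' s)\<^sup>2) \<partial>lborel)"
    using nn_integral_has_integral_lebesgue'[OF _ sq] by simp
  finally show ?thesis .
qed

lemma borel_measurable_cyl_extend:
  fixes f :: "real \<times> real \<Rightarrow> real"
  assumes "f \<in> borel_measurable cyl_measure"
  shows "(\<lambda>p. indicator open_half_plane p * f p) \<in> borel_measurable borel"
proof -
  have "f \<in> borel_measurable (restrict_space lborel open_half_plane)"
    using assms unfolding cyl_measure_def by simp
  thus ?thesis by (subst (asm) borel_measurable_restrict_space_iff) auto
qed

lemma particle_flow_radius_derivative:
  assumes "particle_flow ur uz X" "p \<in> open_half_plane" "t \<ge> 0"
  shows "((\<lambda>s. fst (X s p)) has_real_derivative ur t (X t p)) (at t within {0..})"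
proof -
  have "((\<lambda>s. X s p) has_vector_derivative (ur t (X t p), uz t (X t p))) (at t within {0..})"
    using assms unfolding particle_flow_def by blast
  from bounded_linear.has_vector_derivative[OF bounded_linear_fst this]
  show ?thesis by (simp add: has_real_derivative_iff_has_vector_derivative)
qed

lemma particle_flow_measurable:
  assumes "particle_flow ur uz X" "t \<ge> 0"
  shows "X t \<in> cyl_measure \<rightarrow>\<^sub>M cyl_measure" "distr cyl_measure cyl_measure (X t) = cyl_measure"
  using assms unfolding particle_flow_def by auto

lemma particle_flow_nn_integral:
  fixes f :: "real \<times> real \<Rightarrow> ennreal"
  assumes X: "particle_flow ur uz X" "t \<ge> 0" and f: "f \<in> borel_measurable borel"
  shows "(\<integral>\<^sup>+ p. f (X t p) \<partial>cyl_measure) = (\<integral>\<^sup>+ p. f p \<partial>cyl_measure)"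
proof -
  have "(\<integral>\<^sup>+ p. f p \<partial>cyl_measure) = (\<integral>\<^sup>+ p. f p \<partial>distr cyl_measure cyl_measure (X t))"
    by (simp add: particle_flow_measurable(2)[OF X])
  also have "\<dots> = (\<integral>\<^sup>+ p. f (X t p) \<partial>cyl_measure)"
    using measurable_cyl_measureI[OF f] by (intro nn_integral_distr particle_flow_measurable(1)[OF X]) simp
  finally show ?thesis ..
qed

text \<open>A solution comes with measurability of each \<open>ur t\<close> in space. Joint
  measurability along trajectories is recovered from the flow: the velocity is the limit of right
  difference quotients of the radius, which is continuous in time and measurable in the starting
  point.\<close>

lemma flow_velocity_measurable:
  assumes X: "particle_flow ur uz X"
  shows "(\<lambda>x. indicator {0..} (fst x) * indicator open_half_plane (snd x) * ur (fst x) (X (fst x) (snd x)))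
    \<in> borel_measurable (borel \<Otimes>\<^sub>M (borel :: (real \<times> real) measure))"
proof -
  \<comment> \<open>Freezing the trajectory at negative times makes it continuous on the whole
    line.\<close>
  define \<rho> where "\<rho> s p = indicator open_half_plane p * fst (X (max 0 s) p)" for s p
  have "\<rho> s \<in> borel_measurable borel" for s
    unfolding \<rho>_def
    by (intro borel_measurable_cyl_extend measurable_compose[OF particle_flow_measurable(1)[OF X]] measurable_cyl_measureI) auto
  moreover have "continuous_on UNIV (\<lambda>s. \<rho> s p)" for p
  proof (cases "p \<in> open_half_plane")
    case True
    have "continuous_on {0..} (\<lambda>s. fst (X s p))"
      unfolding continuous_on_eq_continuous_within
      using particle_flow_radius_derivative[OF X True] DERIV_continuous by (metis atLeast_iff)
    hence "continuous_on UNIV (\<lambda>s. fst (X (max 0 s) p))"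
      by (rule continuous_on_compose2) (auto intro!: continuous_intros)
    thus ?thesis using True by (simp add: \<rho>_def)
  qed (simp add: \<rho>_def)
  ultimately have "(\<lambda>x. \<rho> (fst x) (snd x)) \<in> borel_measurable (borel \<Otimes>\<^sub>M borel)"
    by (intro caratheodory_measurable) auto
  hence [measurable]: "(\<lambda>x. \<rho> (f x) (g x)) \<in> borel_measurable N"
    if "f \<in> borel_measurable N" "g \<in> borel_measurable N" for f g and N :: "'c measure"
    using measurable_compose[OF measurable_Pair[OF that], of "\<lambda>x. \<rho> (fst x) (snd x)"] by simp
  show ?thesis
  proof (rule borel_measurable_LIMSEQ_real)
    let ?u = "\<lambda>n x. indicator {0..} (fst x) * ((\<rho> (fst x + 1 / real (Suc n)) (snd x) - \<rho> (fst x) (snd x)) / (1 / real (Suc n)))"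
    show "?u n \<in> borel_measurable (borel \<Otimes>\<^sub>M borel)" for n by measurable
    fix x :: "real \<times> real \<times> real"
    show "(\<lambda>n. ?u n x) \<longlonglongrightarrow> indicator {0..} (fst x) * indicator open_half_plane (snd x) * ur (fst x) (X (fst x) (snd x))"
    proof (cases "0 \<le> fst x \<and> snd x \<in> open_half_plane")
      case True
      define s p where "s = fst x" "p = snd x"
      have s: "0 \<le> s" "p \<in> open_half_plane" using True by (auto simp: s_p_def)
      have D: "((\<lambda>y. (fst (X y p) - fst (X s p)) / (y - s)) \<longlongrightarrow> ur s (X s p)) (at s within {0..})"
        using particle_flow_radius_derivative[OF X s(2,1)] by (simp add: has_field_derivative_iff)
      have "(\<lambda>n. s + 1 / real (Suc n)) \<longlonglongrightarrow> s + 0"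
        by (intro tendsto_add tendsto_const LIMSEQ_Suc lim_1_over_n)
      hence "filterlim (\<lambda>n. s + 1 / real (Suc n)) (at s within {0..}) sequentially"
        using s by (auto simp: filterlim_at intro!: always_eventually)
      from filterlim_compose[OF D this]
      have "(\<lambda>n. (fst (X (s + 1 / real (Suc n)) p) - fst (X s p)) / (1 / real (Suc n))) \<longlonglongrightarrow> ur s (X s p)"
        by simp
      moreover have "max 0 (s + 1 / real (Suc n)) = s + 1 / real (Suc n)" for n using s by simp
      ultimately show ?thesis using s by (simp add: \<rho>_def s_p_def[symmetric])
    qed (auto simp: \<rho>_def)
  qed
qed

text \<open>After exchanging the integrals, volume preservation at each time s replaces the velocity
  along trajectories by \<open>ur s\<close> itself, whose square the energy bounds. One factor T
  comes from Cauchy-Schwarz, the other from the time integral.\<close>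

lemma radial_displacement_le:
  assumes X: "particle_flow ur uz X" and ur: "\<And>s. s \<ge> 0 \<Longrightarrow> ur s \<in> borel_measurable borel"
    and E: "\<And>s. s \<ge> 0 \<Longrightarrow> (\<integral>\<^sup>+ p. ennreal ((ur s p)\<^sup>2) \<partial>cyl_measure) \<le> ennreal E" and T: "T \<ge> 0"
  shows "(\<integral>\<^sup>+ p. ennreal ((fst (X T p) - fst p)\<^sup>2) \<partial>cyl_measure) \<le> ennreal (T\<^sup>2 * E)"
proof (cases "T = 0")
  case True
  have "(\<integral>\<^sup>+ p. ennreal ((fst (X T p) - fst p)\<^sup>2) \<partial>cyl_measure) = (\<integral>\<^sup>+ p. 0 \<partial>cyl_measure)"
    using X True by (intro nn_integral_cong) (auto simp: particle_flow_def)
  then show ?thesis by simp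
next
  case False
  hence T: "T > 0" using T by simp
  \<comment> \<open>The extension by 0 is the form in which \<open>flow_velocity_measurable\<close>
    gives joint measurability, as the exchange of integrals requires.\<close>
  define v where "v s p = indicator {0..} s * indicator open_half_plane p * ur s (X s p)" for s p
  have "(\<lambda>x. v (fst x) (snd x)) \<in> borel_measurable (borel \<Otimes>\<^sub>M borel)"
    unfolding v_def by (rule flow_velocity_measurable[OF X])
  hence v [measurable (raw)]: "(\<lambda>x. v (f x) (g x)) \<in> borel_measurable N"
    if "f \<in> borel_measurable N" "g \<in> borel_measurable N" for f g and N :: "'c measure"
    using measurable_compose[OF measurable_Pair[OF that], of "\<lambda>x. v (fst x) (snd x)"] by simp
  have "(\<integral>\<^sup>+ p. ennreal ((fst (X T p) - fst p)\<^sup>2) \<partial>cyl_measure) \<le>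
      (\<integral>\<^sup>+ p. ennreal T * (\<integral>\<^sup>+ s\<in>{0..T}. ennreal ((v s p)\<^sup>2) \<partial>lborel) \<partial>cyl_measure)"
  proof (intro nn_integral_mono)
    fix p assume "p \<in> space cyl_measure"
    hence p: "p \<in> open_half_plane" by simp
    have "ennreal ((fst (X T p) - fst (X 0 p))\<^sup>2) \<le> ennreal T * (\<integral>\<^sup>+ s\<in>{0..T}. ennreal ((v s p)\<^sup>2) \<partial>lborel)"
    proof (rule increment_square_le[OF T])
      show "(\<lambda>s. v s p) \<in> borel_measurable borel" by measurable
      fix s assume s: "s \<in> {0..T}"
      show "((\<lambda>s. fst (X s p)) has_real_derivative v s p) (at s within {0..T})"
        using particle_flow_radius_derivative[OF X p, of s] s p
        by (auto simp: v_def intro: DERIV_subset)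
    qed
    thus "ennreal ((fst (X T p) - fst p)\<^sup>2) \<le> ennreal T * (\<integral>\<^sup>+ s\<in>{0..T}. ennreal ((v s p)\<^sup>2) \<partial>lborel)"
      using X p by (simp add: particle_flow_def)
  qed
  also have "\<dots> = ennreal T * (\<integral>\<^sup>+ p. (\<integral>\<^sup>+ s\<in>{0..T}. ennreal ((v s p)\<^sup>2) \<partial>lborel) \<partial>cyl_measure)"
    by (intro nn_integral_cmult measurable_cyl_measureI lborel.borel_measurable_nn_integral) measurable
  also have "(\<integral>\<^sup>+ p. (\<integral>\<^sup>+ s\<in>{0..T}. ennreal ((v s p)\<^sup>2) \<partial>lborel) \<partial>cyl_measure) =
     (\<integral>\<^sup>+ p. \<integral>\<^sup>+ s. ennreal (fst p) * (ennreal ((v s p)\<^sup>2) * indicator {0..T} s) * indicator open_half_plane p \<partial>lborel \<partial>lborel)"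
    by (subst nn_integral_cyl_measure)
       (auto simp: nn_integral_cmult nn_integral_multc intro!: nn_integral_cong lborel.borel_measurable_nn_integral)
  also have "\<dots> = (\<integral>\<^sup>+ s. \<integral>\<^sup>+ p. ennreal (fst p) * (ennreal ((v s p)\<^sup>2) * indicator {0..T} s) * indicator open_half_plane p \<partial>lborel \<partial>lborel)"
    by (intro lborel_pair.Fubini') (simp add: split_beta)
  also have "\<dots> \<le> (\<integral>\<^sup>+ s. ennreal E * indicator {0..T} s \<partial>lborel)"
  proof (intro nn_integral_mono)
    fix s :: real
    show "(\<integral>\<^sup>+ p. ennreal (fst p) * (ennreal ((v s p)\<^sup>2) * indicator {0..T} s) * indicator open_half_plane p \<partial>lborel)
       \<le> ennreal E * indicator {0..T} s"
    proof (cases "s \<in> {0..T}")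
      case True
      hence s: "s \<ge> 0" by simp
      have "(\<integral>\<^sup>+ p. ennreal (fst p) * (ennreal ((v s p)\<^sup>2) * indicator {0..T} s) * indicator open_half_plane p \<partial>lborel)
         = (\<integral>\<^sup>+ p. ennreal ((v s p)\<^sup>2) \<partial>cyl_measure)"
        using True by (subst nn_integral_cyl_measure) auto
      also have "\<dots> = (\<integral>\<^sup>+ p. ennreal ((ur s (X s p))\<^sup>2) \<partial>cyl_measure)"
        using s by (intro nn_integral_cong) (auto simp: v_def)
      also have "\<dots> = (\<integral>\<^sup>+ p. ennreal ((ur s p)\<^sup>2) \<partial>cyl_measure)"
        using ur[OF s] by (intro particle_flow_nn_integral[OF X s, of "\<lambda>q. ennreal ((ur s q)\<^sup>2)"]) measurable
      also have "\<dots> \<le> ennreal E" by (rule E[OF s])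
      finally show ?thesis using True by simp
    qed simp
  qed
  also have "(\<integral>\<^sup>+ s. ennreal E * indicator {0..T} s \<partial>lborel) = ennreal E * ennreal T"
    using T by (simp add: nn_integral_cmult_indicator)
  also have "ennreal T * (ennreal E * ennreal T) = ennreal (T\<^sup>2 * E)"
    using T by (simp add: ennreal_mult' ennreal_mult'' power2_eq_square mult_ac)
  finally show ?thesis by (simp add: mult_left_mono)
qed

section \<open>Growth of moments and vorticity\<close>

lemma particle_flow_in_half_plane:
  assumes "particle_flow ur uz X" "p \<in> open_half_plane" "t \<ge> 0"
  shows "X t p \<in> open_half_plane"
  using assms unfolding particle_flow_def by blast

text \<open>The image of \<open>cyl_measure\<close> under the flow is \<open>cyl_measure\<close>
  itself, so a property holding almost everywhere after the flow holds almost everywhere.\<close>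

lemma AE_transported:
  assumes X: "particle_flow ur uz X" "t \<ge> 0"
    and Q: "Measurable.pred borel Q" and AE: "AE p in cyl_measure. Q (X t p)"
  shows "AE q in cyl_measure. Q q"
proof -
  have pred: "Measurable.pred cyl_measure Q"
    using Q unfolding cyl_measure_def by (simp add: measurable_restrict_space1)
  hence "AE q in distr cyl_measure cyl_measure (X t). Q q"
    using AE predE[OF pred] by (subst AE_distr_iff) (auto intro: particle_flow_measurable(1)[OF X])
  thus ?thesis unfolding particle_flow_measurable(2)[OF X] .
qed

lemma radial_moment_transported:
  assumes X: "particle_flow ur uz X" "t \<ge> 0" and w: "w \<in> borel_measurable borel"
    and tr: "AE p in cyl_measure. rel_vorticity w (X t p) = rel_vorticity w0 p"
  shows "radial_moment k w = (\<integral>\<^sup>+ p. ennreal (fst (X t p) ^ k * \<bar>rel_vorticity w0 p\<bar>) \<partial>cyl_measure)"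
proof -
  note rel_vorticity_borel[OF w, measurable]
  have "radial_moment k w = (\<integral>\<^sup>+ p. ennreal (fst (X t p) ^ k * \<bar>rel_vorticity w (X t p)\<bar>) \<partial>cyl_measure)"
    unfolding radial_moment_cyl_measure[OF w]
    by (intro particle_flow_nn_integral[OF X, symmetric, of "\<lambda>q. ennreal (fst q ^ k * \<bar>rel_vorticity w q\<bar>)"]) measurable
  also have "\<dots> = (\<integral>\<^sup>+ p. ennreal (fst (X t p) ^ k * \<bar>rel_vorticity w0 p\<bar>) \<partial>cyl_measure)"
    by (intro nn_integral_cong_AE) (use tr in eventually_elim, simp)
  finally show ?thesis .
qed

lemma fst_flow_borel_measurable:
  assumes "particle_flow ur uz X" "t \<ge> 0"
  shows "(\<lambda>p. fst (X t p)) \<in> borel_measurable cyl_measure"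
  by (intro measurable_compose[OF particle_flow_measurable(1)[OF assms]] measurable_cyl_measureI) simp

lemma second_moment_le:
  assumes X: "particle_flow ur uz X" "t \<ge> 0" and w: "w \<in> borel_measurable borel" "w0 \<in> borel_measurable borel"
    and tr: "AE p in cyl_measure. rel_vorticity w (X t p) = rel_vorticity w0 p"
    and M: "AE p in cyl_measure. \<bar>rel_vorticity w0 p\<bar> \<le> M" "M \<ge> 0"
    and disp: "(\<integral>\<^sup>+ p. ennreal ((fst (X t p) - fst p)\<^sup>2) \<partial>cyl_measure) \<le> ennreal (t\<^sup>2 * E)" and E: "0 \<le> E"
    and P: "radial_moment 2 w0 \<le> ennreal P" "P \<ge> 0"
  shows "radial_moment 2 w \<le> ennreal (2 * P + 2 * M * (t\<^sup>2 * E))"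
proof -
  note [measurable] = fst_flow_borel_measurable[OF X] measurable_cyl_measureI[OF rel_vorticity_borel[OF w(2)]]
    measurable_cyl_measureI[OF borel_measurable_fst_pair]
  have "radial_moment 2 w = (\<integral>\<^sup>+ p. ennreal (fst (X t p) ^ 2 * \<bar>rel_vorticity w0 p\<bar>) \<partial>cyl_measure)"
    by (rule radial_moment_transported[OF X w(1) tr])
  also have "\<dots> \<le> (\<integral>\<^sup>+ p. ennreal 2 * ennreal (fst p ^ 2 * \<bar>rel_vorticity w0 p\<bar>) + ennreal (2 * M) * ennreal ((fst (X t p) - fst p)\<^sup>2) \<partial>cyl_measure)"
  proof (intro nn_integral_mono_AE, use M(1) in eventually_elim)
    fix p assume m: "\<bar>rel_vorticity w0 p\<bar> \<le> M"
    define x r y where "x = fst (X t p)" "r = fst p" "y = \<bar>rel_vorticity w0 p\<bar>"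
    note defs = this
    \<comment> \<open>The initial radius keeps its vorticity weight and yields the initial moment;
      only the displacement term uses the bound \<open>M\<close>.\<close>
    have "x\<^sup>2 \<le> 2 * r\<^sup>2 + 2 * (x - r)\<^sup>2"
      using zero_le_power2[of "2 * r - x"] by (simp add: power2_eq_square algebra_simps)
    hence "x\<^sup>2 * y \<le> (2 * r\<^sup>2 + 2 * (x - r)\<^sup>2) * y" by (intro mult_right_mono) (auto simp: defs)
    also have "\<dots> = 2 * (r\<^sup>2 * y) + 2 * (x - r)\<^sup>2 * y" by (simp add: algebra_simps)
    also have "\<dots> \<le> 2 * (r\<^sup>2 * y) + 2 * (x - r)\<^sup>2 * M"
      using m by (intro add_left_mono mult_left_mono) (auto simp: defs)
    finally have "ennreal (x\<^sup>2 * y) \<le> ennreal (2 * (r\<^sup>2 * y) + (2 * M) * (x - r)\<^sup>2)" by (intro ennreal_leI) (simp add: mult_ac)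
    also have "\<dots> = ennreal (2 * (r\<^sup>2 * y)) + ennreal ((2 * M) * (x - r)\<^sup>2)" using M(2) by (intro ennreal_plus) (auto simp: defs)
    also have "\<dots> = ennreal 2 * ennreal (r\<^sup>2 * y) + ennreal (2 * M) * ennreal ((x - r)\<^sup>2)" using M(2) by (simp only: ennreal_mult'[of 2] ennreal_mult'[of "2 * M"] zero_le_numeral mult_nonneg_nonneg)
    finally show "ennreal (fst (X t p) ^ 2 * \<bar>rel_vorticity w0 p\<bar>) \<le> ennreal 2 * ennreal (fst p ^ 2 * \<bar>rel_vorticity w0 p\<bar>) + ennreal (2 * M) * ennreal ((fst (X t p) - fst p)\<^sup>2)"
      by (simp add: defs)
  qed
  also have "\<dots> = ennreal 2 * radial_moment 2 w0 + ennreal (2 * M) * (\<integral>\<^sup>+ p. ennreal ((fst (X t p) - fst p)\<^sup>2) \<partial>cyl_measure)"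
    unfolding radial_moment_cyl_measure[OF w(2)] by (subst nn_integral_add) (auto simp: nn_integral_cmult)
  also have "\<dots> \<le> ennreal 2 * ennreal P + ennreal (2 * M) * ennreal (t\<^sup>2 * E)"
    by (intro add_mono mult_left_mono P disp) auto
  also have "\<dots> \<le> ennreal (2 * P + 2 * M * (t\<^sup>2 * E))"
  proof -
    have n: "0 \<le> 2 * P" "0 \<le> 2 * M" "0 \<le> t\<^sup>2 * E" using P M E by auto
    show ?thesis
      unfolding ennreal_plus[OF n(1) mult_nonneg_nonneg[OF n(2,3)]] ennreal_mult'[OF n(2)]
      using P(2) by (simp add: ennreal_mult')
  qed
  finally show ?thesis .
qed

text \<open>Either x \<le> 2 r or x \<le> 2 A. In the second case only k - 2 powers are traded for
  A: the remaining x^2 feeds the second moment, which grows like t^2 rather than A^2 ~ t^(8/3). This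
  lowers the final exponent from 4/3 k to 4/3 k - 2/3.\<close>

lemma power_growth_le:
  fixes x r A :: real
  assumes "0 \<le> x" "x \<le> r + A" "0 \<le> r" "0 \<le> A" "2 \<le> k"
  shows "x ^ k \<le> 2 ^ k * r ^ k + (2 * A) ^ (k - 2) * x\<^sup>2"
proof (cases "A \<le> r")
  case True
  have "x ^ k \<le> (2 * r) ^ k" using True assms by (intro power_mono) auto
  thus ?thesis using assms by (simp add: power_mult_distrib add_increasing2)
next
  case False
  have "x ^ k = x ^ (k - 2 + 2)" by (subst le_add_diff_inverse2[OF assms(5)]) (rule refl)
  also have "\<dots> = x ^ (k - 2) * x\<^sup>2" by (rule power_add)
  also have "\<dots> \<le> (2 * A) ^ (k - 2) * x\<^sup>2" using False assms by (intro mult_right_mono power_mono) auto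
  finally show ?thesis using assms by (simp add: add_increasing)
qed

lemma moment_growth:
  assumes X: "particle_flow ur uz X" "t \<ge> 0" and w: "w \<in> borel_measurable borel" "w0 \<in> borel_measurable borel"
    and tr: "AE p in cyl_measure. rel_vorticity w (X t p) = rel_vorticity w0 p"
    and A: "\<And>p. p \<in> open_half_plane \<Longrightarrow> fst (X t p) \<le> fst p + A" "A \<ge> 0" and k: "2 \<le> k"
  shows "radial_moment k w \<le> ennreal (2 ^ k) * radial_moment k w0 + ennreal ((2 * A) ^ (k - 2)) * radial_moment 2 w"
proof -
  note [measurable] = fst_flow_borel_measurable[OF X] measurable_cyl_measureI[OF rel_vorticity_borel[OF w(2)]]
    measurable_cyl_measureI[OF borel_measurable_fst_pair]
  have "radial_moment k w = (\<integral>\<^sup>+ p. ennreal (fst (X t p) ^ k * \<bar>rel_vorticity w0 p\<bar>) \<partial>cyl_measure)"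
    by (rule radial_moment_transported[OF X w(1) tr])
  also have "\<dots> \<le> (\<integral>\<^sup>+ p. ennreal (2 ^ k) * ennreal (fst p ^ k * \<bar>rel_vorticity w0 p\<bar>)
      + ennreal ((2 * A) ^ (k - 2)) * ennreal (fst (X t p) ^ 2 * \<bar>rel_vorticity w0 p\<bar>) \<partial>cyl_measure)"
  proof (intro nn_integral_mono)
    fix p assume "p \<in> space cyl_measure"
    hence p: "p \<in> open_half_plane" by simp
    define x r y where "x = fst (X t p)" "r = fst p" "y = \<bar>rel_vorticity w0 p\<bar>"
    note defs = this
    have r: "0 \<le> r" using p by (simp add: defs open_half_plane_def)
    have x: "0 \<le> x" using particle_flow_in_half_plane[OF X(1) p X(2)] by (simp add: defs open_half_plane_def)
    have y: "0 \<le> y" by (simp add: defs)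
    have "x ^ k \<le> 2 ^ k * r ^ k + (2 * A) ^ (k - 2) * x\<^sup>2"
      using A(1)[OF p] by (intro power_growth_le x r A(2) k) (simp add: defs)
    hence "x ^ k * y \<le> (2 ^ k * r ^ k + (2 * A) ^ (k - 2) * x\<^sup>2) * y" using y by (rule mult_right_mono)
    also have "\<dots> = 2 ^ k * (r ^ k * y) + (2 * A) ^ (k - 2) * (x\<^sup>2 * y)" by (simp add: algebra_simps)
    finally have "ennreal (x ^ k * y) \<le> ennreal (2 ^ k * (r ^ k * y) + (2 * A) ^ (k - 2) * (x\<^sup>2 * y))" by (rule ennreal_leI)
    also have "\<dots> = ennreal (2 ^ k) * ennreal (r ^ k * y) + ennreal ((2 * A) ^ (k - 2)) * ennreal (x\<^sup>2 * y)"
    proof -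
      have n: "0 \<le> (2::real) ^ k" "0 \<le> r ^ k * y" "0 \<le> (2 * A) ^ (k - 2)" "0 \<le> x\<^sup>2 * y"
        using r x y A(2) by auto
      show ?thesis
        unfolding ennreal_plus[OF mult_nonneg_nonneg[OF n(1,2)] mult_nonneg_nonneg[OF n(3,4)]]
          ennreal_mult'[OF n(1)] ennreal_mult'[OF n(3)] ..
    qed
    finally show "ennreal (fst (X t p) ^ k * \<bar>rel_vorticity w0 p\<bar>) \<le> ennreal (2 ^ k) * ennreal (fst p ^ k * \<bar>rel_vorticity w0 p\<bar>)
      + ennreal ((2 * A) ^ (k - 2)) * ennreal (fst (X t p) ^ 2 * \<bar>rel_vorticity w0 p\<bar>)"
      by (simp add: defs)
  qed
  also have "\<dots> = ennreal (2 ^ k) * radial_moment k w0 + ennreal ((2 * A) ^ (k - 2)) * radial_moment 2 w"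
    unfolding radial_moment_cyl_measure[OF w(2)] radial_moment_transported[OF X w(1) tr, of 2]
    by (subst nn_integral_add) (auto simp: nn_integral_cmult)
  finally show ?thesis .
qed

text \<open>The velocity bound is asked for at every point, since an almost everywhere bound says
  nothing along a single trajectory; \<open>radial_velocity_le\<close> is pointwise for this
  reason.\<close>

lemma flow_radius_le:
  assumes X: "particle_flow ur uz X" "t \<ge> 0" and p: "p \<in> open_half_plane"
    and B: "\<And>s q. s \<ge> 0 \<Longrightarrow> s \<le> t \<Longrightarrow> q \<in> open_half_plane \<Longrightarrow> \<bar>ur s q\<bar> \<le> B"
  shows "fst (X t p) \<le> fst p + B * t"
proof -
  note Xin = particle_flow_in_half_plane[OF X(1) p]
  have "norm (fst (X t p) - fst (X 0 p)) \<le> B * norm (t - 0)"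
  proof (rule field_differentiable_bound[where S="{0..t}" and f'="\<lambda>s. ur s (X s p)"])
    fix s assume s: "s \<in> {0..t}"
    show "((\<lambda>s. fst (X s p)) has_field_derivative ur s (X s p)) (at s within {0..t})"
      using particle_flow_radius_derivative[OF X(1) p, of s] s by (auto intro: DERIV_subset)
    show "norm (ur s (X s p)) \<le> B" using B[of s "X s p"] Xin s by simp
  qed (use X(2) in auto)
  moreover have "X 0 p = p" using X(1) p by (simp add: particle_flow_def)
  ultimately show ?thesis using X(2) by simp
qed

text \<open>
  \<open>E\<close>, \<open>P\<close>, \<open>M\<close> and \<open>W\<close> bound the kinetic energy, \<open>P\<^sub>2(0)\<close>, \<open>\<bar>\<omega>\<^sub>0/r\<bar>\<close> and \<open>\<bar>\<omega>\<^sub>0\<bar>\<close>; the constants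
  depend on nothing else, so they are uniform over solutions.
\<close>

locale euler_data =
  fixes w0 :: "real \<times> real \<Rightarrow> real" and E P M W :: real
  assumes w0 [measurable]: "w0 \<in> borel_measurable borel"
    and E: "0 \<le> E" and P: "radial_moment 2 w0 \<le> ennreal P" "0 \<le> P"
    and M: "AE p in cyl_measure. \<bar>rel_vorticity w0 p\<bar> \<le> M" "0 \<le> M"
    and W: "AE p in cyl_measure. \<bar>w0 p\<bar> \<le> W" "0 \<le> W"
    and P0: "radial_moment 0 w0 < \<infinity>"
begin

definition "P2_const = 2 * P + 2 * M * E"
text \<open>The bound of \<open>radial_velocity_le\<close> at L = \<nu> = 1 with second moment
  \<open>P2_const\<close>, that is, at time 0.\<close>

definition "ur_const = 6400 * (324 * M * 3 powr (1/3) + P2_const) + sqrt E"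

lemma const_nonneg: "0 \<le> P2_const" "0 \<le> ur_const"
  using E P M by (auto simp: P2_const_def ur_const_def)

context
  fixes ur uz w :: "real \<Rightarrow> real \<times> real \<Rightarrow> real" and X
  assumes ur: "\<And>t. 0 \<le> t \<Longrightarrow> ur t \<in> borel_measurable borel"
    and w: "\<And>t. 0 \<le> t \<Longrightarrow> w t \<in> borel_measurable borel"
    and bs: "\<And>t. 0 \<le> t \<Longrightarrow> biot_savart (w t) (ur t) (uz t)"
    and X: "particle_flow ur uz X"
    and tr: "\<And>t. 0 \<le> t \<Longrightarrow> AE p in cyl_measure. rel_vorticity (w t) (X t p) = rel_vorticity w0 p"
    and energy: "\<And>t. 0 \<le> t \<Longrightarrow> (\<integral>\<^sup>+ p. ennreal ((ur t p)\<^sup>2) \<partial>cyl_measure) \<le> ennreal E"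
begin

lemma second_moment_growth:
  assumes t: "0 \<le> t"
  shows "radial_moment 2 (w t) \<le> ennreal (P2_const * (1 + t)\<^sup>2)"
proof -
  have "radial_moment 2 (w t) \<le> ennreal (2 * P + 2 * M * (t\<^sup>2 * E))"
    by (rule second_moment_le[OF X t w[OF t] w0 tr[OF t] M radial_displacement_le[OF X ur energy t] E P])
  also have "\<dots> \<le> ennreal (P2_const * (1 + t)\<^sup>2)"
  proof (rule ennreal_leI)
    have "1 \<le> (1 + t)\<^sup>2" "t\<^sup>2 \<le> (1 + t)\<^sup>2" using t by (auto simp: power2_eq_square algebra_simps)
    hence "2 * P * 1 + 2 * M * E * t\<^sup>2 \<le> 2 * P * (1 + t)\<^sup>2 + 2 * M * E * (1 + t)\<^sup>2"
      using E P M by (intro add_mono mult_left_mono) auto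
    thus "2 * P + 2 * M * (t\<^sup>2 * E) \<le> P2_const * (1 + t)\<^sup>2" by (simp add: P2_const_def algebra_simps)
  qed
  finally show ?thesis .
qed

lemma vorticity_le_radius:
  assumes t: "0 \<le> t"
  shows "AE q in lborel. q \<in> half_plane \<longrightarrow> \<bar>w t q\<bar> \<le> M * fst q"
proof -
  note w[OF t, measurable]
  have "AE p in cyl_measure. \<bar>rel_vorticity (w t) (X t p)\<bar> \<le> M"
    using tr[OF t] M(1) by eventually_elim simp
  hence "AE q in cyl_measure. \<bar>rel_vorticity (w t) q\<bar> \<le> M"
    by (intro AE_transported[OF X t, of "\<lambda>q. \<bar>rel_vorticity (w t) q\<bar> \<le> M"]) auto
  hence "AE q in lborel. q \<in> open_half_plane \<longrightarrow> \<bar>rel_vorticity (w t) q\<bar> \<le> M"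
    by (subst (asm) AE_cyl_measure_iff) auto
  thus ?thesis using AE_lborel_off_axis
    by eventually_elim (auto simp: open_half_plane_def half_plane_def rel_vorticity_def pos_divide_le_eq)
qed

text \<open>With \<tau> = 1 + t, take L = \<tau>^(-2/3) and \<nu> = \<tau>^(-5/3). The three terms
  then have the exponents 5/9 - 2/9, -5/3 + 2 and 1/3, all equal to 1/3.\<close>

lemma radial_velocity_growth:
  assumes t: "0 \<le> t" and p: "p \<in> open_half_plane"
  shows "\<bar>ur t p\<bar> \<le> ur_const * (1 + t) powr (1/3)"
proof -
  define \<tau> where "\<tau> = 1 + t"
  have \<tau>: "\<tau> > 0" using t by (simp add: \<tau>_def)
  have m0: "radial_moment 0 (w t) < \<infinity>"
  proof -
    have "radial_moment 0 (w t) = radial_moment 0 w0"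
      unfolding radial_moment_transported[OF X t w[OF t] tr[OF t]] radial_moment_cyl_measure[OF w0] by simp
    thus ?thesis using P0 by simp
  qed
  have "\<bar>ur t p\<bar> \<le> 6400 * (324 * M * (\<tau> powr (-5/3)) powr (-1/3) * (3 * \<tau> powr (-2/3)) powr (1/3)
      + \<tau> powr (-5/3) * (P2_const * \<tau>\<^sup>2)) + sqrt (E / \<tau> powr (-2/3))"
    using second_moment_growth[OF t] const_nonneg \<tau> p E unfolding \<tau>_def[symmetric]
    by (intro radial_velocity_le[OF w[OF t] ur[OF t] vorticity_le_radius[OF t] M(2) m0 _ _ bs[OF t] energy[OF t]])
       (auto simp: open_half_plane_def)
  also have "324 * M * (\<tau> powr (-5/3)) powr (-1/3) * (3 * \<tau> powr (-2/3)) powr (1/3) = 324 * M * 3 powr (1/3) * \<tau> powr (1/3)"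
  proof -
    have "(\<tau> powr (-5/3)) powr (-1/3) * (3 * \<tau> powr (-2/3)) powr (1/3) = 3 powr (1/3) * (\<tau> powr (5/9) * \<tau> powr (-2/9))"
      using \<tau> by (simp add: powr_mult powr_powr)
    also have "\<tau> powr (5/9) * \<tau> powr (-2/9) = \<tau> powr (1/3)" unfolding powr_add[symmetric] by simp
    finally show ?thesis by (simp add: mult.assoc)
  qed
  also have "\<tau> powr (-5/3) * (P2_const * \<tau>\<^sup>2) = P2_const * \<tau> powr (1/3)"
  proof -
    have "\<tau> powr (-5/3) * \<tau>\<^sup>2 = \<tau> powr (-5/3) * \<tau> powr 2" using \<tau> by simp
    also have "\<dots> = \<tau> powr (1/3)" unfolding powr_add[symmetric] by simp
    finally show ?thesis by (simp add: mult_ac)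
  qed
  also have "sqrt (E / \<tau> powr (-2/3)) = sqrt E * \<tau> powr (1/3)"
  proof -
    have "\<tau> powr (2/3) = (\<tau> powr (1/3))\<^sup>2" unfolding power2_eq_square powr_add[symmetric] by simp
    hence "E / \<tau> powr (-2/3) = E * (\<tau> powr (1/3))\<^sup>2" by (simp add: powr_minus_divide)
    thus ?thesis by (simp add: real_sqrt_mult)
  qed
  finally show ?thesis by (simp add: ur_const_def \<tau>_def algebra_simps)
qed

lemma flow_radius_growth:
  assumes t: "0 \<le> t" and p: "p \<in> open_half_plane"
  shows "fst (X t p) \<le> fst p + ur_const * (1 + t) powr (4/3)"
proof -
  have "fst (X t p) \<le> fst p + (ur_const * (1 + t) powr (1/3)) * t"
  proof (rule flow_radius_le[OF X t p])
    fix s q assume s: "0 \<le> s" "s \<le> t" and q: "q \<in> open_half_plane"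
    have "\<bar>ur s q\<bar> \<le> ur_const * (1 + s) powr (1/3)" by (rule radial_velocity_growth[OF s(1) q])
    also have "\<dots> \<le> ur_const * (1 + t) powr (1/3)"
      using s const_nonneg by (intro mult_left_mono powr_mono2) auto
    finally show "\<bar>ur s q\<bar> \<le> ur_const * (1 + t) powr (1/3)" .
  qed
  also have "\<dots> \<le> fst p + ur_const * ((1 + t) powr (1/3) * (1 + t) powr 1)"
    using t const_nonneg by (auto simp: mult.assoc intro!: mult_left_mono)
  also have "(1 + t) powr (1/3) * (1 + t) powr 1 = (1 + t) powr (4/3)" unfolding powr_add[symmetric] by simp
  finally show ?thesis .
qed

lemma radial_moment_growth:
  assumes t: "0 \<le> t" and k: "2 \<le> k" and K: "radial_moment k w0 \<le> ennreal K" "0 \<le> K"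
  shows "radial_moment k (w t) \<le>
    ennreal ((2 ^ k * K + (2 * ur_const) ^ (k - 2) * P2_const) * (1 + t) powr (4/3 * real k - 2/3))"
proof -
  define \<tau> where "\<tau> = 1 + t"
  have \<tau>: "\<tau> \<ge> 1" using t by (simp add: \<tau>_def)
  let ?A = "ur_const * \<tau> powr (4/3)"
  have A: "0 \<le> ?A" using const_nonneg by simp
  have "radial_moment k (w t) \<le> ennreal (2 ^ k) * radial_moment k w0 + ennreal ((2 * ?A) ^ (k - 2)) * radial_moment 2 (w t)"
    using flow_radius_growth[OF t] A k unfolding \<tau>_def
    by (intro moment_growth[OF X t w[OF t] w0 tr[OF t]]) auto
  also have "\<dots> \<le> ennreal (2 ^ k) * ennreal K + ennreal ((2 * ?A) ^ (k - 2)) * ennreal (P2_const * \<tau>\<^sup>2)"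
    unfolding \<tau>_def by (intro add_mono mult_left_mono K second_moment_growth t) auto
  also have "\<dots> = ennreal (2 ^ k * K + (2 * ?A) ^ (k - 2) * (P2_const * \<tau>\<^sup>2))"
  proof -
    have n: "0 \<le> (2::real) ^ k" "0 \<le> (2 * ?A) ^ (k - 2)" "0 \<le> P2_const * \<tau>\<^sup>2"
      using A const_nonneg by auto
    show ?thesis
      unfolding ennreal_plus[OF mult_nonneg_nonneg[OF n(1) K(2)] mult_nonneg_nonneg[OF n(2,3)]]
        ennreal_mult'[OF n(1)] ennreal_mult'[OF n(2)] ..
  qed
  also have "\<dots> \<le> ennreal ((2 ^ k * K + (2 * ur_const) ^ (k - 2) * P2_const) * \<tau> powr (4/3 * real k - 2/3))"
  proof (rule ennreal_leI)
    let ?e = "4/3 * real k - 2/3"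
    \<comment> \<open>For k \<ge> 2 the exponent is at least 2, so the initial moment is absorbed
      into the growing power.\<close>
    have "1 \<le> \<tau> powr ?e" using \<tau> k by (intro ge_one_powr_ge_zero) auto
    hence "2 ^ k * K * 1 \<le> 2 ^ k * K * \<tau> powr ?e" using K by (intro mult_left_mono) auto
    moreover have "(2 * ?A) ^ (k - 2) * (P2_const * \<tau>\<^sup>2) = (2 * ur_const) ^ (k - 2) * P2_const * \<tau> powr ?e"
    proof -
      have "(\<tau> powr (4/3)) ^ (k - 2) = (\<tau> powr (4/3)) powr real (k - 2)"
        using \<tau> by (intro powr_realpow[symmetric]) simp
      moreover have "\<tau>\<^sup>2 = \<tau> powr 2" using \<tau> by simp
      ultimately have "(\<tau> powr (4/3)) ^ (k - 2) * \<tau>\<^sup>2 = \<tau> powr (4/3 * real (k - 2) + 2)"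
        by (simp only: powr_powr powr_add)
      also have "4/3 * real (k - 2) + 2 = ?e" using k by (simp add: of_nat_diff field_simps)
      finally have "(\<tau> powr (4/3)) ^ (k - 2) * \<tau>\<^sup>2 = \<tau> powr ?e" .
      thus ?thesis by (simp add: power_mult_distrib mult_ac)
    qed
    ultimately show "2 ^ k * K + (2 * ?A) ^ (k - 2) * (P2_const * \<tau>\<^sup>2) \<le>
      (2 ^ k * K + (2 * ur_const) ^ (k - 2) * P2_const) * \<tau> powr ?e"
      unfolding distrib_right by linarith
  qed
  finally show ?thesis by (simp add: \<tau>_def)
qed

lemma Linf_radial_velocity_growth:
  assumes t: "0 \<le> t"
  shows "Linf_norm (ur t \<circ> cyl) \<le> ereal (ur_const * (1 + t) powr (1/3))"
  using radial_velocity_growth[OF t] by (intro Linf_norm_cyl_le ur t AE_I2) simp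

text \<open>The vorticity at the moved particle is its new radius times |\<omega>0/r|. In the bound
  r + displacement for that radius, the first part recombines to |\<omega>0| \<le> W, and the second
  is paid for with M.\<close>

lemma Linf_vorticity_growth:
  assumes t: "0 \<le> t"
  shows "Linf_norm (w t \<circ> cyl) \<le> ereal ((W + ur_const * M) * (1 + t) powr (4/3))"
proof (rule Linf_norm_cyl_le[OF w[OF t]])
  note w[OF t, measurable]
  let ?\<tau> = "(1 + t) powr (4/3)"
  have "AE p in cyl_measure. \<bar>w t (X t p)\<bar> \<le> (W + ur_const * M) * ?\<tau>"
    using tr[OF t] M(1) W(1) AE_space
  proof eventually_elim
    fix p
    assume tr: "rel_vorticity (w t) (X t p) = rel_vorticity w0 p" and M': "\<bar>rel_vorticity w0 p\<bar> \<le> M"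
      and W': "\<bar>w0 p\<bar> \<le> W" and "p \<in> space cyl_measure"
    hence p: "p \<in> open_half_plane" by simp
    hence r: "0 < fst p" by (simp add: open_half_plane_def)
    have x: "0 < fst (X t p)" using particle_flow_in_half_plane[OF X p t] by (simp add: open_half_plane_def)
    have "\<bar>w t (X t p)\<bar> = fst (X t p) * \<bar>rel_vorticity w0 p\<bar>"
      unfolding tr[symmetric] using x by (simp add: rel_vorticity_def abs_divide)
    also have "\<dots> \<le> (fst p + ur_const * ?\<tau>) * \<bar>rel_vorticity w0 p\<bar>"
      by (intro mult_right_mono flow_radius_growth t p) auto
    also have "\<dots> = \<bar>w0 p\<bar> + ur_const * ?\<tau> * \<bar>rel_vorticity w0 p\<bar>"
      using r by (simp add: distrib_right) (simp add: rel_vorticity_def abs_divide)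
    also have "\<dots> \<le> W * ?\<tau> + ur_const * ?\<tau> * M"
    proof (intro add_mono mult_left_mono M')
      have "1 \<le> ?\<tau>" using t by (intro ge_one_powr_ge_zero) auto
      hence "W * 1 \<le> W * ?\<tau>" using W by (intro mult_left_mono) auto
      thus "\<bar>w0 p\<bar> \<le> W * ?\<tau>" using W' by simp
    qed (use const_nonneg in auto)
    finally show "\<bar>w t (X t p)\<bar> \<le> (W + ur_const * M) * ?\<tau>" by (simp add: algebra_simps)
  qed
  thus "AE q in cyl_measure. \<bar>w t q\<bar> \<le> (W + ur_const * M) * ?\<tau>"
    by (intro AE_transported[OF X t, of "\<lambda>q. \<bar>w t q\<bar> \<le> (W + ur_const * M) * ?\<tau>"]) auto
qed

end

end

section \<open>Assembly: one constant for all solutions with the given data\<close>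

theorem theorem1p1:
  fixes ur0 uz0 \<omega>0 :: "real \<times> real \<Rightarrow> real"
  assumes "initial_data ur0 uz0 \<omega>0"
    and "radial_moment 2 \<omega>0 < \<infinity>"
  shows "(\<forall>k::nat. 2 \<le> k \<and> radial_moment k \<omega>0 < \<infinity> \<longrightarrow>
            (\<exists>C::real. \<forall>ur uz \<omega>. axisym_euler_solution ur0 uz0 \<omega>0 ur uz \<omega> \<longrightarrow>
               (\<forall>t\<ge>0. radial_moment k (\<omega> t) \<le>
                  ennreal (C * (1 + t) powr (4 / 3 * real k - 2 / 3))))) \<and>
         (\<exists>C::real. \<forall>ur uz \<omega>. axisym_euler_solution ur0 uz0 \<omega>0 ur uz \<omega> \<longrightarrow>
            (\<forall>t\<ge>0. Linf_norm (ur t \<circ> cyl) \<le> ereal (C * (1 + t) powr (1 / 3)) \<and>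
                    Linf_norm (\<omega> t \<circ> cyl) \<le> ereal (C * (1 + t) powr (4 / 3))))"
proof -
  note data = assms(1)[unfolded initial_data_def]
  have w0 [measurable]: "\<omega>0 \<in> borel_measurable borel" using data by simp
  obtain M where M: "0 \<le> M" "AE p in cyl_measure. \<bar>rel_vorticity \<omega>0 p\<bar> \<le> M"
    using in_Linf_cylD[OF rel_vorticity_borel[OF w0]] data by blast
  obtain W where W: "0 \<le> W" "AE p in cyl_measure. \<bar>\<omega>0 p\<bar> \<le> W"
    using in_Linf_cylD[OF w0] data by blast
  obtain E where E': "0 \<le> E" "kinetic_energy (axisym_velocity ur0 uz0) = ennreal E"
    using kinetic_energy_finite[of "axisym_velocity ur0 uz0"] data
    by (cases "kinetic_energy (axisym_velocity ur0 uz0)") auto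
  have finE: "\<exists>K\<ge>0. radial_moment k \<omega>0 \<le> ennreal K" if "radial_moment k \<omega>0 < \<infinity>" for k
    using that by (cases "radial_moment k \<omega>0") auto
  obtain P where P: "0 \<le> P" "radial_moment 2 \<omega>0 \<le> ennreal P" using finE[OF assms(2)] by blast
  have P0: "radial_moment 0 \<omega>0 < \<infinity>" using data by (intro in_L1_radial_moment) auto
  \<comment> \<open>No solution has been fixed yet, so \<open>P2_const\<close> and
    \<open>ur_const\<close> can serve as witnesses in front of the quantifier over
    solutions.\<close>
  interpret euler_data \<omega>0 E P M W
    by unfold_locales (use M W E' P P0 in auto)
  have sol: "ur t \<in> borel_measurable borel" "\<omega> t \<in> borel_measurable borel" "biot_savart (\<omega> t) (ur t) (uz t)"
    "(\<integral>\<^sup>+ p. ennreal ((ur t p)\<^sup>2) \<partial>cyl_measure) \<le> ennreal E"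
    if "axisym_euler_solution ur0 uz0 \<omega>0 ur uz \<omega>" "0 \<le> t" for ur uz \<omega> t
  proof -
    note s = that(1)[unfolded axisym_euler_solution_def]
    show [measurable]: "ur t \<in> borel_measurable borel" and "\<omega> t \<in> borel_measurable borel" "biot_savart (\<omega> t) (ur t) (uz t)"
      using s that(2) by auto
    have "kinetic_energy (axisym_velocity (ur t) (uz t)) = ennreal E" using s that(2) E'(2) by simp
    thus "(\<integral>\<^sup>+ p. ennreal ((ur t p)\<^sup>2) \<partial>cyl_measure) \<le> ennreal E"
      using radial_energy_le[of "ur t" "uz t"] by simp
  qed
  have flow: "\<exists>X. particle_flow ur uz X \<and> (\<forall>t\<ge>0. AE p in cyl_measure. rel_vorticity (\<omega> t) (X t p) = rel_vorticity \<omega>0 p)"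
    if "axisym_euler_solution ur0 uz0 \<omega>0 ur uz \<omega>" for ur uz \<omega>
    using that unfolding axisym_euler_solution_def by blast
  show ?thesis
  proof (intro conjI allI impI)
    fix k :: nat assume k: "2 \<le> k \<and> radial_moment k \<omega>0 < \<infinity>"
    then obtain K where K: "0 \<le> K" "radial_moment k \<omega>0 \<le> ennreal K" using finE by blast
    show "\<exists>C::real. \<forall>ur uz \<omega>. axisym_euler_solution ur0 uz0 \<omega>0 ur uz \<omega> \<longrightarrow>
       (\<forall>t\<ge>0. radial_moment k (\<omega> t) \<le> ennreal (C * (1 + t) powr (4 / 3 * real k - 2 / 3)))"
    proof (intro exI allI impI)
      fix ur uz \<omega> and t :: real
      assume s: "axisym_euler_solution ur0 uz0 \<omega>0 ur uz \<omega>" and t: "0 \<le> t"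
      obtain X where X: "particle_flow ur uz X"
        "\<And>t. 0 \<le> t \<Longrightarrow> AE p in cyl_measure. rel_vorticity (\<omega> t) (X t p) = rel_vorticity \<omega>0 p"
        using flow[OF s] by blast
      show "radial_moment k (\<omega> t) \<le> ennreal ((2 ^ k * K + (2 * ur_const) ^ (k - 2) * P2_const) * (1 + t) powr (4 / 3 * real k - 2 / 3))"
        using k by (intro radial_moment_growth[OF sol(1)[OF s] sol(2)[OF s] sol(3)[OF s] X sol(4)[OF s] t _ K(2,1)]) auto
    qed
  next
    \<comment> \<open>A single constant has to serve both bounds; the sum dominates each summand
      because both are nonnegative.\<close>
    define C where "C = ur_const + (W + ur_const * M)"
    have C: "ur_const \<le> C" "W + ur_const * M \<le> C" using const_nonneg W M by (auto simp: C_def)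
    show "\<exists>C::real. \<forall>ur uz \<omega>. axisym_euler_solution ur0 uz0 \<omega>0 ur uz \<omega> \<longrightarrow>
       (\<forall>t\<ge>0. Linf_norm (ur t \<circ> cyl) \<le> ereal (C * (1 + t) powr (1 / 3)) \<and>
               Linf_norm (\<omega> t \<circ> cyl) \<le> ereal (C * (1 + t) powr (4 / 3)))"
    proof (intro exI allI impI conjI)
      fix ur uz \<omega> and t :: real
      assume s: "axisym_euler_solution ur0 uz0 \<omega>0 ur uz \<omega>" and t: "0 \<le> t"
      obtain X where X: "particle_flow ur uz X"
        "\<And>t. 0 \<le> t \<Longrightarrow> AE p in cyl_measure. rel_vorticity (\<omega> t) (X t p) = rel_vorticity \<omega>0 p"
        using flow[OF s] by blast
      note hyps = sol(1)[OF s] sol(2)[OF s] sol(3)[OF s] X sol(4)[OF s] t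
      show "Linf_norm (ur t \<circ> cyl) \<le> ereal (C * (1 + t) powr (1 / 3))"
        using C(1) by (intro order_trans[OF Linf_radial_velocity_growth[OF hyps]]) (auto intro!: mult_right_mono)
      show "Linf_norm (\<omega> t \<circ> cyl) \<le> ereal (C * (1 + t) powr (4 / 3))"
        using C(2) by (intro order_trans[OF Linf_vorticity_growth[OF hyps]]) (auto intro!: mult_right_mono)
    qed
  qed
qed

end
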